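(* Let $0\le\theta\le\pi/2$ and for $\epsilon>0$ let $S_\epsilon(z)=\epsilon S(z/\epsilon)$ and $K_\epsilon(z)=\epsilon K(z/\epsilon)$, where $S(z)=z+\frac1z$ and $$K(z)=z\Big(1-\frac{e^{2i\theta}}{z^2}\Big)^{1/2}\Big(1-\frac{e^{-2i\theta}}{z^2}\Big)^{1/2}.$$ (1) The composition $S_\epsilon(K_\epsilon^{-1}(w))$ is a family in $\epsilon^2$ varying from the identity, with first and second variation cocycles (first and second derivatives in the parameter $\epsilon^2$ at $0$) $$\frac{1+\cos2\theta}{w}\frac{d}{dw}\qquad\text{and}\qquad\frac{-1-4\cos2\theta+\cos4\theta-4\cos^22\theta}{2w^3}\frac{d}{dw}.$$ (2) The pushforward of the differential $\omega=w\,dw$ by $S_\epsilon(K_\epsilon^{-1})$ extends to a holomorphic differential on $\mathbb C$ with a simple zero at the origin. (3) If the construction is performed in a coordinate $w$ in a small disc on a compact Riemann surface $R$ in which an Abelian differential has the normal form $w\,dw$, the deformation of the differential is isoperiodic (the periods are not changed), and the integral norm of the differential is not changed.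
   Context: $S$ is the Riemann mapping from $\{|z|>1\}$ to the complement of the segment $[-2,2]$. $K$ (branch with $K(z)\sim z$ at infinity) is the Riemann mapping from $\{|z|>1\}$ to the complement of a horizontal-vertical skean: the union of a horizontal and a vertical segment, each centered at the origin; the points $e^{\pm i\theta},-e^{\pm i\theta}$ are the preimages of the origin on the unit circle. $S_\epsilon,K_\epsilon$ have domain $\{|z|>\epsilon\}$; the composition maps the complement of the scaled skean $\Sigma_\epsilon$ onto the complement of $\{\zeta\mid-2\epsilon\le\Re\zeta\le2\epsilon,\ \Im\zeta=0\}$. Pushforward means pullback by the inverse of the (injective) map, a priori defined on the complement of the image slit. A holomorphic family $A_\epsilon(w)$ with $A_0(w)=w$, holomorphic away from a small neighborhood of $w=0$, has variation cocycles the vector fields $\dot A(w)\frac{d}{dw}$ and $\ddot A(w)\frac{d}{dw}$ (derivatives in the indicated parameter at value $0$) on an annulus around $w=0$. Construction on a surface: with $A_\epsilon=S_\epsilon\circ K_\epsilon^{-1}$, $\epsilon$ small and $\Sigma_\epsilon$ contained in a disc $\{|w|<\rho\}$ of the coordinate, the deformed surface is obtained by cutting $R$ open along $\Sigma_\epsilon$ and regluing the slit edges via $A_\epsilon$, i.e. $\{|w|<\rho\}\setminus\Sigma_\epsilon$ is identified by $\zeta=A_\epsilon(w)$ with its image in the $\zeta$-plane and the image slit is filled in. The deformed differential is the extension of the original differential on $R\setminus\Sigma_\epsilon$. Periods are compared on cycles disjoint from the disc; the integral norm of $\omega$ is $\frac i2\int\omega\wedge\overline{\omega}$. *)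

theory Defs
  imports "HOL-Complex_Analysis.Complex_Analysis"
begin

section \<open>The planar maps\<close>

definition S_map :: "real \<Rightarrow> complex \<Rightarrow> complex" where
  "S_map \<epsilon> z = complex_of_real \<epsilon> * (let u = z / complex_of_real \<epsilon> in u + 1 / u)"

text \<open>
  For \<open>norm u > 1\<close> both radicands lie in the open right half plane, so the principal
  square roots give the branch that is holomorphic there and asymptotic to \<open>u\<close> at infinity.
\<close>

definition K_map :: "real \<Rightarrow> real \<Rightarrow> complex \<Rightarrow> complex" where
  "K_map \<theta> \<epsilon> z = complex_of_real \<epsilon> *
     (let u = z / complex_of_real \<epsilon> in
        u * csqrt (1 - exp (2 * \<i> * complex_of_real \<theta>) / u\<^sup>2)
          * csqrt (1 - exp (- 2 * \<i> * complex_of_real \<theta>) / u\<^sup>2))"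

definition outer_domain :: "real \<Rightarrow> complex set" where
  "outer_domain \<epsilon> = {z. norm z > \<epsilon>}"

definition slit :: "real \<Rightarrow> complex set" where
  "slit \<epsilon> = {\<zeta>. - 2 * \<epsilon> \<le> Re \<zeta> \<and> Re \<zeta> \<le> 2 * \<epsilon> \<and> Im \<zeta> = 0}"

text \<open>
  The half-lengths come from \<open>(K z)\<^sup>2 = z\<^sup>2 + 1 / z\<^sup>2 - 2 cos 2\<theta>\<close>, which on the unit circle
  sweeps out the real interval from \<open>- 4 (cos \<theta>)\<^sup>2\<close> to \<open>4 (sin \<theta>)\<^sup>2\<close>.
\<close>

definition skean :: "real \<Rightarrow> real \<Rightarrow> complex set" where
  "skean \<theta> \<epsilon> =
     {w. Im w = 0 \<and> \<bar>Re w\<bar> \<le> 2 * \<epsilon> * sin \<theta>} \<union> {w. Re w = 0 \<and> \<bar>Im w\<bar> \<le> 2 * \<epsilon> * cos \<theta>}"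

definition riemann_mapping :: "(complex \<Rightarrow> complex) \<Rightarrow> complex set \<Rightarrow> complex set \<Rightarrow> bool" where
  "riemann_mapping f U V \<longleftrightarrow> f holomorphic_on U \<and> bij_betw f U V"

definition skean_to_slit :: "real \<Rightarrow> real \<Rightarrow> complex \<Rightarrow> complex" where
  "skean_to_slit \<theta> \<epsilon> w = S_map \<epsilon> (inv_into (outer_domain \<epsilon>) (K_map \<theta> \<epsilon>) w)"


section \<open>Families varying from the identity\<close>

text \<open>
  The excluded neighbourhood of \<open>w = 0\<close> may be taken arbitrarily small, at the price of
  shrinking the parameter disc.
\<close>

definition holomorphic_family_from_identity :: "(complex \<Rightarrow> complex \<Rightarrow> complex) \<Rightarrow> bool" where
  "holomorphic_family_from_identity F \<longleftrightarrow>
     (\<forall>w. w \<noteq> 0 \<longrightarrow> F 0 w = w) \<and>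
     (\<forall>\<delta>>0. \<exists>r>0.
        continuous_on (ball 0 r \<times> {w. norm w > \<delta>}) (\<lambda>(t, w). F t w) \<and>
        (\<forall>w. norm w > \<delta> \<longrightarrow> (\<lambda>t. F t w) holomorphic_on ball 0 r) \<and>
        (\<forall>t\<in>ball 0 r. F t holomorphic_on {w. norm w > \<delta>}))"

text \<open>A vector field \<open>v(w) d/dw\<close> is represented by its coefficient \<open>v\<close>.\<close>

definition first_variation :: "(complex \<Rightarrow> complex \<Rightarrow> complex) \<Rightarrow> complex \<Rightarrow> complex" where
  "first_variation F w = deriv (\<lambda>t. F t w) 0"

definition second_variation :: "(complex \<Rightarrow> complex \<Rightarrow> complex) \<Rightarrow> complex \<Rightarrow> complex" where
  "second_variation F w = (deriv ^^ 2) (\<lambda>t. F t w) 0"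

text \<open>A planar differential \<open>f(w) dw\<close> is represented by its coefficient \<open>f\<close>.\<close>

definition pushforward ::
    "(complex \<Rightarrow> complex) \<Rightarrow> complex set \<Rightarrow> (complex \<Rightarrow> complex) \<Rightarrow> complex \<Rightarrow> complex" where
  "pushforward A U f \<zeta> = f (inv_into U A \<zeta>) * deriv (inv_into U A) \<zeta>"


section \<open>Riemann surfaces and Abelian differentials\<close>

text \<open>
  A chart is a domain together with a coordinate function, whose values outside the domain are
  irrelevant. Atlases may be, but need not be, maximal.
\<close>

type_synonym 'a chart = "'a set \<times> ('a \<Rightarrow> complex)"

definition chart_on :: "'a topology \<Rightarrow> 'a chart \<Rightarrow> bool" where
  "chart_on X c \<longleftrightarrow> openin X (fst c) \<and> open (snd c ` fst c) \<and>
     homeomorphic_map (subtopology X (fst c)) (top_of_set (snd c ` fst c)) (snd c)"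

definition transition :: "'a chart \<Rightarrow> 'a chart \<Rightarrow> complex \<Rightarrow> complex" where
  "transition c d z = snd d (inv_into (fst c) (snd c) z)"

definition riemann_surface :: "'a topology \<Rightarrow> 'a chart set \<Rightarrow> bool" where
  "riemann_surface X \<A> \<longleftrightarrow>
     Hausdorff_space X \<and> connected_space X \<and>
     (\<forall>c\<in>\<A>. chart_on X c) \<and> topspace X = (\<Union>c\<in>\<A>. fst c) \<and>
     (\<forall>c\<in>\<A>. \<forall>d\<in>\<A>. transition c d holomorphic_on snd c ` (fst c \<inter> fst d))"

definition compact_riemann_surface :: "'a topology \<Rightarrow> 'a chart set \<Rightarrow> bool" where
  "compact_riemann_surface X \<A> \<longleftrightarrow> riemann_surface X \<A> \<and> compact_space X"

text \<open>
  A differential is given by its coefficients: \<open>\<omega> c\<close> is the function \<open>f\<close> such that the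
  differential is \<open>f(z) dz\<close> in the coordinate \<open>z\<close> of the chart \<open>c\<close>.
\<close>

definition abelian_differential :: "'a chart set \<Rightarrow> ('a chart \<Rightarrow> complex \<Rightarrow> complex) \<Rightarrow> bool" where
  "abelian_differential \<A> \<omega> \<longleftrightarrow>
     (\<forall>c\<in>\<A>. \<omega> c holomorphic_on snd c ` fst c) \<and>
     (\<forall>c\<in>\<A>. \<forall>d\<in>\<A>. \<forall>z \<in> snd c ` (fst c \<inter> fst d).
        \<omega> c z = \<omega> d (transition c d z) * deriv (transition c d) z)"

definition piecewise_C1_path :: "'a topology \<Rightarrow> 'a chart set \<Rightarrow> (real \<Rightarrow> 'a) \<Rightarrow> bool" where
  "piecewise_C1_path X \<A> \<gamma> \<longleftrightarrow> pathin X \<gamma> \<and>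
     (\<forall>c\<in>\<A>. \<forall>a b. 0 \<le> a \<and> a \<le> b \<and> b \<le> 1 \<and> \<gamma> ` {a..b} \<subseteq> fst c \<longrightarrow>
        (snd c \<circ> \<gamma>) piecewise_C1_differentiable_on {a..b})"

text \<open>
  The value of \<open>\<omega>\<close> on the velocity of \<open>\<gamma>\<close> at time \<open>t\<close>. By the transformation rule it does not
  depend on the chart chosen, except at the finitely many break points of \<open>\<gamma>\<close>.
\<close>

definition velocity_pairing ::
    "'a chart set \<Rightarrow> ('a chart \<Rightarrow> complex \<Rightarrow> complex) \<Rightarrow> (real \<Rightarrow> 'a) \<Rightarrow> real \<Rightarrow> complex" where
  "velocity_pairing \<A> \<omega> \<gamma> t =
     (let c = (SOME c. c \<in> \<A> \<and> \<gamma> t \<in> fst c)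
      in \<omega> c (snd c (\<gamma> t)) * vector_derivative (snd c \<circ> \<gamma>) (at t within {0..1}))"

definition path_integral ::
    "'a chart set \<Rightarrow> ('a chart \<Rightarrow> complex \<Rightarrow> complex) \<Rightarrow> (real \<Rightarrow> 'a) \<Rightarrow> complex" where
  "path_integral \<A> \<omega> \<gamma> = integral {0..1} (velocity_pairing \<A> \<omega> \<gamma>)"

text \<open>A chain is a formal integer combination of paths; a cycle is a chain with zero boundary.\<close>

type_synonym 'a chain = "(int \<times> (real \<Rightarrow> 'a)) list"

definition cycle :: "'a topology \<Rightarrow> 'a chart set \<Rightarrow> 'a chain \<Rightarrow> bool" where
  "cycle X \<A> C \<longleftrightarrow> (\<forall>(n, \<gamma>)\<in>set C. piecewise_C1_path X \<A> \<gamma>) \<and>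
     (\<forall>p. (\<Sum>(n, \<gamma>)\<leftarrow>C. n * (of_bool (\<gamma> 1 = p) - of_bool (\<gamma> 0 = p))) = 0)"

definition period ::
    "'a chart set \<Rightarrow> ('a chart \<Rightarrow> complex \<Rightarrow> complex) \<Rightarrow> 'a chain \<Rightarrow> complex" where
  "period \<A> \<omega> C = (\<Sum>(n, \<gamma>)\<leftarrow>C. of_int n * path_integral \<A> \<omega> \<gamma>)"

text \<open>
  A 2-form \<open>\<eta>\<close> is given by its coefficients with respect to \<open>dx \<and> dy\<close> in the charts. It is
  integrated by decomposing the surface into finitely many disjoint measurable pieces, each
  inside a chart. For genuine 2-forms the value does not depend on the decomposition.
\<close>

definition has_surface_integral ::
    "'a topology \<Rightarrow> 'a chart set \<Rightarrow> ('a chart \<Rightarrow> complex \<Rightarrow> complex) \<Rightarrow> complex \<Rightarrow> bool" where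
  "has_surface_integral X \<A> \<eta> I \<longleftrightarrow>
     (\<exists>(n::nat) (c :: nat \<Rightarrow> 'a chart) (E :: nat \<Rightarrow> 'a set).
        (\<forall>i<n. c i \<in> \<A> \<and> E i \<subseteq> fst (c i) \<and> snd (c i) ` E i \<in> sets lebesgue \<and>
                set_integrable lebesgue (snd (c i) ` E i) (\<eta> (c i))) \<and>
        disjoint_family_on E {..<n} \<and> (\<Union>i<n. E i) = topspace X \<and>
        I = (\<Sum>i<n. set_lebesgue_integral lebesgue (snd (c i) ` E i) (\<eta> (c i))))"

definition surface_integral ::
    "'a topology \<Rightarrow> 'a chart set \<Rightarrow> ('a chart \<Rightarrow> complex \<Rightarrow> complex) \<Rightarrow> complex" where
  "surface_integral X \<A> \<eta> = (THE I. has_surface_integral X \<A> \<eta> I)"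

text \<open>\<open>f dz \<and> cnj (f dz) = f * cnj f * dz \<and> cnj dz\<close>, and \<open>dz \<and> cnj dz = - 2 \<i> dx \<and> dy\<close>.\<close>

definition wedge_cnj ::
    "('a chart \<Rightarrow> complex \<Rightarrow> complex) \<Rightarrow> 'a chart \<Rightarrow> complex \<Rightarrow> complex" where
  "wedge_cnj \<omega> c z = - 2 * \<i> * (\<omega> c z * cnj (\<omega> c z))"

definition integral_norm ::
    "'a topology \<Rightarrow> 'a chart set \<Rightarrow> ('a chart \<Rightarrow> complex \<Rightarrow> complex) \<Rightarrow> complex" where
  "integral_norm X \<A> \<omega> = \<i> / 2 * surface_integral X \<A> (wedge_cnj \<omega>)"


section \<open>Cutting open along the skean and regluing\<close>

definition coord_preimage :: "'a chart \<Rightarrow> complex set \<Rightarrow> 'a set" where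
  "coord_preimage c B = {p \<in> fst c. snd c p \<in> B}"

definition filled_image_disc :: "real \<Rightarrow> real \<Rightarrow> real \<Rightarrow> complex set" where
  "filled_image_disc \<theta> \<epsilon> \<rho> = skean_to_slit \<theta> \<epsilon> ` (ball 0 \<rho> - skean \<theta> \<epsilon>) \<union> slit \<epsilon>"

text \<open>
  The points of the deformed surface are the points of \<open>X\<close> off the skean (tagged \<open>Inl\<close>) and the
  points of the image slit (tagged \<open>Inr\<close>). The filled image disc in the \<open>\<zeta>\<close>-plane maps to it by
  identifying \<open>\<zeta> = skean_to_slit \<theta> \<epsilon> w\<close> with the point of coordinate \<open>w\<close>; the topology is the
  quotient topology from the disjoint union of \<open>X\<close> minus the skean and the filled image disc.
\<close>

definition glue_disc :: "'a chart \<Rightarrow> real \<Rightarrow> real \<Rightarrow> complex \<Rightarrow> 'a + complex" where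
  "glue_disc c \<theta> \<epsilon> \<zeta> =
     (if \<zeta> \<in> slit \<epsilon> then Inr \<zeta>
      else Inl (inv_into (fst c) (snd c) (inv_into (- skean \<theta> \<epsilon>) (skean_to_slit \<theta> \<epsilon>) \<zeta>)))"

definition deformed_points ::
    "'a topology \<Rightarrow> 'a chart \<Rightarrow> real \<Rightarrow> real \<Rightarrow> ('a + complex) set" where
  "deformed_points X c \<theta> \<epsilon> =
     Inl ` (topspace X - coord_preimage c (skean \<theta> \<epsilon>)) \<union> Inr ` slit \<epsilon>"

definition deformed_surface ::
    "'a topology \<Rightarrow> 'a chart \<Rightarrow> real \<Rightarrow> real \<Rightarrow> real \<Rightarrow> ('a + complex) topology" where
  "deformed_surface X c \<theta> \<epsilon> \<rho> = topology (\<lambda>V.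
     V \<subseteq> deformed_points X c \<theta> \<epsilon> \<and>
     openin (subtopology X (topspace X - coord_preimage c (skean \<theta> \<epsilon>))) (Inl -` V) \<and>
     openin (top_of_set (filled_image_disc \<theta> \<epsilon> \<rho>))
            {\<zeta> \<in> filled_image_disc \<theta> \<epsilon> \<rho>. glue_disc c \<theta> \<epsilon> \<zeta> \<in> V})"

definition restricted_chart ::
    "'a chart \<Rightarrow> real \<Rightarrow> real \<Rightarrow> 'a chart \<Rightarrow> ('a + complex) chart" where
  "restricted_chart c \<theta> \<epsilon> d =
     (Inl ` (fst d - coord_preimage c (skean \<theta> \<epsilon>)), snd d \<circ> projl)"

definition zeta_chart :: "'a chart \<Rightarrow> real \<Rightarrow> real \<Rightarrow> real \<Rightarrow> ('a + complex) chart" where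
  "zeta_chart c \<theta> \<epsilon> \<rho> =
     (glue_disc c \<theta> \<epsilon> ` filled_image_disc \<theta> \<epsilon> \<rho>,
      case_sum (\<lambda>p. skean_to_slit \<theta> \<epsilon> (snd c p)) (\<lambda>\<zeta>. \<zeta>))"

definition deformed_atlas ::
    "'a chart set \<Rightarrow> 'a chart \<Rightarrow> real \<Rightarrow> real \<Rightarrow> real \<Rightarrow> ('a + complex) chart set" where
  "deformed_atlas \<A> c \<theta> \<epsilon> \<rho> =
     insert (zeta_chart c \<theta> \<epsilon> \<rho>) (restricted_chart c \<theta> \<epsilon> ` \<A>)"

definition deformed_differential ::
    "'a chart set \<Rightarrow> ('a chart \<Rightarrow> complex \<Rightarrow> complex) \<Rightarrow> 'a chart \<Rightarrow> real \<Rightarrow> real \<Rightarrow> real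
     \<Rightarrow> (('a + complex) chart \<Rightarrow> complex \<Rightarrow> complex) \<Rightarrow> bool" where
  "deformed_differential \<A> \<omega> c \<theta> \<epsilon> \<rho> \<omega>' \<longleftrightarrow>
     abelian_differential (deformed_atlas \<A> c \<theta> \<epsilon> \<rho>) \<omega>' \<and>
     (\<forall>d\<in>\<A>. \<forall>z \<in> snd d ` (fst d - coord_preimage c (skean \<theta> \<epsilon>)).
        \<omega>' (restricted_chart c \<theta> \<epsilon> d) z = \<omega> d z)"

definition transported_chain :: "'a chain \<Rightarrow> ('a + complex) chain" where
  "transported_chain C = map (\<lambda>(n, \<gamma>). (n, Inl \<circ> \<gamma>)) C"

end

(* All maps are square roots: S(z)^2 = K(z)^2 + 4 (cos \<theta>)^2, so S_\<epsilon> composed with the inverse of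
   K_\<epsilon> is the branch of \<zeta> = sqrt (w^2 + k) asymptotic to w, with k = 4 \<epsilon>^2 (cos \<theta>)^2. The
   variation cocycles are its Taylor coefficients in \<epsilon>^2, and \<zeta>^2 = w^2 + k gives w dw = \<zeta> d\<zeta>.
   The skean and the slit are the preimages under squaring of real intervals that differ by the
   translation by k, and the filled image disc is the Cassini domain |\<zeta>^2 - k| < \<rho>^2. Periods agree
   because nothing changes off the disc. The integral norms agree because any decomposition used to
   integrate over one surface can be carried over to the other after discarding the null sets
   skean and slit, by the change of variables formula for \<zeta>. *)

theory Submission
  imports Defs
begin

section \<open>The planar maps\<close>

text \<open>The branch is the obstacle. The principal root of \<open>w\<^sup>2 + k\<close> would be
  cut along unbounded rays, so \<open>w\<close> is pulled out:
  \<open>w * csqrt (1 + k / w\<^sup>2)\<close> is cut only where \<open>w\<^sup>2\<close> lies on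
  the segment from \<open>0\<close> to \<open>- k\<close>. For the relevant \<open>k\<close> this
  cut lies inside the skean, and for the opposite sign inside the slit, so one formula gives both
  the map and its inverse. It is also homogeneous, which reduces every \<epsilon> to \<epsilon> = 1.
  That K follows this branch is not visible from squares, which leave a sign; connectedness of the
  outer domain and one explicit value settle it. On the surface, a disc slightly smaller than the
  given one but still containing the skean supplies the room for Hausdorff separation and
  compactness. The integral is a definite description, so the relations
  \<open>has_surface_integral\<close> of the two surfaces are shown to coincide, rather than two
  values to be equal. The two inclusions are of unequal depth: only pieces given in the \<zeta>
  coordinate call for a change of variables.\<close>

definition quad_shift :: "complex \<Rightarrow> complex \<Rightarrow> complex" where
  "quad_shift k w = w * csqrt (1 + k / w\<^sup>2)"

lemma quad_shift_power2: "w \<noteq> 0 \<Longrightarrow> (quad_shift k w)\<^sup>2 = w\<^sup>2 + k"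
  by (simp add: quad_shift_def power_mult_distrib field_simps)

lemma quad_shift_0 [simp]: "quad_shift 0 w = w"
  by (simp add: quad_shift_def)

lemma quad_shift_eq_0_iff:
  assumes "1 + k / w\<^sup>2 \<notin> \<real>\<^sub>\<le>\<^sub>0" shows "quad_shift k w = 0 \<longleftrightarrow> w = 0"
  using assms by (auto simp: quad_shift_def)

text \<open>The two radicands are reciprocal, because
  \<open>1 - k / (w\<^sup>2 + k) = 1 / (1 + k / w\<^sup>2)\<close>. Off the nonpositive axis the
  principal root respects inversion, so the root factors cancel.\<close>

lemma quad_shift_inverse:
  assumes "w \<noteq> 0" and k: "1 + k / w\<^sup>2 \<notin> \<real>\<^sub>\<le>\<^sub>0"
  shows "quad_shift (- k) (quad_shift k w) = w"
proof -
  have nz: "w\<^sup>2 + k \<noteq> 0"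
    using quad_shift_eq_0_iff[OF k] assms(1) quad_shift_power2[OF assms(1), of k] by auto
  have "1 + - k / (quad_shift k w)\<^sup>2 = inverse (1 + k / w\<^sup>2)"
    using nz assms(1) by (simp add: quad_shift_power2 field_simps)
  then show ?thesis
    using k csqrt_eq_0[of "1 + k / w\<^sup>2"]
    by (cases "1 + k / w\<^sup>2 = 0") (simp_all add: quad_shift_def[of "- k"] csqrt_inverse, simp add: quad_shift_def)
qed

lemma quad_shift_scale:
  "e \<noteq> 0 \<Longrightarrow> quad_shift (e\<^sup>2 * k) (e * w) = e * quad_shift k w"
  by (simp add: quad_shift_def power_mult_distrib)

lemma holomorphic_on_quad_shift:
  assumes "\<And>w. w \<in> U \<Longrightarrow> w \<noteq> 0 \<and> 1 + k / w\<^sup>2 \<notin> \<real>\<^sub>\<le>\<^sub>0"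
  shows "quad_shift k holomorphic_on U"
  unfolding quad_shift_def using assms by (intro holomorphic_intros) auto

text \<open>Locates the branch cut: a radicand \<open>r \<le> 0\<close> means
  \<open>w\<^sup>2 = - k / (1 - r)\<close>, and \<open>t = 1 / (1 - r)\<close> stays in the unit
  interval.\<close>

lemma quad_shift_radicand_nonpos:
  assumes "w \<noteq> 0" "1 + complex_of_real k / w\<^sup>2 \<in> \<real>\<^sub>\<le>\<^sub>0"
  shows "\<exists>t. 0 \<le> t \<and> t \<le> 1 \<and> w\<^sup>2 = complex_of_real (- t * k)"
proof -
  obtain r where r: "1 + complex_of_real k / w\<^sup>2 = complex_of_real r" "r \<le> 0"
    using assms(2) by (auto elim!: nonpos_Reals_cases)
  have "complex_of_real k / w\<^sup>2 = complex_of_real (r - 1)"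
    using r(1) by (simp add: algebra_simps)
  then have "complex_of_real k = complex_of_real (r - 1) * w\<^sup>2"
    using assms(1) by (simp add: field_simps)
  then have "w\<^sup>2 = complex_of_real k / complex_of_real (r - 1)"
    using r(2) by (simp del: of_real_diff)
  also have "\<dots> = complex_of_real (- (1 / (1 - r)) * k)"
    using r(2) by (simp add: field_simps flip: of_real_diff of_real_divide of_real_minus)
  finally show ?thesis
    using r(2) by (intro exI[of _ "1 / (1 - r)"]) auto
qed

section \<open>Slit and skean as preimages under squaring\<close>

lemma power2_eq_of_real_iff:
  "z\<^sup>2 = complex_of_real r \<longleftrightarrow> Im z = 0 \<and> (Re z)\<^sup>2 = r \<or> Re z = 0 \<and> (Im z)\<^sup>2 = - r"
  by (auto simp: complex_eq_iff power2_eq_square)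

text \<open>The difference of the squares of S and K. For \<epsilon> = 1 it is \<open>(z + 1 /
  z)\<^sup>2 - (z\<^sup>2 + 1 / z\<^sup>2 - 2 cos 2\<theta>) = 2 + 2 cos 2\<theta> = 4 (cos
  \<theta>)\<^sup>2\<close>.\<close>

definition quad_const :: "real \<Rightarrow> real \<Rightarrow> real" where
  "quad_const \<theta> \<epsilon> = 4 * \<epsilon>\<^sup>2 * (cos \<theta>)\<^sup>2"

lemma quad_const_ge_0: "0 \<le> quad_const \<theta> \<epsilon>"
  and quad_const_le: "quad_const \<theta> \<epsilon> \<le> 4 * \<epsilon>\<^sup>2"
proof -
  show "0 \<le> quad_const \<theta> \<epsilon>"
    by (simp add: quad_const_def)
  have "(cos \<theta>)\<^sup>2 \<le> 1"
    by (simp add: abs_square_le_1)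
  then show "quad_const \<theta> \<epsilon> \<le> 4 * \<epsilon>\<^sup>2"
    using mult_left_le[of "(cos \<theta>)\<^sup>2" "4 * \<epsilon>\<^sup>2"] by (simp add: quad_const_def)
qed

lemma slit_iff_power2:
  assumes "0 < \<epsilon>"
  shows "z \<in> slit \<epsilon> \<longleftrightarrow> z\<^sup>2 \<in> complex_of_real ` {0..4 * \<epsilon>\<^sup>2}"
proof -
  have sq: "\<bar>x\<bar> \<le> 2 * \<epsilon> \<longleftrightarrow> x\<^sup>2 \<le> 4 * \<epsilon>\<^sup>2" for x :: real
    using abs_le_square_iff[of x "2 * \<epsilon>"] assms by (simp add: power_mult_distrib)
  have "z \<in> slit \<epsilon> \<longleftrightarrow> Im z = 0 \<and> \<bar>Re z\<bar> \<le> 2 * \<epsilon>"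
    by (auto simp: slit_def)
  also have "\<dots> \<longleftrightarrow> (\<exists>r. 0 \<le> r \<and> r \<le> 4 * \<epsilon>\<^sup>2 \<and> z\<^sup>2 = complex_of_real r)"
  proof
    assume "Im z = 0 \<and> \<bar>Re z\<bar> \<le> 2 * \<epsilon>"
    then show "\<exists>r. 0 \<le> r \<and> r \<le> 4 * \<epsilon>\<^sup>2 \<and> z\<^sup>2 = complex_of_real r"
      unfolding sq power2_eq_of_real_iff by (intro exI[of _ "(Re z)\<^sup>2"]) simp
  next
    assume "\<exists>r. 0 \<le> r \<and> r \<le> 4 * \<epsilon>\<^sup>2 \<and> z\<^sup>2 = complex_of_real r"
    then obtain r where r: "0 \<le> r" "r \<le> 4 * \<epsilon>\<^sup>2" and "z\<^sup>2 = complex_of_real r"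
      by blast
    then consider "Im z = 0" "(Re z)\<^sup>2 = r" | "Re z = 0" "(Im z)\<^sup>2 = - r"
      unfolding power2_eq_of_real_iff by blast
    then show "Im z = 0 \<and> \<bar>Re z\<bar> \<le> 2 * \<epsilon>"
    proof cases
      case 1
      then show ?thesis using r unfolding sq by simp
    next
      case 2
      then have "(Im z)\<^sup>2 \<le> 0" using r by simp
      then have "Im z = 0" by simp
      then show ?thesis using 2(1) assms by simp
    qed
  qed
  finally show ?thesis
    by (auto simp: image_iff)
qed

text \<open>The sign of \<open>w\<^sup>2\<close> selects the arm: nonnegative squares belong to the
  horizontal one, nonpositive squares to the vertical one. The end points are \<open>(2 \<epsilon>
  sin \<theta>)\<^sup>2 = 4 \<epsilon>\<^sup>2 - k\<close> and
  \<open>- (2 \<epsilon> cos \<theta>)\<^sup>2 = - k\<close>.\<close>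

lemma skean_iff_power2:
  assumes "0 < \<epsilon>" "0 \<le> \<theta>" "\<theta> \<le> pi / 2"
  shows "w \<in> skean \<theta> \<epsilon> \<longleftrightarrow>
         w\<^sup>2 \<in> complex_of_real ` {- quad_const \<theta> \<epsilon>..4 * \<epsilon>\<^sup>2 - quad_const \<theta> \<epsilon>}"
proof -
  have sc: "0 \<le> sin \<theta>" "0 \<le> cos \<theta>"
    using assms by (auto intro!: sin_ge_zero cos_ge_zero)
  have sq: "\<bar>x\<bar> \<le> 2 * \<epsilon> * sin \<theta> \<longleftrightarrow> x\<^sup>2 \<le> 4 * \<epsilon>\<^sup>2 - quad_const \<theta> \<epsilon>"
      "\<bar>x\<bar> \<le> 2 * \<epsilon> * cos \<theta> \<longleftrightarrow> x\<^sup>2 \<le> quad_const \<theta> \<epsilon>" for x :: real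
    using abs_le_square_iff[of x "2 * \<epsilon> * sin \<theta>"] abs_le_square_iff[of x "2 * \<epsilon> * cos \<theta>"] assms sc
    by (simp_all add: power_mult_distrib quad_const_def sin_squared_eq algebra_simps)
  have le: "- quad_const \<theta> \<epsilon> \<le> x\<^sup>2" "- x\<^sup>2 \<le> 4 * \<epsilon>\<^sup>2 - quad_const \<theta> \<epsilon>" for x
    using quad_const_ge_0[of \<theta> \<epsilon>] quad_const_le[of \<theta> \<epsilon>] zero_le_power2[of x] by linarith+
  have "w \<in> skean \<theta> \<epsilon> \<longleftrightarrow>
        (\<exists>r. - quad_const \<theta> \<epsilon> \<le> r \<and> r \<le> 4 * \<epsilon>\<^sup>2 - quad_const \<theta> \<epsilon> \<and> w\<^sup>2 = complex_of_real r)"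
    unfolding skean_def mem_Collect_eq Un_iff sq power2_eq_of_real_iff
  proof (intro iffI; elim disjE conjE exE)
    assume "Im w = 0" "(Re w)\<^sup>2 \<le> 4 * \<epsilon>\<^sup>2 - quad_const \<theta> \<epsilon>"
    then show "\<exists>r. - quad_const \<theta> \<epsilon> \<le> r \<and> r \<le> 4 * \<epsilon>\<^sup>2 - quad_const \<theta> \<epsilon> \<and>
        (Im w = 0 \<and> (Re w)\<^sup>2 = r \<or> Re w = 0 \<and> (Im w)\<^sup>2 = - r)"
      using le(1) by blast
  next
    assume "Re w = 0" "(Im w)\<^sup>2 \<le> quad_const \<theta> \<epsilon>"
    then show "\<exists>r. - quad_const \<theta> \<epsilon> \<le> r \<and> r \<le> 4 * \<epsilon>\<^sup>2 - quad_const \<theta> \<epsilon> \<and>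
        (Im w = 0 \<and> (Re w)\<^sup>2 = r \<or> Re w = 0 \<and> (Im w)\<^sup>2 = - r)"
      using le(2)[of "Im w"] by (intro exI[of _ "- (Im w)\<^sup>2"] conjI) linarith+
  qed auto
  then show ?thesis
    by (auto simp: image_iff)
qed

lemma slit_eq_closed_segment: "0 < \<epsilon> \<Longrightarrow> slit \<epsilon> = closed_segment (- complex_of_real (2*\<epsilon>)) (complex_of_real (2*\<epsilon>))"
  by (subst closed_segment_same_Im) (auto simp: slit_def closed_segment_eq_real_ivl)

lemma skean_eq_closed_segments:
  assumes "0 < \<epsilon>" "0 \<le> \<theta>" "\<theta> \<le> pi / 2"
  shows "skean \<theta> \<epsilon> = closed_segment (- complex_of_real (2 * \<epsilon> * sin \<theta>)) (complex_of_real (2 * \<epsilon> * sin \<theta>))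
           \<union> closed_segment (- (\<i> * complex_of_real (2 * \<epsilon> * cos \<theta>))) (\<i> * complex_of_real (2 * \<epsilon> * cos \<theta>))"
proof -
  have sc: "0 \<le> \<epsilon> * sin \<theta>" "0 \<le> \<epsilon> * cos \<theta>"
    using assms sin_ge_zero[of \<theta>] cos_ge_zero[of \<theta>] by auto
  then show ?thesis
    unfolding skean_def
    by (auto simp: closed_segment_same_Im closed_segment_same_Re closed_segment_eq_real_ivl abs_le_iff)
qed

lemma compact_slit: "0 < \<epsilon> \<Longrightarrow> compact (slit \<epsilon>)"
  by (simp add: slit_eq_closed_segment)

lemma compact_skean: "\<lbrakk>0 < \<epsilon>; 0 \<le> \<theta>; \<theta> \<le> pi / 2\<rbrakk> \<Longrightarrow> compact (skean \<theta> \<epsilon>)"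
  by (simp add: skean_eq_closed_segments compact_Un)

lemma zero_in_slit: "0 < \<epsilon> \<Longrightarrow> 0 \<in> slit \<epsilon>"
  by (simp add: slit_def)

lemma zero_in_skean: "\<lbrakk>0 < \<epsilon>; 0 \<le> \<theta>; \<theta> \<le> pi / 2\<rbrakk> \<Longrightarrow> 0 \<in> skean \<theta> \<epsilon>"
  using sin_ge_zero[of \<theta>] by (auto simp: skean_def)

text \<open>Points of the cut have squares \<open>t * k\<close> with
  \<open>0 \<le> t \<le> 1\<close>, and \<open>k \<le> 4 * \<epsilon>\<^sup>2\<close> keeps these
  within the range of squares on the slit.\<close>

lemma radicand_off_slit:
  assumes "0 < \<epsilon>" "z \<notin> slit \<epsilon>"
  shows "z \<noteq> 0" "1 + - complex_of_real (quad_const \<theta> \<epsilon>) / z\<^sup>2 \<notin> \<real>\<^sub>\<le>\<^sub>0"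
proof -
  show z: "z \<noteq> 0"
    using assms zero_in_slit by blast
  show "1 + - complex_of_real (quad_const \<theta> \<epsilon>) / z\<^sup>2 \<notin> \<real>\<^sub>\<le>\<^sub>0"
  proof
    assume "1 + - complex_of_real (quad_const \<theta> \<epsilon>) / z\<^sup>2 \<in> \<real>\<^sub>\<le>\<^sub>0"
    then obtain t where t: "0 \<le> t" "t \<le> 1" "z\<^sup>2 = complex_of_real (t * quad_const \<theta> \<epsilon>)"
      using quad_shift_radicand_nonpos[of z "- quad_const \<theta> \<epsilon>"] z by auto
    have "t * quad_const \<theta> \<epsilon> \<in> {0..4 * \<epsilon>\<^sup>2}"
      using t quad_const_ge_0[of \<theta> \<epsilon>] quad_const_le[of \<theta> \<epsilon>]
        mult_right_le_one_le[of "quad_const \<theta> \<epsilon>" t] by (auto simp: mult.commute intro: order_trans)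
    then show False
      using assms t(3) slit_iff_power2 by blast
  qed
qed

text \<open>On the cut \<open>w\<^sup>2 = - t * k\<close>, so the cut is covered by the vertical
  arm, whose squares reach down exactly to \<open>- k\<close>.\<close>

lemma radicand_off_skean:
  assumes "0 < \<epsilon>" "0 \<le> \<theta>" "\<theta> \<le> pi / 2" "w \<notin> skean \<theta> \<epsilon>"
  shows "w \<noteq> 0" "1 + complex_of_real (quad_const \<theta> \<epsilon>) / w\<^sup>2 \<notin> \<real>\<^sub>\<le>\<^sub>0"
proof -
  show w: "w \<noteq> 0"
    using assms zero_in_skean by blast
  show "1 + complex_of_real (quad_const \<theta> \<epsilon>) / w\<^sup>2 \<notin> \<real>\<^sub>\<le>\<^sub>0"
  proof
    assume "1 + complex_of_real (quad_const \<theta> \<epsilon>) / w\<^sup>2 \<in> \<real>\<^sub>\<le>\<^sub>0"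
    then obtain t where t: "0 \<le> t" "t \<le> 1" "w\<^sup>2 = complex_of_real (- t * quad_const \<theta> \<epsilon>)"
      using quad_shift_radicand_nonpos[of w "quad_const \<theta> \<epsilon>"] w by auto
    have "t * quad_const \<theta> \<epsilon> \<in> {0..quad_const \<theta> \<epsilon>}"
      using t quad_const_ge_0[of \<theta> \<epsilon>] mult_right_le_one_le[of "quad_const \<theta> \<epsilon>" t]
      by (auto simp: mult.commute)
    then have "- t * quad_const \<theta> \<epsilon> \<in> {- quad_const \<theta> \<epsilon>..4 * \<epsilon>\<^sup>2 - quad_const \<theta> \<epsilon>}"
      using quad_const_le[of \<theta> \<epsilon>] by auto
    then show False
      using assms t(3) skean_iff_power2 by blast
  qed
qed

text \<open>Stated for any pair related by squares, so that no branch enters: it serves the map, its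
  inverse, and an auxiliary root chosen over a point of the slit.\<close>

lemma skean_iff_slit:
  assumes "0 < \<epsilon>" "0 \<le> \<theta>" "\<theta> \<le> pi / 2" "z\<^sup>2 = w\<^sup>2 + complex_of_real (quad_const \<theta> \<epsilon>)"
  shows "w \<in> skean \<theta> \<epsilon> \<longleftrightarrow> z \<in> slit \<epsilon>"
proof -
  let ?k = "quad_const \<theta> \<epsilon>"
  have eq: "w\<^sup>2 = complex_of_real r \<longleftrightarrow> z\<^sup>2 = complex_of_real (r + ?k)" for r
    using assms(4) by (auto simp: algebra_simps)
  show ?thesis
  proof
    assume "w \<in> skean \<theta> \<epsilon>"
    then obtain r where "w\<^sup>2 = complex_of_real r" "- ?k \<le> r" "r \<le> 4 * \<epsilon>\<^sup>2 - ?k"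
      by (auto simp: skean_iff_power2[OF assms(1-3)])
    then have "z\<^sup>2 = complex_of_real (r + ?k)" "r + ?k \<in> {0..4 * \<epsilon>\<^sup>2}"
      unfolding eq by auto
    then show "z \<in> slit \<epsilon>"
      unfolding slit_iff_power2[OF assms(1)] by blast
  next
    assume "z \<in> slit \<epsilon>"
    then obtain r where "z\<^sup>2 = complex_of_real r" "0 \<le> r" "r \<le> 4 * \<epsilon>\<^sup>2"
      by (auto simp: slit_iff_power2[OF assms(1)])
    then have "w\<^sup>2 = complex_of_real (r - ?k)" "r - ?k \<in> {- ?k..4 * \<epsilon>\<^sup>2 - ?k}"
      unfolding eq by auto
    then show "w \<in> skean \<theta> \<epsilon>"
      unfolding skean_iff_power2[OF assms(1-3)] by blast
  qed
qed

lemma bij_betw_quad_shift: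
  assumes "0 < \<epsilon>" "0 \<le> \<theta>" "\<theta> \<le> pi / 2"
  shows "bij_betw (quad_shift (quad_const \<theta> \<epsilon>)) (- skean \<theta> \<epsilon>) (- slit \<epsilon>)" (is ?A)
    and "bij_betw (quad_shift (- quad_const \<theta> \<epsilon>)) (- slit \<epsilon>) (- skean \<theta> \<epsilon>)" (is ?B)
proof -
  let ?k = "complex_of_real (quad_const \<theta> \<epsilon>)"
  have 1: "quad_shift ?k w \<in> - slit \<epsilon>" "quad_shift (- ?k) (quad_shift ?k w) = w" if "w \<in> - skean \<theta> \<epsilon>" for w
    using radicand_off_skean[OF assms, of w] that skean_iff_slit[OF assms, of "quad_shift ?k w" w]
      quad_shift_power2[of w ?k] quad_shift_inverse[of w ?k] by auto
  have 2: "quad_shift (- ?k) z \<in> - skean \<theta> \<epsilon>" "quad_shift ?k (quad_shift (- ?k) z) = z" if "z \<in> - slit \<epsilon>" for z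
    using radicand_off_slit(1)[OF assms(1), of z] radicand_off_slit(2)[OF assms(1), of z \<theta>] that skean_iff_slit[OF assms, of z "quad_shift (- ?k) z"]
      quad_shift_power2[of z "- ?k"] quad_shift_inverse[of z "- ?k"] by auto
  show ?A ?B
    using 1 2 by (auto intro: bij_betw_byWitness[where f' = "quad_shift (- ?k)"] bij_betw_byWitness[where f' = "quad_shift ?k"])
qed

section \<open>The Joukowski map and the branch of K\<close>

lemma connected_outer_domain: "connected (outer_domain \<epsilon>)"
proof -
  have "outer_domain \<epsilon> = - cball 0 \<epsilon>"
    by (auto simp: outer_domain_def)
  then show ?thesis
    by (simp add: connected_complement_bounded_convex)
qed

text \<open>The fibre of \<open>u + 1 / u\<close> over \<open>z\<close> is the pair of reciprocal
  roots of \<open>X\<^sup>2 - z X + 1\<close>. If one root lies on the unit circle, the other is its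
  conjugate and \<open>z = 2 * Re u\<close> is in the slit; otherwise exactly one root lies outside
  the circle.\<close>

lemma unit_joukowski_bij:
  "bij_betw (\<lambda>u. u + 1 / u) (outer_domain 1) (- slit 1)"
  unfolding bij_betw_def
proof (intro conjI inj_onI equalityI subsetI)
  fix u v :: complex
  assume uv: "u \<in> outer_domain 1" "v \<in> outer_domain 1" "u + 1 / u = v + 1 / v"
  then have n: "norm u > 1" "norm v > 1" "u \<noteq> 0" "v \<noteq> 0"
    by (auto simp: outer_domain_def)
  then have "(u - v) * (u * v - 1) = 0"
    using uv(3) by (simp add: field_simps)
  moreover have "norm (u * v) > 1"
    using n by (simp add: norm_mult less_1_mult)
  then have "u * v \<noteq> 1"
    by auto
  ultimately show "u = v"
    by simp
next
  fix z assume "z \<in> (\<lambda>u. u + 1 / u) ` outer_domain 1"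
  then obtain u where u: "norm u > 1" "z = u + 1 / u"
    by (auto simp: outer_domain_def)
  show "z \<in> - slit 1"
  proof
    assume "z \<in> slit 1"
    then have "Im z = 0" "\<bar>Re z / 2\<bar> \<le> 1"
      by (auto simp: slit_def)
    \<comment> \<open>Writing \<open>z = 2 cos \<phi>\<close> exhibits its preimages as
      \<open>cis \<phi>\<close> and the inverse, both on the unit circle, which leaves no place for
      \<open>u\<close>.\<close>
    then obtain \<phi> where "Re z / 2 = cos \<phi>"
      by (metis abs_le_iff cos_arccos minus_le_iff)
    then have z: "z = cis \<phi> + 1 / cis \<phi>"
      using \<open>Im z = 0\<close> by (simp add: complex_eq_iff flip: cis_inverse inverse_eq_divide)
    have "u \<noteq> 0" using u by auto
    then have "(u - cis \<phi>) * (u * cis \<phi> - 1) = 0"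
      using z[unfolded u(2)] cis_neq_zero[of \<phi>] by (simp add: field_simps)
    then have "norm u = 1 \<or> norm (u * cis \<phi>) = 1"
      by auto
    then show False
      using u(1) by (simp add: norm_mult)
  qed
next
  fix z assume z: "z \<in> - slit 1"
  \<comment> \<open>The two roots of \<open>X\<^sup>2 - z X + 1\<close>. Which of them is outside
    the circle depends on \<open>z\<close>, so both are kept as candidates.\<close>
  define u where "u = (z + csqrt (z\<^sup>2 - 4)) / 2"
  define v where "v = (z - csqrt (z\<^sup>2 - 4)) / 2"
  have uv: "u * v = 1" "u + v = z"
    unfolding u_def v_def using power2_csqrt[of "z\<^sup>2 - 4"] by (simp_all add: field_simps power2_eq_square)
  then have nz: "u \<noteq> 0" "v \<noteq> 0" by auto
  have inv: "v = 1 / u" "u = 1 / v"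
    using uv(1) nz by (simp_all add: field_simps)
  have "norm u \<noteq> 1"
  proof
    assume n: "norm u = 1"
    then have "v = cnj u"
      using inv(1) by (simp add: divide_conv_cnj)
    then have "Im z = 0" "Re z = 2 * Re u"
      using uv(2) by auto
    moreover have "\<bar>Re u\<bar> \<le> 1"
      using n abs_Re_le_cmod by metis
    ultimately show False
      using z by (auto simp: slit_def)
  qed
  moreover have "norm u * norm v = 1"
    using uv(1) by (metis norm_mult norm_one)
  moreover have "norm u * norm v < 1" if "norm u < 1" "norm v \<le> 1"
    using that mult_left_le[of "norm v" "norm u"] by auto
  ultimately have "norm u > 1 \<or> norm v > 1"
    by linarith
  then show "z \<in> (\<lambda>u. u + 1 / u) ` outer_domain 1"
  proof
    assume "norm u > 1"
    then show ?thesis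
      using uv(2) by (intro image_eqI[of _ _ u]) (auto simp: outer_domain_def inv(1))
  next
    assume "norm v > 1"
    then show ?thesis
      using uv(2) by (intro image_eqI[of _ _ v]) (auto simp: outer_domain_def inv(2) add.commute)
  qed
qed

text \<open>Both sides have the same square and the right one never vanishes, so their quotient is
  continuous with values \<open>1\<close> and \<open>-1\<close> on a connected domain, hence
  constant. One sample point fixes the sign.\<close>

lemma unit_K_eq:
  assumes "0 \<le> \<theta>" "\<theta> \<le> pi / 2" and "norm u > 1"
  shows "u * csqrt (1 - exp (2 * \<i> * complex_of_real \<theta>) / u\<^sup>2)
          * csqrt (1 - exp (- 2 * \<i> * complex_of_real \<theta>) / u\<^sup>2)
         = quad_shift (- quad_const \<theta> 1) (u + 1 / u)"
proof -
  define e where "e = exp (2 * \<i> * complex_of_real \<theta>)"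
  define e' where "e' = exp (- 2 * \<i> * complex_of_real \<theta>)"
  define k where "k = quad_const \<theta> 1"
  define f where "f = (\<lambda>u. u * csqrt (1 - e / u\<^sup>2) * csqrt (1 - e' / u\<^sup>2))"
  define g where "g = (\<lambda>u. quad_shift (- complex_of_real k) (u + 1 / u))"
  have ecis: "e = cis (2 * \<theta>)" "e' = cis (- (2 * \<theta>))"
    unfolding e_def e'_def cis_conv_exp by (simp_all add: mult_ac)
  have e: "norm e = 1" "norm e' = 1" "e' = cnj e" "e * e' = 1" "e + e' = complex_of_real k - 2"
    unfolding ecis by (simp_all add: cis_cnj cis_mult complex_eq_iff k_def quad_const_def cos_double_cos)
  have notneg: "1 - a / u\<^sup>2 \<notin> \<real>\<^sub>\<le>\<^sub>0" if "norm a = 1" "norm u > 1" for a u :: complex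
  proof -
    have "(norm u)\<^sup>2 > 1" using that by simp
    then have "norm (a / u\<^sup>2) < 1"
      using that by (auto simp: norm_divide norm_power divide_simps)
    then have "Re (a / u\<^sup>2) < 1"
      using abs_Re_le_cmod[of "a / u\<^sup>2"] by linarith
    then show ?thesis
      by (auto simp: complex_nonpos_Reals_iff)
  qed
  have S: "u + 1 / u \<notin> slit 1" if "norm u > 1" for u
    using unit_joukowski_bij that by (auto simp: bij_betw_def outer_domain_def)
  have rad: "u + 1 / u \<noteq> 0" "1 + - complex_of_real k / (u + 1/u)\<^sup>2 \<notin> \<real>\<^sub>\<le>\<^sub>0" if "norm u > 1" for u
    using radicand_off_slit[of 1 "u + 1 / u"] S[OF that] by (auto simp: k_def)
  have gnz: "g u \<noteq> 0" if "norm u > 1" for u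
    unfolding g_def using rad[OF that] quad_shift_eq_0_iff by blast
  have sq: "(f u)\<^sup>2 = (g u)\<^sup>2" if "norm u > 1" for u
  proof -
    have u: "u \<noteq> 0" using that by auto
    have "(f u)\<^sup>2 = u\<^sup>2 * (1 - e / u\<^sup>2) * (1 - e' / u\<^sup>2)"
      by (simp add: f_def power_mult_distrib)
    also have "\<dots> = u\<^sup>2 - (e + e') + (e * e') / u\<^sup>2"
      using u by (simp add: field_simps power2_eq_square)
    also have "\<dots> = (u + 1 / u)\<^sup>2 + - complex_of_real k"
      unfolding e(4,5) using u by (simp add: field_simps power2_eq_square)
    also have "\<dots> = (g u)\<^sup>2"
      unfolding g_def using rad[OF that] by (subst quad_shift_power2) auto
    finally show ?thesis .
  qed
  define h where "h = (\<lambda>u. f u / g u)"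
  have hsq: "(h u)\<^sup>2 = 1" if "norm u > 1" for u
    using sq[OF that] gnz[OF that] by (simp add: h_def power_divide)
  have "continuous_on (outer_domain 1) h"
    unfolding h_def
  proof (intro continuous_intros)
    show "continuous_on (outer_domain 1) f"
      unfolding f_def using notneg e
      by (intro holomorphic_on_imp_continuous_on holomorphic_intros) (auto simp: outer_domain_def)
    show "continuous_on (outer_domain 1) g"
      unfolding g_def quad_shift_def using rad
      by (intro holomorphic_on_imp_continuous_on holomorphic_intros) (auto simp: outer_domain_def)
  qed (use gnz in \<open>auto simp: outer_domain_def\<close>)
  moreover have "h ` outer_domain 1 \<subseteq> {1, -1}"
    using hsq by (auto simp: outer_domain_def power2_eq_1_iff)
  ultimately have "h constant_on outer_domain 1"
    using connected_outer_domain by (meson continuous_finite_range_constant finite.emptyI finite_insert finite_subset)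
  then obtain c where c: "\<And>u. u \<in> outer_domain 1 \<Longrightarrow> h u = c"
    by (auto simp: constant_on_def)
  \<comment> \<open>At \<open>2\<close> the two radicands in \<open>f\<close> are complex conjugate,
    so \<open>f 2\<close> is twice a squared modulus; \<open>k \<le> 4\<close> makes
    \<open>g 2\<close> a nonnegative real as well.\<close>
  have "h 2 = 1"
  proof -
    have "csqrt (1 - e' / 4) = cnj (csqrt (1 - e / 4))"
      using notneg[of e 2] e cnj_csqrt[of "1 - e / 4"] by simp
    then have f2: "f 2 = complex_of_real (2 * (norm (csqrt (1 - e / 4)))\<^sup>2)"
      unfolding of_real_mult complex_norm_square by (simp add: f_def mult.assoc)
    have "k \<le> 4"
      using quad_const_le[of \<theta> 1] by (simp add: k_def)
    then have "csqrt (1 + - complex_of_real k / (2 + 1 / 2)\<^sup>2) = complex_of_real (sqrt (1 - k * 4 / 25))"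
      by (subst of_real_sqrt) (auto simp: power2_eq_square field_simps)
    then have g2: "g 2 = complex_of_real (5 / 2 * sqrt (1 - k * 4 / 25))"
      by (simp add: g_def quad_shift_def)
    have "Re (h 2) \<ge> 0"
      using \<open>k \<le> 4\<close> unfolding h_def f2 g2 of_real_divide[symmetric] Re_complex_of_real
      by (intro divide_nonneg_nonneg mult_nonneg_nonneg) auto
    then show ?thesis
      using hsq[of 2] by (auto simp: power2_eq_1_iff)
  qed
  then have "h u = 1"
    using c[of u] c[of 2] assms by (simp add: outer_domain_def)
  then have "f u = g u"
    using gnz[OF assms(3)] by (simp add: h_def)
  then show ?thesis
    by (simp add: f_def g_def e_def e'_def k_def)
qed

lemma outer_domain_scale: "0 < \<epsilon> \<Longrightarrow> z \<in> outer_domain \<epsilon> \<longleftrightarrow> z / complex_of_real \<epsilon> \<in> outer_domain 1"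
  by (simp add: outer_domain_def norm_divide field_simps)

lemma slit_scale: "0 < \<epsilon> \<Longrightarrow> z \<in> slit \<epsilon> \<longleftrightarrow> z / complex_of_real \<epsilon> \<in> slit 1"
  by (auto simp: slit_def field_simps)

lemma bij_betw_S_map:
  assumes "0 < \<epsilon>" shows "bij_betw (S_map \<epsilon>) (outer_domain \<epsilon>) (- slit \<epsilon>)"
proof -
  let ?e = "complex_of_real \<epsilon>"
  have 1: "bij_betw (\<lambda>z. z / ?e) (outer_domain \<epsilon>) (outer_domain 1)"
    by (rule bij_betw_byWitness[where f' = "\<lambda>z. z * ?e"])
      (use assms in \<open>auto simp: outer_domain_scale[of \<epsilon>]\<close>)
  have 2: "bij_betw (\<lambda>z. ?e * z) (- slit 1) (- slit \<epsilon>)"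
    by (rule bij_betw_byWitness[where f' = "\<lambda>z. z / ?e"])
      (use assms in \<open>auto simp: slit_scale[of \<epsilon>]\<close>)
  have "S_map \<epsilon> = (\<lambda>z. ?e * z) \<circ> (\<lambda>u. u + 1 / u) \<circ> (\<lambda>z. z / ?e)"
    by (auto simp: S_map_def Let_def)
  then show ?thesis
    using bij_betw_trans[OF bij_betw_trans[OF 1 unit_joukowski_bij] 2] by (simp add: o_assoc)
qed

lemma K_map_eq:
  assumes "0 < \<epsilon>" "0 \<le> \<theta>" "\<theta> \<le> pi / 2" "z \<in> outer_domain \<epsilon>"
  shows "K_map \<theta> \<epsilon> z = quad_shift (- quad_const \<theta> \<epsilon>) (S_map \<epsilon> z)"
proof -
  let ?e = "complex_of_real \<epsilon>"
  have k: "- complex_of_real (quad_const \<theta> \<epsilon>) = ?e\<^sup>2 * - complex_of_real (quad_const \<theta> 1)"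
    by (simp add: quad_const_def)
  have "norm (z / ?e) > 1"
    using assms outer_domain_scale[of \<epsilon> z] by (auto simp: outer_domain_def)
  from unit_K_eq[OF assms(2,3) this]
  have "K_map \<theta> \<epsilon> z = ?e * quad_shift (- complex_of_real (quad_const \<theta> 1)) (z / ?e + 1 / (z / ?e))"
    unfolding K_map_def Let_def by simp
  also have "\<dots> = quad_shift (?e\<^sup>2 * - complex_of_real (quad_const \<theta> 1)) (S_map \<epsilon> z)"
    unfolding S_map_def Let_def by (rule quad_shift_scale[symmetric]) (use assms(1) in simp)
  finally show ?thesis
    unfolding k[symmetric] by simp
qed

lemma riemann_mapping_S_map:
  assumes "0 < \<epsilon>"
  shows "riemann_mapping (S_map \<epsilon>) (outer_domain \<epsilon>) (- slit \<epsilon>)"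
  unfolding riemann_mapping_def
proof
  show "S_map \<epsilon> holomorphic_on outer_domain \<epsilon>"
    unfolding S_map_def Let_def using assms
    by (intro holomorphic_intros) (auto simp: outer_domain_def)
qed (rule bij_betw_S_map[OF assms])

section \<open>The composed map, its inverse and the pushforward\<close>

context
  fixes \<theta> \<epsilon> :: real
  assumes eps: "0 < \<epsilon>" and theta: "0 \<le> \<theta>" "\<theta> \<le> pi / 2"
begin

lemma holomorphic_quad_shift_off_slit: "quad_shift (- quad_const \<theta> \<epsilon>) holomorphic_on - slit \<epsilon>"
  using radicand_off_slit[OF eps] by (intro holomorphic_on_quad_shift) auto

lemma holomorphic_quad_shift_off_skean: "quad_shift (quad_const \<theta> \<epsilon>) holomorphic_on - skean \<theta> \<epsilon>"
  using radicand_off_skean[OF eps theta] by (intro holomorphic_on_quad_shift) auto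

lemma riemann_mapping_K_map: "riemann_mapping (K_map \<theta> \<epsilon>) (outer_domain \<epsilon>) (- skean \<theta> \<epsilon>)"
proof -
  let ?f = "quad_shift (- quad_const \<theta> \<epsilon>) \<circ> S_map \<epsilon>"
  have eq: "K_map \<theta> \<epsilon> z = ?f z" if "z \<in> outer_domain \<epsilon>" for z
    using K_map_eq[OF eps theta that] by simp
  have S: "S_map \<epsilon> holomorphic_on outer_domain \<epsilon>" "bij_betw (S_map \<epsilon>) (outer_domain \<epsilon>) (- slit \<epsilon>)"
    using riemann_mapping_S_map[OF eps] by (auto simp: riemann_mapping_def)
  have "?f holomorphic_on outer_domain \<epsilon>"
    using S holomorphic_quad_shift_off_slit by (intro holomorphic_on_compose_gen) (auto simp: bij_betw_def)
  moreover have "bij_betw ?f (outer_domain \<epsilon>) (- skean \<theta> \<epsilon>)"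
    using bij_betw_trans[OF S(2) bij_betw_quad_shift(2)[OF eps theta]] .
  ultimately show ?thesis
    unfolding riemann_mapping_def
    using eq bij_betw_cong[of "outer_domain \<epsilon>" "K_map \<theta> \<epsilon>" ?f] holomorphic_cong[of "outer_domain \<epsilon>" _ "K_map \<theta> \<epsilon>" ?f]
    by blast
qed

text \<open>\<open>K_map\<close> is the inverse shift applied to \<open>S_map\<close>, so the
  variable of the outer domain cancels and a closed formula replaces the two Riemann mappings from
  here on. It is confined to the complement of the skean, since elsewhere \<open>inv_into\<close>
  returns an arbitrary value.\<close>

lemma skean_to_slit_eq:
  assumes "w \<notin> skean \<theta> \<epsilon>"
  shows "skean_to_slit \<theta> \<epsilon> w = quad_shift (quad_const \<theta> \<epsilon>) w"
proof -
  have "w \<in> K_map \<theta> \<epsilon> ` outer_domain \<epsilon>"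
    using assms riemann_mapping_K_map unfolding riemann_mapping_def bij_betw_def by blast
  then obtain z where z: "z \<in> outer_domain \<epsilon>" "K_map \<theta> \<epsilon> z = w"
    by blast
  then have "inv_into (outer_domain \<epsilon>) (K_map \<theta> \<epsilon>) w = z"
    using riemann_mapping_K_map unfolding riemann_mapping_def by (metis bij_betw_inv_into_left)
  moreover have "S_map \<epsilon> z \<notin> slit \<epsilon>"
    using z(1) bij_betw_S_map[OF eps] unfolding bij_betw_def by blast
  then have "quad_shift (quad_const \<theta> \<epsilon>) w = S_map \<epsilon> z"
    using quad_shift_inverse[of "S_map \<epsilon> z" "- complex_of_real (quad_const \<theta> \<epsilon>)"]
      radicand_off_slit(1)[OF eps] radicand_off_slit(2)[OF eps, of "S_map \<epsilon> z" \<theta>]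
    unfolding z(2)[symmetric] K_map_eq[OF eps theta z(1)] by simp
  ultimately show ?thesis
    by (simp add: skean_to_slit_def)
qed

lemma skean_to_slit_power2:
  "w \<notin> skean \<theta> \<epsilon> \<Longrightarrow> (skean_to_slit \<theta> \<epsilon> w)\<^sup>2 = w\<^sup>2 + quad_const \<theta> \<epsilon>"
  using radicand_off_skean(1)[OF eps theta, of w] by (subst skean_to_slit_eq) (auto simp: quad_shift_power2)

lemma bij_betw_skean_to_slit: "bij_betw (skean_to_slit \<theta> \<epsilon>) (- skean \<theta> \<epsilon>) (- slit \<epsilon>)"
  using bij_betw_quad_shift(1)[OF eps theta] skean_to_slit_eq
    bij_betw_cong[of "- skean \<theta> \<epsilon>" "skean_to_slit \<theta> \<epsilon>" "quad_shift (quad_const \<theta> \<epsilon>)"]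
  by blast

lemma holomorphic_skean_to_slit: "skean_to_slit \<theta> \<epsilon> holomorphic_on - skean \<theta> \<epsilon>"
  using holomorphic_quad_shift_off_skean skean_to_slit_eq
    holomorphic_cong[of "- skean \<theta> \<epsilon>" _ "skean_to_slit \<theta> \<epsilon>" "quad_shift (quad_const \<theta> \<epsilon>)"]
  by blast

lemma inv_skean_to_slit_eq:
  assumes "z \<notin> slit \<epsilon>"
  shows "inv_into (- skean \<theta> \<epsilon>) (skean_to_slit \<theta> \<epsilon>) z = quad_shift (- quad_const \<theta> \<epsilon>) z"
proof (rule inv_into_f_eq)
  show "inj_on (skean_to_slit \<theta> \<epsilon>) (- skean \<theta> \<epsilon>)"
    using bij_betw_skean_to_slit by (simp add: bij_betw_def)
  show *: "quad_shift (- quad_const \<theta> \<epsilon>) z \<in> - skean \<theta> \<epsilon>"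
    using bij_betw_quad_shift(2)[OF eps theta] assms by (auto simp: bij_betw_def)
  show "skean_to_slit \<theta> \<epsilon> (quad_shift (- quad_const \<theta> \<epsilon>) z) = z"
    using * assms radicand_off_slit(1)[OF eps, of z] radicand_off_slit(2)[OF eps, of z \<theta>] quad_shift_inverse[of z "- quad_const \<theta> \<epsilon>"]
    by (auto simp: skean_to_slit_eq)
qed

text \<open>Off the slit the square of the map is \<open>z\<^sup>2 - k\<close>; comparing the two
  derivatives of that square gives the claim without differentiating a root.\<close>

lemma quad_shift_times_deriv:
  assumes "z \<notin> slit \<epsilon>"
  shows "quad_shift (- quad_const \<theta> \<epsilon>) z * deriv (quad_shift (- quad_const \<theta> \<epsilon>)) z = z"
proof -
  let ?q = "quad_shift (- quad_const \<theta> \<epsilon>)"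
  have op: "open (- slit \<epsilon>)"
    using compact_slit[OF eps] compact_imp_closed by blast
  then have "(?q has_field_derivative deriv ?q z) (at z)"
    using holomorphic_quad_shift_off_slit assms by (auto intro: holomorphic_derivI)
  then have 1: "((\<lambda>z. (?q z)\<^sup>2) has_field_derivative 2 * ?q z * deriv ?q z) (at z)"
    by (auto intro!: derivative_eq_intros)
  have "((\<lambda>z. (?q z)\<^sup>2) has_field_derivative 2 * z) (at z)"
  proof (rule has_field_derivative_transform_within_open[OF _ op])
    show "((\<lambda>z. z\<^sup>2 - complex_of_real (quad_const \<theta> \<epsilon>)) has_field_derivative 2 * z) (at z)"
      by (auto intro!: derivative_eq_intros)
  qed (use assms radicand_off_slit[OF eps] in \<open>auto simp: quad_shift_power2\<close>)
  from DERIV_unique[OF 1 this] show ?thesis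
    by simp
qed

text \<open>On the open complement of the slit \<open>inv_into\<close> agrees with the explicit
  inverse, so the derivatives agree too and the product is the one just computed.\<close>

lemma pushforward_skean_to_slit:
  assumes "z \<notin> slit \<epsilon>"
  shows "pushforward (skean_to_slit \<theta> \<epsilon>) (- skean \<theta> \<epsilon>) (\<lambda>w. w) z = z"
proof -
  have "open (- slit \<epsilon>)"
    using compact_slit[OF eps] compact_imp_closed by blast
  then have "deriv (inv_into (- skean \<theta> \<epsilon>) (skean_to_slit \<theta> \<epsilon>)) z = deriv (quad_shift (- quad_const \<theta> \<epsilon>)) z"
    using assms inv_skean_to_slit_eq by (intro deriv_cong_ev) (auto simp: eventually_nhds)
  then show ?thesis
    using quad_shift_times_deriv[OF assms] by (simp add: pushforward_def inv_skean_to_slit_eq assms)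
qed

end

lemma zorder_id_0: "zorder (\<lambda>z::complex. z) 0 = 1"
  by (rule zorder_eqI[where S = UNIV and g = "\<lambda>_. 1"]) auto


section \<open>The variation cocycles\<close>

text \<open>Here \<open>t\<close> stands for \<open>\<epsilon>\<^sup>2\<close> and is allowed to be
  complex, so that the variations are complex derivatives; the factor in front of it is
  \<open>quad_const \<theta> 1\<close>.\<close>

definition quad_family :: "real \<Rightarrow> complex \<Rightarrow> complex \<Rightarrow> complex" where
  "quad_family \<theta> t = quad_shift (complex_of_real (4 * (cos \<theta>)\<^sup>2) * t)"

text \<open>The bound \<open>\<delta>\<^sup>2 / 4\<close> cancels the factor 4: it gives \<open>norm
  (4 * (cos \<theta>)\<^sup>2 * t) < \<delta>\<^sup>2 < (norm w)\<^sup>2\<close>, so the radicand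
  stays in the unit disc about \<open>1\<close>.\<close>

lemma quad_family_radicand:
  assumes "0 < \<delta>" "norm t < \<delta>\<^sup>2 / 4" "norm w > \<delta>"
  shows "w \<noteq> 0" "1 + complex_of_real (4 * (cos \<theta>)\<^sup>2) * t / w\<^sup>2 \<notin> \<real>\<^sub>\<le>\<^sub>0"
proof -
  let ?x = "complex_of_real (4 * (cos \<theta>)\<^sup>2) * t / w\<^sup>2"
  show "w \<noteq> 0" using assms by auto
  have "(cos \<theta>)\<^sup>2 \<le> 1"
    by (simp add: abs_square_le_1)
  then have "(cos \<theta>)\<^sup>2 * norm t \<le> norm t"
    using mult_right_mono[of "(cos \<theta>)\<^sup>2" 1 "norm t"] by simp
  moreover have "\<delta>\<^sup>2 < (norm w)\<^sup>2"
    using assms by (simp add: power_strict_mono)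
  ultimately have "4 * ((cos \<theta>)\<^sup>2 * norm t) < (norm w)\<^sup>2"
    using assms(2) by linarith
  then have "norm ?x < 1"
    using \<open>w \<noteq> 0\<close> by (simp add: norm_mult norm_divide norm_power)
  then have "Re ?x > -1"
    using abs_Re_le_cmod[of ?x] by linarith
  then show "1 + ?x \<notin> \<real>\<^sub>\<le>\<^sub>0"
    by (auto simp: complex_nonpos_Reals_iff)
qed

lemma holomorphic_family_quad_family: "holomorphic_family_from_identity (quad_family \<theta>)"
  unfolding holomorphic_family_from_identity_def
proof (intro conjI allI impI)
  fix \<delta> :: real assume "0 < \<delta>"
  note rad = quad_family_radicand[OF this]
  show "\<exists>r>0. continuous_on (ball 0 r \<times> {w. \<delta> < cmod w}) (\<lambda>(t, w). quad_family \<theta> t w) \<and>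
           (\<forall>w. \<delta> < cmod w \<longrightarrow> (\<lambda>t. quad_family \<theta> t w) holomorphic_on ball 0 r) \<and>
           (\<forall>t\<in>ball 0 r. quad_family \<theta> t holomorphic_on {w. \<delta> < cmod w})"
  proof (intro exI[of _ "\<delta>\<^sup>2 / 4"] conjI allI impI ballI)
    show "continuous_on (ball 0 (\<delta>\<^sup>2 / 4) \<times> {w. \<delta> < cmod w}) (\<lambda>(t, w). quad_family \<theta> t w)"
      unfolding quad_family_def quad_shift_def case_prod_unfold
      using rad
      by (intro continuous_intros continuous_on_compose2[OF continuous_on_csqrt]) auto
    show "(\<lambda>t. quad_family \<theta> t w) holomorphic_on ball 0 (\<delta>\<^sup>2 / 4)" if "\<delta> < norm w" for w
      unfolding quad_family_def quad_shift_def using rad[OF _ that]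
      by (intro holomorphic_intros) auto
    show "quad_family \<theta> t holomorphic_on {w. \<delta> < cmod w}" if "t \<in> ball 0 (\<delta>\<^sup>2 / 4)" for t
      unfolding quad_family_def using rad that
      by (intro holomorphic_on_quad_shift) auto
  qed (use \<open>0 < \<delta>\<close> in auto)
qed (simp add: quad_family_def)

text \<open>The squares on the skean are reals of absolute value at most
  \<open>4 * \<epsilon>\<^sup>2\<close>, so the skean lies within distance
  \<open>2 * \<epsilon> < \<delta>\<close> of the origin. The radius that ensures holomorphy
  therefore serves here as well.\<close>

lemma quad_family_eq_skean_to_slit:
  assumes "0 \<le> \<theta>" "\<theta> \<le> pi / 2" "0 < \<delta>" "0 < \<epsilon>" "\<epsilon>\<^sup>2 < \<delta>\<^sup>2 / 4" "norm w > \<delta>"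
  shows "w \<notin> skean \<theta> \<epsilon> \<and> quad_family \<theta> (complex_of_real (\<epsilon>\<^sup>2)) w = skean_to_slit \<theta> \<epsilon> w"
proof -
  have "w \<notin> skean \<theta> \<epsilon>"
  proof
    assume "w \<in> skean \<theta> \<epsilon>"
    then obtain r where r: "w\<^sup>2 = complex_of_real r" "\<bar>r\<bar> \<le> 4 * \<epsilon>\<^sup>2"
      using skean_iff_power2[OF assms(4,1,2)] quad_const_ge_0[of \<theta> \<epsilon>] quad_const_le[of \<theta> \<epsilon>] by fastforce
    have "(norm w)\<^sup>2 = \<bar>r\<bar>"
      by (metis norm_of_real norm_power r(1))
    moreover have "\<delta>\<^sup>2 < (norm w)\<^sup>2"
      using assms by (simp add: power_strict_mono)
    ultimately show False
      using r(2) assms(5) by linarith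
  qed
  then show ?thesis
    using skean_to_slit_eq[OF assms(4,1,2)] by (simp add: quad_family_def quad_const_def mult_ac)
qed

lemma variations_quad_family:
  assumes "w \<noteq> 0"
  shows "first_variation (quad_family \<theta>) w = complex_of_real (1 + cos (2 * \<theta>)) / w"
    and "second_variation (quad_family \<theta>) w =
           complex_of_real (- 1 - 4 * cos (2 * \<theta>) + cos (4 * \<theta>) - 4 * (cos (2 * \<theta>))\<^sup>2) / (2 * w ^ 3)"
proof -
  define a where "a = complex_of_real (4 * (cos \<theta>)\<^sup>2) / w\<^sup>2"
  \<comment> \<open>Half of \<open>norm w\<close> plays the part of \<delta>, because the radicand
    bound asks for \<open>norm w > \<delta>\<close> strictly.\<close>
  define r where "r = (norm w / 2)\<^sup>2 / 4"
  have r: "r > 0" using assms by (simp add: r_def)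
  have pos: "1 + a * t \<notin> \<real>\<^sub>\<le>\<^sub>0" if "t \<in> ball 0 r" for t
    using quad_family_radicand(2)[of "norm w / 2" t w \<theta>] that assms by (simp add: a_def r_def)
  have eq: "(\<lambda>t. quad_family \<theta> t w) = (\<lambda>t. w * csqrt (1 + a * t))"
    by (simp add: quad_family_def quad_shift_def a_def)
  have d1: "deriv (\<lambda>t. quad_family \<theta> t w) t = w * a / (2 * csqrt (1 + a * t))" if "t \<in> ball 0 r" for t
    unfolding eq using pos[OF that] by (intro DERIV_imp_deriv derivative_eq_intros) auto
  have c: "complex_of_real (1 + cos (2 * \<theta>)) = a * w\<^sup>2 / 2"
    using assms by (simp add: a_def cos_double_cos)
  show "first_variation (quad_family \<theta>) w = complex_of_real (1 + cos (2 * \<theta>)) / w"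
    unfolding first_variation_def c using d1[of 0] r assms by (simp add: power2_eq_square)
  have "second_variation (quad_family \<theta>) w = deriv (deriv (\<lambda>t. quad_family \<theta> t w)) 0"
    by (simp add: second_variation_def numeral_2_eq_2)
  \<comment> \<open>The formula for the first derivative holds on the whole ball, as differentiating
    once more at \<open>0\<close> requires.\<close>
  also have "\<dots> = deriv (\<lambda>t. w * a / (2 * csqrt (1 + a * t))) 0"
    using d1 r by (intro deriv_cong_ev) (auto simp: eventually_nhds intro!: exI[of _ "ball 0 r"])
  also have "\<dots> = - (w * a\<^sup>2 / 4)"
    by (rule DERIV_imp_deriv) (auto intro!: derivative_eq_intros simp: power2_eq_square)
  also have "\<dots> = - ((a * w\<^sup>2 / 2)\<^sup>2 / w ^ 3)"
    using assms by (simp add: power2_eq_square power3_eq_cube)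
  also have "\<dots> = complex_of_real (- 2 * (1 + cos (2 * \<theta>))\<^sup>2) / (2 * w ^ 3)"
    unfolding c[symmetric] by simp
  \<comment> \<open>By \<open>cos 4\<theta> = 2 (cos 2\<theta>)\<^sup>2 - 1\<close>, the expanded
    coefficient is a multiple of a perfect square.\<close>
  also have "- 2 * (1 + cos (2 * \<theta>))\<^sup>2 = - 1 - 4 * cos (2 * \<theta>) + cos (4 * \<theta>) - 4 * (cos (2 * \<theta>))\<^sup>2"
    using cos_double_cos[of "2 * \<theta>"] by (simp add: power2_eq_square algebra_simps)
  finally show "second_variation (quad_family \<theta>) w =
     complex_of_real (- 1 - 4 * cos (2 * \<theta>) + cos (4 * \<theta>) - 4 * (cos (2 * \<theta>))\<^sup>2) / (2 * w ^ 3)" .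
qed

section \<open>Holomorphic change of variables in the plane\<close>

text \<open>Moves the plane to \<open>real^2\<close>, where Jacobian matrices and
  \<open>has_absolute_integral_change_of_variables\<close> are formulated. Later both the points and
  the values of an integrand are converted.\<close>

definition complex_of_vec :: "real^2 \<Rightarrow> complex" where
  "complex_of_vec v = Complex (v $ 1) (v $ 2)"

definition vec_of_complex :: "complex \<Rightarrow> real^2" where
  "vec_of_complex z = vector [Re z, Im z]"

lemma complex_of_vec_of_complex [simp]: "complex_of_vec (vec_of_complex z) = z"
  by (simp add: complex_of_vec_def vec_of_complex_def)

lemma vec_of_complex_of_vec [simp]: "vec_of_complex (complex_of_vec v) = v"
  by (simp add: complex_of_vec_def vec_of_complex_def vec_eq_iff forall_2)

lemma linear_complex_of_vec: "linear complex_of_vec"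
  by (rule linearI) (auto simp: complex_of_vec_def complex_eq_iff)

lemma linear_vec_of_complex: "linear vec_of_complex"
  by (rule linearI) (auto simp: vec_of_complex_def vec_eq_iff forall_2)

lemmas bounded_linear_complex_of_vec = linear_complex_of_vec[unfolded linear_conv_bounded_linear]
lemmas bounded_linear_vec_of_complex = linear_vec_of_complex[unfolded linear_conv_bounded_linear]

lemma borel_measurable_complex_of_vec [measurable]: "complex_of_vec \<in> borel_measurable borel"
  by (intro borel_measurable_continuous_onI linear_continuous_on bounded_linear_complex_of_vec)

lemma borel_measurable_vec_of_complex [measurable]: "vec_of_complex \<in> borel_measurable borel"
  by (intro borel_measurable_continuous_onI linear_continuous_on bounded_linear_vec_of_complex)

text \<open>Lebesgue measure is determined by its values on boxes, and the preimage of a box is a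
  box with the same side lengths.\<close>

lemma lborel_distr_complex_of_vec: "distr lborel borel complex_of_vec = lborel"
proof (rule lborel_eqI[symmetric])
  fix l u :: complex assume le: "\<And>b. b \<in> Basis \<Longrightarrow> l \<bullet> b \<le> u \<bullet> b"
  have re_im: "Re l \<le> Re u" "Im l \<le> Im u"
    using le[of 1] le[of \<i>] by (auto simp: Basis_complex_def inner_complex_def)
  have B: "Basis = (\<lambda>i::2. axis i (1::real)) ` UNIV" "inj (\<lambda>i::2. axis i (1::real))"
    by (auto simp: Basis_vec_def inj_on_def axis_eq_axis)
  have eq: "complex_of_vec -` box l u = box (vec_of_complex l) (vec_of_complex u)"
    by (auto simp: box_def complex_of_vec_def vec_of_complex_def Basis_complex_def B(1)
        inner_axis forall_2 inner_complex_def)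
  have "emeasure lborel (box (vec_of_complex l) (vec_of_complex u))
      = (\<Prod>b\<in>Basis. (vec_of_complex u - vec_of_complex l) \<bullet> b)"
    by (rule emeasure_lborel_box)
      (use re_im in \<open>auto simp: B(1) inner_axis vec_of_complex_def UNIV_2\<close>)
  also have "(\<Prod>b\<in>Basis. (vec_of_complex u - vec_of_complex l) \<bullet> b) = (\<Prod>b\<in>Basis. (u - l) \<bullet> b)"
    unfolding B(1) prod.reindex[OF B(2)]
    by (simp add: UNIV_2 inner_axis Basis_complex_def vec_of_complex_def inner_complex_def)
  finally show "emeasure (distr lborel borel complex_of_vec) (box l u) = (\<Prod>b\<in>Basis. (u - l) \<bullet> b)"
    by (simp add: emeasure_distr eq)
qed simp

text \<open>Lifts measure preservation from Borel sets to the completed measure used for chart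
  integrals: null sets pull back to null sets, and completion commutes with the image
  measure.\<close>

lemma distr_lebesgue_eqI:
  fixes T :: "'a::euclidean_space \<Rightarrow> 'b::euclidean_space"
  assumes T[measurable]: "T \<in> borel_measurable borel" and d: "distr lborel borel T = lborel"
  shows "T \<in> lebesgue \<rightarrow>\<^sub>M lebesgue" "distr lebesgue lebesgue T = lebesgue"
proof -
  have eq: "distr lebesgue lborel T = lborel"
    using d by (simp add: distr_completion cong: distr_cong)
  show "T \<in> lebesgue \<rightarrow>\<^sub>M lebesgue"
    by (simp add: completion.measurable_completion2 eq measurable_completion)
  have "completion (distr lebesgue lborel T) = distr lebesgue lebesgue T"
    by (rule completion.completion_distr_eq) (auto simp: eq measurable_completion)
  then show "distr lebesgue lebesgue T = lebesgue"
    by (simp add: eq)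
qed

lemma lborel_distr_vec_of_complex: "distr lborel borel vec_of_complex = lborel"
proof -
  have "distr lborel borel vec_of_complex = distr (distr lborel borel complex_of_vec) borel vec_of_complex"
    by (simp add: lborel_distr_complex_of_vec)
  also have "\<dots> = distr lborel borel (\<lambda>v. v)"
    by (subst distr_distr) (auto simp: o_def)
  also have "\<dots> = lborel"
    by (rule distr_id2) simp
  finally show ?thesis .
qed

text \<open>Each integrand is obtained from the other by composing with a measure preserving map and
  then applying a bounded linear map to the values, so the same argument gives both
  directions.\<close>

lemma set_integral_complex_of_vec:
  fixes h :: "complex \<Rightarrow> complex"
  shows "set_integrable lebesgue A h \<longleftrightarrow> set_integrable lebesgue (vec_of_complex ` A) (\<lambda>v. vec_of_complex (h (complex_of_vec v)))" (is "?P \<longleftrightarrow> ?Q")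
    and "set_integrable lebesgue A h \<Longrightarrow>
      (LINT v:vec_of_complex ` A|lebesgue. vec_of_complex (h (complex_of_vec v))) = vec_of_complex (LINT z:A|lebesgue. h z)"
proof -
  let ?f = "\<lambda>z. indicator A z *\<^sub>R h z"
  let ?g = "\<lambda>v. indicator (vec_of_complex ` A) v *\<^sub>R vec_of_complex (h (complex_of_vec v))"
  have "complex_of_vec v \<in> A \<longleftrightarrow> v \<in> vec_of_complex ` A" for v
    by (metis complex_of_vec_of_complex image_iff vec_of_complex_of_vec)
  then have g: "?g = (\<lambda>v. vec_of_complex (?f (complex_of_vec v)))"
    by (auto simp: fun_eq_iff indicator_def linear_0[OF linear_vec_of_complex])
  have f: "?f = (\<lambda>z. complex_of_vec (?g (vec_of_complex z)))"
    unfolding fun_cong[OF g] by simp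
  note C = distr_lebesgue_eqI[OF borel_measurable_complex_of_vec lborel_distr_complex_of_vec]
  note V = distr_lebesgue_eqI[OF borel_measurable_vec_of_complex lborel_distr_vec_of_complex]
  have gf: "integrable lebesgue ?g" if i: "integrable lebesgue ?f"
  proof -
    have "integrable lebesgue (\<lambda>v. ?f (complex_of_vec v))"
      using integrable_distr[OF C(1), of ?f] i unfolding C(2) by blast
    from integrable_bounded_linear[OF bounded_linear_vec_of_complex this]
    show ?thesis unfolding g .
  qed
  have fg: "integrable lebesgue ?f" if i: "integrable lebesgue ?g"
  proof -
    have "integrable lebesgue (\<lambda>v. ?g (vec_of_complex v))"
      using integrable_distr[OF V(1), of ?g] i unfolding V(2) by blast
    from integrable_bounded_linear[OF bounded_linear_complex_of_vec this]
    show ?thesis unfolding f[symmetric] .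
  qed
  show "?P \<longleftrightarrow> ?Q"
    unfolding set_integrable_def using fg gf by blast
  assume "?P"
  then have i: "integrable lebesgue ?f"
    by (simp add: set_integrable_def)
  then have m: "?f \<in> borel_measurable lebesgue"
    by (rule borel_measurable_integrable)
  have i': "integrable lebesgue (\<lambda>v. ?f (complex_of_vec v))"
    using integrable_distr[OF C(1), of ?f] i unfolding C(2) by blast
  have "integral\<^sup>L lebesgue ?g = vec_of_complex (integral\<^sup>L lebesgue (\<lambda>v. ?f (complex_of_vec v)))"
    unfolding g by (rule integral_bounded_linear[OF bounded_linear_vec_of_complex i'])
  also have "integral\<^sup>L lebesgue (\<lambda>v. ?f (complex_of_vec v)) = integral\<^sup>L lebesgue ?f"
    using integral_distr[OF C(1) m] unfolding C(2) by simp
  finally show "(LINT v:vec_of_complex ` A|lebesgue. vec_of_complex (h (complex_of_vec v))) = vec_of_complex (LINT z:A|lebesgue. h z)"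
    unfolding set_lebesgue_integral_def .
qed

lemma sets_lebesgue_vec_of_complex: "A \<in> sets lebesgue \<Longrightarrow> vec_of_complex ` A \<in> sets lebesgue"
  by (rule differentiable_image_in_sets_lebesgue)
    (auto intro: linear_imp_differentiable_on linear_vec_of_complex)

text \<open>For \<open>a = x + i y\<close> the matrix has rows \<open>(x, - y)\<close> and
  \<open>(y, x)\<close>: this is the Jacobian determinant of a holomorphic map under the
  Cauchy-Riemann equations.\<close>

lemma det_matrix_complex_mult:
  "det (matrix (\<lambda>v. vec_of_complex (a * complex_of_vec v))) = (norm a)\<^sup>2"
  unfolding det_2 matrix_def
  by (simp add: vec_of_complex_def complex_of_vec_def axis_def cmod_power2, simp add: power2_eq_square)

text \<open>The real Jacobian of a holomorphic map is \<open>(norm (deriv f z))\<^sup>2\<close>, so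
  the theorem on \<open>real^2\<close> applies once points and values are converted. Only
  \<open>U\<close> is open; \<open>S\<close> is an arbitrary measurable subset, as the pieces of a
  decomposition are.\<close>

theorem holomorphic_change_of_variables:
  fixes f h :: "complex \<Rightarrow> complex"
  assumes f: "f holomorphic_on U" "open U" and S: "S \<in> sets lebesgue" "S \<subseteq> U" and inj: "inj_on f S"
    and int: "set_integrable lebesgue S (\<lambda>z. (norm (deriv f z))\<^sup>2 *\<^sub>R h (f z))"
  shows "f ` S \<in> sets lebesgue" "set_integrable lebesgue (f ` S) h"
    "(LINT z:f ` S|lebesgue. h z) = (LINT z:S|lebesgue. (norm (deriv f z))\<^sup>2 *\<^sub>R h (f z))"
proof -
  let ?D = "\<lambda>z. (norm (deriv f z))\<^sup>2 *\<^sub>R h (f z)"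
  have der: "(f has_field_derivative deriv f z) (at z)" if "z \<in> S" for z
    using f S that by (auto intro: holomorphic_derivI)
  then have "f differentiable_on S"
    by (meson differentiable_at_withinI differentiableI differentiable_on_def has_field_derivative_imp_has_derivative)
  then show "f ` S \<in> sets lebesgue"
    using S by (auto intro: differentiable_image_in_sets_lebesgue)
  define g where "g = (\<lambda>v. vec_of_complex (f (complex_of_vec v)))"
  define g' where "g' = (\<lambda>v w. vec_of_complex (deriv f (complex_of_vec v) * complex_of_vec w))"
  define H where "H = (\<lambda>v. vec_of_complex (h (complex_of_vec v)))"
  let ?S = "vec_of_complex ` S"
  have S': "?S \<in> sets lebesgue"
    using S(1) by (rule sets_lebesgue_vec_of_complex)
  have dg: "(g has_derivative g' v) (at v within ?S)" if "v \<in> ?S" for v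
  proof -
    have "(f has_derivative (*) (deriv f (complex_of_vec v))) (at (complex_of_vec v))"
      using that der by (auto simp: has_field_derivative_def)
    then have "((\<lambda>v. vec_of_complex (f (complex_of_vec v))) has_derivative g' v) (at v)"
      unfolding g'_def
      by (intro bounded_linear.has_derivative[OF bounded_linear_vec_of_complex]
          has_derivative_compose[where g = f, OF bounded_linear_imp_has_derivative[OF bounded_linear_complex_of_vec]])
    then show ?thesis
      unfolding g_def by (rule has_derivative_at_withinI)
  qed
  have ig: "inj_on g ?S"
    using inj by (auto simp: inj_on_def g_def) (metis complex_of_vec_of_complex)
  have gS: "g ` ?S = vec_of_complex ` (f ` S)"
    by (force simp: g_def)
  have eq: "(\<lambda>v. \<bar>det (matrix (g' v))\<bar> *\<^sub>R H (g v)) = (\<lambda>v. vec_of_complex (?D (complex_of_vec v)))"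
    by (simp add: g'_def det_matrix_complex_mult H_def g_def linear_scale[OF linear_vec_of_complex])
  note cv = has_absolute_integral_change_of_variables[OF S' dg ig, of H, unfolded eq]
  have i: "set_integrable lebesgue ?S (\<lambda>v. vec_of_complex (?D (complex_of_vec v)))"
    using int set_integral_complex_of_vec(1)[of S ?D] by blast
  then have H: "set_integrable lebesgue (vec_of_complex ` (f ` S)) H"
    "integral (vec_of_complex ` (f ` S)) H = integral ?S (\<lambda>v. vec_of_complex (?D (complex_of_vec v)))"
    using cv unfolding gS by blast+
  then show hint: "set_integrable lebesgue (f ` S) h"
    using set_integral_complex_of_vec(1)[of "f ` S" h] unfolding H_def by blast
  have "vec_of_complex (LINT z:f ` S|lebesgue. h z) = (LINT v:vec_of_complex ` (f ` S)|lebesgue. H v)"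
    unfolding H_def by (rule set_integral_complex_of_vec(2)[OF hint, symmetric])
  also have "\<dots> = (LINT v:?S|lebesgue. vec_of_complex (?D (complex_of_vec v)))"
    using H i by (simp only: set_lebesgue_integral_eq_integral)
  also have "\<dots> = vec_of_complex (LINT z:S|lebesgue. ?D z)"
    by (rule set_integral_complex_of_vec(2)[OF int])
  finally show "(LINT z:f ` S|lebesgue. h z) = (LINT z:S|lebesgue. ?D z)"
    by (metis complex_of_vec_of_complex)
qed

section \<open>Charts\<close>

text \<open>Trades the homeomorphism of subspaces for statements about open sets of \<open>X\<close>
  alone, the form in which charts of the glued space can be checked.\<close>

lemma chart_on_altdef:
  "chart_on X c \<longleftrightarrow> openin X (fst c) \<and> inj_on (snd c) (fst c) \<and>
     (\<forall>U. openin X U \<and> U \<subseteq> fst c \<longrightarrow> open (snd c ` U)) \<and>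
     (\<forall>V. open V \<longrightarrow> openin X (coord_preimage c V))" (is "?L \<longleftrightarrow> ?R")
proof
  assume L: ?L
  then have op: "openin X (fst c)" and im: "open (snd c ` fst c)"
    and hom: "homeomorphic_map (subtopology X (fst c)) (top_of_set (snd c ` fst c)) (snd c)"
    by (auto simp: chart_on_def)
  have ts: "topspace (subtopology X (fst c)) = fst c"
    using openin_subset[OF op] by auto
  have 1: "openin X U \<longleftrightarrow> open (snd c ` U)" if "U \<subseteq> fst c" for U
    using homeomorphic_map_openness[OF hom, of U] that im op ts
    by (auto simp: openin_open_subtopology openin_open_eq)
  have 2: "openin X (coord_preimage c V)" if "open V" for V
  proof -
    have "snd c ` coord_preimage c V = snd c ` fst c \<inter> V"
      by (auto simp: coord_preimage_def)
    then show ?thesis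
      using 1[of "coord_preimage c V"] im that by (auto simp: coord_preimage_def)
  qed
  show ?R
    using op homeomorphic_imp_injective_map[OF hom] ts 1 2 by auto
next
  assume R: ?R
  then have op: "openin X (fst c)" and im: "open (snd c ` fst c)"
    by auto
  have ts: "topspace (subtopology X (fst c)) = fst c"
    using openin_subset[OF op] by auto
  have "homeomorphic_map (subtopology X (fst c)) (top_of_set (snd c ` fst c)) (snd c)"
  proof (rule bijective_open_imp_homeomorphic_map)
    show "continuous_map (subtopology X (fst c)) (top_of_set (snd c ` fst c)) (snd c)"
      unfolding continuous_map_def ts
    proof (intro conjI allI impI)
      fix U assume "openin (top_of_set (snd c ` fst c)) U"
      then have "open U" using im by (simp add: openin_open_eq)
      then show "openin (subtopology X (fst c)) {x \<in> fst c. snd c x \<in> U}"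
        using R op by (auto simp: openin_open_subtopology coord_preimage_def)
    qed auto
    show "open_map (subtopology X (fst c)) (top_of_set (snd c ` fst c)) (snd c)"
      unfolding open_map_def using R op im
      by (auto simp: openin_open_subtopology openin_open_eq)
  qed (use R ts in auto)
  then show ?L
    using op im by (simp add: chart_on_def)
qed

text \<open>In a Hausdorff surface this makes compact coordinate sets closed; applied to the skean,
  it shows that cutting leaves an open set.\<close>

lemma compactin_coord_preimage:
  assumes "chart_on X c" "compact K" "K \<subseteq> snd c ` fst c"
  shows "compactin X (coord_preimage c K)"
proof -
  have hom: "homeomorphic_map (subtopology X (fst c)) (top_of_set (snd c ` fst c)) (snd c)"
    and op: "openin X (fst c)"
    using assms(1) by (auto simp: chart_on_def)
  have "snd c ` coord_preimage c K = K"
    using assms(3) by (auto simp: coord_preimage_def)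
  then have "compactin (subtopology X (fst c)) (coord_preimage c K)"
    using homeomorphic_map_compactness_eq[OF hom, of "coord_preimage c K"] assms(2,3) openin_subset[OF op]
    by (auto simp: coord_preimage_def compactin_subtopology)
  then show ?thesis
    by (simp add: compactin_subtopology)
qed

lemma transition_coord:
  assumes "inj_on (snd c) (fst c)" "p \<in> fst c"
  shows "transition c d (snd c p) = snd d p"
  using assms by (simp add: transition_def)


section \<open>The deformed surface\<close>

locale skean_surgery =
  fixes X :: "'a topology" and \<A> :: "'a chart set" and c :: "'a chart" and \<theta> \<epsilon> \<rho> :: real
  assumes theta: "0 \<le> \<theta>" "\<theta> \<le> pi / 2"
    and eps: "0 < \<epsilon>"
    and surface: "compact_riemann_surface X \<A>"
    and chart: "c \<in> \<A>"
    and disc: "ball 0 \<rho> \<subseteq> snd c ` fst c"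
    and skean_subset: "skean \<theta> \<epsilon> \<subseteq> ball 0 \<rho>"
begin

abbreviation "K \<equiv> complex_of_real (quad_const \<theta> \<epsilon>)"
abbreviation "D \<equiv> filled_image_disc \<theta> \<epsilon> \<rho>"
abbreviation "SK \<equiv> coord_preimage c (skean \<theta> \<epsilon>)"
abbreviation "A \<equiv> skean_to_slit \<theta> \<epsilon>"
text \<open>The inverse of \<open>A\<close> in closed form, meaningful off the slit.\<close>

abbreviation "B \<equiv> quad_shift (- K)"
abbreviation "glue \<equiv> glue_disc c \<theta> \<epsilon>"
abbreviation "X' \<equiv> deformed_surface X c \<theta> \<epsilon> \<rho>"
abbreviation "\<A>' \<equiv> deformed_atlas \<A> c \<theta> \<epsilon> \<rho>"
abbreviation "res \<equiv> restricted_chart c \<theta> \<epsilon>"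
abbreviation "zc \<equiv> zeta_chart c \<theta> \<epsilon> \<rho>"
abbreviation "pts \<equiv> deformed_points X c \<theta> \<epsilon>"
abbreviation "q \<zeta> \<equiv> inv_into (fst c) (snd c) (B \<zeta>)"

lemma charts: "d \<in> \<A> \<Longrightarrow> chart_on X d"
  and hausdorff: "Hausdorff_space X"
  and connected: "connected_space X"
  and compact: "compact_space X"
  and topspace_eq: "topspace X = (\<Union>d\<in>\<A>. fst d)"
  and transitions: "d \<in> \<A> \<Longrightarrow> e \<in> \<A> \<Longrightarrow> transition d e holomorphic_on snd d ` (fst d \<inter> fst e)"
  using surface by (auto simp: compact_riemann_surface_def riemann_surface_def)

lemma inj_chart: "d \<in> \<A> \<Longrightarrow> inj_on (snd d) (fst d)"
  and open_chart_image: "\<lbrakk>d \<in> \<A>; openin X U; U \<subseteq> fst d\<rbrakk> \<Longrightarrow> open (snd d ` U)"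
  and openin_coord_preimage: "\<lbrakk>d \<in> \<A>; open V\<rbrakk> \<Longrightarrow> openin X (coord_preimage d V)"
  and openin_chart: "d \<in> \<A> \<Longrightarrow> openin X (fst d)"
  using charts[of d] unfolding chart_on_altdef by blast+

section \<open>The filled image disc and the gluing map\<close>

lemma rho_pos: "0 < \<rho>"
  using zero_in_skean[OF eps theta] skean_subset by (metis centre_in_ball subsetD)

lemma B_off_slit: "z \<notin> slit \<epsilon> \<Longrightarrow> B z \<notin> skean \<theta> \<epsilon>"
  using bij_betw_quad_shift(2)[OF eps theta] by (auto simp: bij_betw_def)

lemma A_off_skean: "w \<notin> skean \<theta> \<epsilon> \<Longrightarrow> A w \<notin> slit \<epsilon>"
  using bij_betw_skean_to_slit[OF eps theta] by (auto simp: bij_betw_def)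

lemma A_B: "z \<notin> slit \<epsilon> \<Longrightarrow> A (B z) = z"
  using inv_skean_to_slit_eq[OF eps theta, of z] bij_betw_inv_into_right[OF bij_betw_skean_to_slit[OF eps theta], of z]
  by simp

lemma B_A: "w \<notin> skean \<theta> \<epsilon> \<Longrightarrow> B (A w) = w"
  using inv_skean_to_slit_eq[OF eps theta, of "A w"] bij_betw_inv_into_left[OF bij_betw_skean_to_slit[OF eps theta], of w]
    A_off_skean[of w] by simp

lemma B_power2: "z \<notin> slit \<epsilon> \<Longrightarrow> (B z)\<^sup>2 = z\<^sup>2 - K"
  using radicand_off_slit(1)[OF eps] by (subst quad_shift_power2) auto

text \<open>The radius is arbitrary because separation and compactness use a disc smaller than the
  given one.\<close>

lemma B_in_ball_iff:
  assumes "z \<notin> slit \<epsilon>" "0 < r"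
  shows "norm (B z) < r \<longleftrightarrow> norm (z\<^sup>2 - K) < r\<^sup>2"
  using B_power2[OF assms(1)] power_mono_iff[of r "norm (B z)" 2] assms(2)
  by (metis linorder_not_le norm_ge_zero norm_power less_imp_le zero_less_numeral)

lemma A_in_iff:
  assumes "w \<notin> skean \<theta> \<epsilon>" "0 < r"
  shows "norm ((A w)\<^sup>2 - K) < r\<^sup>2 \<longleftrightarrow> norm w < r"
  using B_in_ball_iff[OF A_off_skean[OF assms(1)] assms(2)] B_A[OF assms(1)] by simp

text \<open>On the slit \<open>B\<close> gives no information, so an arbitrary square root of
  \<open>z\<^sup>2 - K\<close> is taken instead; whichever it is, it lies on the skean.\<close>

lemma slit_power2_bound:
  assumes "z \<in> slit \<epsilon>" "0 < r" "skean \<theta> \<epsilon> \<subseteq> ball 0 r"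
  shows "norm (z\<^sup>2 - K) < r\<^sup>2"
proof -
  define w where "w = csqrt (z\<^sup>2 - K)"
  have w: "w\<^sup>2 = z\<^sup>2 - K" by (simp add: w_def)
  then have "w \<in> skean \<theta> \<epsilon>"
    using skean_iff_slit[OF eps theta, of z w] assms(1) by simp
  then have "norm w < r" using assms(3) by auto
  then have "(norm w)\<^sup>2 < r\<^sup>2" by (simp add: power_strict_mono)
  then show ?thesis
    by (simp flip: w norm_power)
qed

text \<open>The definition joins an image with the slit; this explicit inequality is what shows
  openness, star shape and the comparison of radii.\<close>

lemma D_eq: "D = {z. norm (z\<^sup>2 - K) < \<rho>\<^sup>2}"
proof (intro equalityI subsetI)
  fix z assume "z \<in> D"
  then consider "z \<in> slit \<epsilon>" | w where "w \<in> ball 0 \<rho>" "w \<notin> skean \<theta> \<epsilon>" "z = A w"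
    by (auto simp: filled_image_disc_def)
  then show "z \<in> {z. norm (z\<^sup>2 - K) < \<rho>\<^sup>2}"
    using slit_power2_bound[OF _ rho_pos skean_subset] A_in_iff rho_pos by cases auto
next
  fix z assume z: "z \<in> {z. norm (z\<^sup>2 - K) < \<rho>\<^sup>2}"
  show "z \<in> D"
  proof (cases "z \<in> slit \<epsilon>")
    case False
    then have "B z \<in> ball 0 \<rho> - skean \<theta> \<epsilon>"
      using z B_in_ball_iff[OF False rho_pos] B_off_slit by auto
    then have "A (B z) \<in> D"
      by (auto simp: filled_image_disc_def)
    then show ?thesis by (simp add: A_B[OF False])
  qed (simp add: filled_image_disc_def)
qed

lemma open_D: "open D"
  unfolding D_eq by (intro open_Collect_less continuous_intros)

lemma slit_subset_D: "slit \<epsilon> \<subseteq> D"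
  by (auto simp: filled_image_disc_def)

lemma closed_slit: "closed (slit \<epsilon>)"
  using compact_slit[OF eps] compact_imp_closed by blast

lemma closed_skean: "closed (skean \<theta> \<epsilon>)"
  using compact_skean[OF eps theta] compact_imp_closed by blast

text \<open>\<open>D\<close> is star-shaped about \<open>0\<close>: squaring turns scaling by \<open>t\<close> into a convex combination
  with the value at \<open>0\<close>.\<close>

lemma connected_D: "connected D"
proof -
  have "starlike D"
    unfolding starlike_def
  proof (intro bexI ballI)
    show "0 \<in> D"
      using slit_subset_D zero_in_slit[OF eps] by blast
    fix z assume z: "z \<in> D"
    show "closed_segment 0 z \<subseteq> D"
    proof
      fix y assume "y \<in> closed_segment 0 z"
      then obtain t where t: "0 \<le> t" "t \<le> 1" "y = t *\<^sub>R z"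
        by (auto simp: closed_segment_def)
      have "y\<^sup>2 - K = (1 - t\<^sup>2) *\<^sub>R (0\<^sup>2 - K) + t\<^sup>2 *\<^sub>R (z\<^sup>2 - K)"
        by (simp add: t(3) scaleR_conv_of_real power_mult_distrib algebra_simps)
      moreover have "\<dots> \<in> ball 0 (\<rho>\<^sup>2)"
        using z \<open>0 \<in> D\<close> t power_le_one[of t 2]
        by (intro convexD_alt[OF convex_ball]) (auto simp: D_eq)
      ultimately show "y \<in> D"
        by (simp add: D_eq)
    qed
  qed
  then show ?thesis by (rule starlike_imp_connected)
qed

lemma compactin_SK: "compactin X SK"
  using compactin_coord_preimage[OF charts[OF chart] compact_skean[OF eps theta]] skean_subset disc by blast

lemma closedin_SK: "closedin X SK"
  using compactin_imp_closedin[OF hausdorff compactin_SK] .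

lemma open_off_SK: "openin X U \<Longrightarrow> openin X (U - SK)"
  using closedin_SK openin_diff by blast

lemma B_in:
  assumes "z \<in> D" "z \<notin> slit \<epsilon>"
  shows "norm (B z) < \<rho>" "B z \<notin> skean \<theta> \<epsilon>" "q z \<in> fst c" "q z \<notin> SK" "snd c (q z) = B z"
proof -
  show 1: "norm (B z) < \<rho>" "B z \<notin> skean \<theta> \<epsilon>"
    using assms B_in_ball_iff[OF assms(2) rho_pos] B_off_slit by (auto simp: D_eq)
  then have "B z \<in> snd c ` fst c"
    using disc by auto
  then show "q z \<in> fst c" and 2: "snd c (q z) = B z"
    by (auto intro: inv_into_into f_inv_into_f)
  show "q z \<notin> SK"
    using 1 2 by (simp add: coord_preimage_def)
qed

lemma A_in:
  assumes "p \<in> fst c" "norm (snd c p) < \<rho>" "p \<notin> SK"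
  shows "A (snd c p) \<in> D" "A (snd c p) \<notin> slit \<epsilon>" "glue (A (snd c p)) = Inl p"
proof -
  have w: "snd c p \<notin> skean \<theta> \<epsilon>"
    using assms by (simp add: coord_preimage_def)
  show 1: "A (snd c p) \<in> D" "A (snd c p) \<notin> slit \<epsilon>"
    using assms w by (auto simp: A_off_skean filled_image_disc_def)
  then have "q (A (snd c p)) = p"
    using B_A[OF w] inj_chart[OF chart] assms(1) by simp
  then show "glue (A (snd c p)) = Inl p"
    using 1 inv_skean_to_slit_eq[OF eps theta, of "A (snd c p)"] by (simp add: glue_disc_def)
qed

lemma glue_slit: "z \<in> slit \<epsilon> \<Longrightarrow> glue z = Inr z"
  and glue_off_slit: "z \<notin> slit \<epsilon> \<Longrightarrow> glue z = Inl (q z)"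
  using inv_skean_to_slit_eq[OF eps theta, of z] by (auto simp: glue_disc_def)

lemma zc_glue: "z \<in> D \<Longrightarrow> snd zc (glue z) = z"
  using B_in[of z] A_B[of z] by (cases "z \<in> slit \<epsilon>") (auto simp: glue_slit glue_off_slit zeta_chart_def)

lemma fst_zc: "fst zc = glue ` D"
  by (simp add: zeta_chart_def)

lemma inj_glue: "inj_on glue D"
  by (metis inj_onI zc_glue)

lemma Inl_in_zc_iff: "Inl p \<in> glue ` D \<longleftrightarrow> p \<in> fst c \<and> norm (snd c p) < \<rho> \<and> p \<notin> SK"
proof
  assume "Inl p \<in> glue ` D"
  then obtain z where "z \<in> D" "glue z = Inl p" by auto
  then show "p \<in> fst c \<and> norm (snd c p) < \<rho> \<and> p \<notin> SK"
    using B_in[of z] by (cases "z \<in> slit \<epsilon>") (auto simp: glue_slit glue_off_slit)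
next
  assume "p \<in> fst c \<and> norm (snd c p) < \<rho> \<and> p \<notin> SK"
  then show "Inl p \<in> glue ` D"
    using A_in[of p] by (metis imageI)
qed

lemma Inr_in_zc_iff: "Inr z \<in> glue ` D \<longleftrightarrow> z \<in> slit \<epsilon>"
proof
  assume "Inr z \<in> glue ` D"
  then obtain y where "Inr z = glue y" by auto
  then show "z \<in> slit \<epsilon>"
    by (cases "y \<in> slit \<epsilon>") (auto simp: glue_slit glue_off_slit)
qed (use slit_subset_D glue_slit in force)

section \<open>Topology of the deformed surface\<close>

lemma fst_c_subset: "fst c \<subseteq> topspace X"
  using openin_subset openin_chart chart by blast

lemma glue_in_pts: "z \<in> D \<Longrightarrow> glue z \<in> pts"
  using B_in[of z] fst_c_subset
  by (cases "z \<in> slit \<epsilon>") (auto simp: glue_slit glue_off_slit deformed_points_def)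

text \<open>Both spaces being glued are open in their surroundings, so relative openness becomes
  openness in \<open>X\<close> and in the plane. That the predicate is a topology must be shown
  before \<open>topology\<close> can be unfolded.\<close>

lemma openin_deformed:
  "openin X' V \<longleftrightarrow> V \<subseteq> pts \<and> openin X (Inl -` V) \<and> open {z \<in> D. glue z \<in> V}" (is "_ \<longleftrightarrow> ?Q V")
proof -
  have eq: "(V \<subseteq> pts \<and> openin (subtopology X (topspace X - SK)) (Inl -` V) \<and>
      openin (top_of_set D) {z \<in> D. glue z \<in> V}) \<longleftrightarrow> ?Q V" for V
    using open_off_SK[OF openin_topspace] open_D
    by (auto simp: openin_open_subtopology openin_open_eq deformed_points_def)
  have "istopology ?Q"
    unfolding istopology_def
  proof (intro conjI allI impI)
    fix S T assume S: "?Q S" and T: "?Q T"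
    have "{z \<in> D. glue z \<in> S \<inter> T} = {z \<in> D. glue z \<in> S} \<inter> {z \<in> D. glue z \<in> T}" by auto
    then show "openin X (Inl -` (S \<inter> T))" "open {z \<in> D. glue z \<in> S \<inter> T}"
      using S T by (auto simp: openin_Int)
    show "S \<inter> T \<subseteq> pts" using S by auto
  next
    fix \<K> assume K: "\<forall>V\<in>\<K>. ?Q V"
    have "{z \<in> D. glue z \<in> \<Union>\<K>} = (\<Union>V\<in>\<K>. {z \<in> D. glue z \<in> V})" by auto
    then show "openin X (Inl -` \<Union>\<K>)" "open {z \<in> D. glue z \<in> \<Union>\<K>}" 
      using K by (auto simp: vimage_Union)
    show "\<Union>\<K> \<subseteq> pts" using K by auto
  qed
  then show ?thesis
    unfolding deformed_surface_def eq by simp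
qed

lemma topspace_deformed: "topspace X' = pts"
proof
  show "topspace X' \<subseteq> pts"
    using openin_deformed[of "topspace X'"] by simp
  have "Inl -` pts = topspace X - SK" "{z \<in> D. glue z \<in> pts} = D"
    using glue_in_pts by (auto simp: deformed_points_def)
  then have "openin X' pts"
    using open_off_SK[OF openin_topspace] open_D by (simp add: openin_deformed)
  then show "pts \<subseteq> topspace X'"
    by (rule openin_subset)
qed

lemma continuous_B: "continuous_on (- slit \<epsilon>) B"
  using holomorphic_quad_shift_off_slit[OF eps theta] by (simp add: holomorphic_on_imp_continuous_on)

lemma continuous_A: "continuous_on (- skean \<theta> \<epsilon>) A"
  using holomorphic_skean_to_slit[OF eps theta] by (rule holomorphic_on_imp_continuous_on)

text \<open>The cut surface enters the glued one by an open map: the trace of \<open>U\<close> in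
  the \<zeta>-plane is the preimage of its coordinate image under \<open>B\<close>, which is
  continuous off the closed slit.\<close>

lemma openin_Inl_image:
  assumes "openin X U" "U \<inter> SK = {}"
  shows "openin X' (Inl ` U)"
proof -
  have "{z \<in> D. glue z \<in> Inl ` U} = D \<inter> ((- slit \<epsilon>) \<inter> B -` (snd c ` (U \<inter> fst c)))"
  proof (intro equalityI subsetI)
    fix z assume "z \<in> {z \<in> D. glue z \<in> Inl ` U}"
    then have z: "z \<in> D" "glue z \<in> Inl ` U" by auto
    then have "z \<notin> slit \<epsilon>" by (auto simp: glue_slit)
    then show "z \<in> D \<inter> ((- slit \<epsilon>) \<inter> B -` (snd c ` (U \<inter> fst c)))"
      using z B_in[of z] by (force simp: glue_off_slit)
  next
    fix z assume "z \<in> D \<inter> ((- slit \<epsilon>) \<inter> B -` (snd c ` (U \<inter> fst c)))"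
    then obtain p where "z \<in> D" "z \<notin> slit \<epsilon>" "p \<in> U" "p \<in> fst c" "B z = snd c p"
      by auto
    then show "z \<in> {z \<in> D. glue z \<in> Inl ` U}"
      using inj_chart[OF chart] by (simp add: glue_off_slit)
  qed
  moreover have "open (snd c ` (U \<inter> fst c))"
    using open_chart_image[OF chart] assms(1) openin_chart[OF chart] by blast
  then have "open ((- slit \<epsilon>) \<inter> B -` (snd c ` (U \<inter> fst c)))"
    using continuous_B closed_slit continuous_on_open_vimage[of "- slit \<epsilon>" B] by (auto simp: Int_commute)
  moreover have "Inl -` (Inl ` U :: ('a + complex) set) = U"
    by auto
  ultimately show ?thesis
    using assms open_D openin_subset[OF assms(1)] unfolding openin_deformed
    by (auto simp: deformed_points_def)
qed

text \<open>The counterpart for the \<zeta>-plane, by continuity of \<open>A\<close> off the closed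
  skean.\<close>

lemma openin_glue_image:
  assumes "open W" "W \<subseteq> D"
  shows "openin X' (glue ` W)"
proof -
  have "Inl -` (glue ` W) = coord_preimage c (ball 0 \<rho> \<inter> ((- skean \<theta> \<epsilon>) \<inter> A -` W))"
  proof (intro equalityI subsetI)
    fix p assume "p \<in> Inl -` (glue ` W)"
    then obtain z where z: "z \<in> W" "Inl p = glue z" by auto
    then have "z \<notin> slit \<epsilon>" "z \<in> D" using assms(2) by (auto simp: glue_slit)
    then show "p \<in> coord_preimage c (ball 0 \<rho> \<inter> ((- skean \<theta> \<epsilon>) \<inter> A -` W))"
      using z B_in[of z] A_B[of z] by (auto simp: glue_off_slit coord_preimage_def)
  next
    fix p assume p: "p \<in> coord_preimage c (ball 0 \<rho> \<inter> ((- skean \<theta> \<epsilon>) \<inter> A -` W))"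
    then have "glue (A (snd c p)) = Inl p" "A (snd c p) \<in> W"
      using A_in(3)[of p] by (auto simp: coord_preimage_def)
    then show "p \<in> Inl -` (glue ` W)"
      by (metis imageI vimageI)
  qed
  moreover have "open ((- skean \<theta> \<epsilon>) \<inter> A -` W)"
    using continuous_A closed_skean assms(1) continuous_on_open_vimage[of "- skean \<theta> \<epsilon>" A]
    by (auto simp: Int_commute)
  moreover have "{z \<in> D. glue z \<in> glue ` W} = W"
    using inj_glue assms(2) by (auto dest: inj_onD)
  ultimately show ?thesis
    using assms openin_coord_preimage[OF chart, of "ball 0 \<rho> \<inter> (- skean \<theta> \<epsilon> \<inter> A -` W)"] glue_in_pts
    by (auto simp: openin_deformed open_Int)
qed

lemma chart_on_res:
  assumes "d \<in> \<A>" shows "chart_on X' (res d)"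
  unfolding chart_on_altdef
proof (intro conjI allI impI)
  have fst: "fst (res d) = Inl ` (fst d - SK)" and snd: "snd (res d) = snd d \<circ> projl"
    by (auto simp: restricted_chart_def)
  show "openin X' (fst (res d))"
    unfolding fst using open_off_SK[OF openin_chart[OF assms]] by (intro openin_Inl_image) auto
  show "inj_on (snd (res d)) (fst (res d))"
    unfolding fst snd using inj_chart[OF assms] by (auto simp: inj_on_def)
  show "open (snd (res d) ` U)" if U: "openin X' U \<and> U \<subseteq> fst (res d)" for U
  proof -
    have "snd (res d) ` U = snd d ` (Inl -` U)"
      using U unfolding fst snd by force
    then show ?thesis
      using U open_chart_image[OF assms, of "Inl -` U"] by (auto simp: openin_deformed fst)
  qed
  show "openin X' (coord_preimage (res d) V)" if "open V" for V
  proof -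
    have "coord_preimage (res d) V = Inl ` (coord_preimage d V - SK)"
      by (auto simp: coord_preimage_def fst snd)
    then show ?thesis
      using open_off_SK[OF openin_coord_preimage[OF assms that]] openin_Inl_image by auto
  qed
qed

lemma chart_on_zc: "chart_on X' zc"
  unfolding chart_on_altdef fst_zc
proof (intro conjI allI impI)
  show "openin X' (glue ` D)"
    by (intro openin_glue_image open_D order_refl)
  show "inj_on (snd zc) (glue ` D)"
    by (auto simp: inj_on_def zc_glue)
  show "open (snd zc ` U)" if U: "openin X' U \<and> U \<subseteq> glue ` D" for U
  proof -
    have "snd zc ` U = {z \<in> D. glue z \<in> U}"
      using U zc_glue by (force simp: image_iff)
    then show ?thesis
      using U by (simp add: openin_deformed)
  qed
  show "openin X' (coord_preimage zc V)" if "open V" for V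
  proof -
    have "coord_preimage zc V = glue ` (D \<inter> V)"
      by (auto simp: coord_preimage_def fst_zc zc_glue)
    then show ?thesis
      using that open_D openin_glue_image[of "D \<inter> V"] by auto
  qed
qed

lemma chart_on_deformed: "d' \<in> \<A>' \<Longrightarrow> chart_on X' d'"
  using chart_on_res chart_on_zc by (auto simp: deformed_atlas_def)

lemma pts_cases:
  assumes "x \<in> pts"
  obtains p where "x = Inl p" "p \<in> topspace X" "p \<notin> SK"
  | z where "x = Inr z" "z \<in> slit \<epsilon>"
  using assms by (auto simp: deformed_points_def)

text \<open>A compact set in an open disc has a point of largest modulus, which leaves an annulus of
  room between the skean and the boundary.\<close>

lemma intermediate_radius:
  obtains \<sigma> where "0 < \<sigma>" "\<sigma> < \<rho>" "skean \<theta> \<epsilon> \<subseteq> ball 0 \<sigma>"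
proof -
  have "norm ` skean \<theta> \<epsilon> \<noteq> {}" using zero_in_skean[OF eps theta] by auto
  moreover have "compact (norm ` skean \<theta> \<epsilon>)"
    using compact_skean[OF eps theta] by (intro compact_continuous_image continuous_intros)
  ultimately obtain s where s: "s \<in> skean \<theta> \<epsilon>" "\<And>w. w \<in> skean \<theta> \<epsilon> \<Longrightarrow> norm w \<le> norm s"
    using compact_attains_sup[of "norm ` skean \<theta> \<epsilon>"] by auto
  then have "norm s < \<rho>" using skean_subset by auto
  then obtain \<sigma> where "norm s < \<sigma>" "\<sigma> < \<rho>" using dense by blast
  moreover have "skean \<theta> \<epsilon> \<subseteq> ball 0 \<sigma>"
  proof
    fix w assume "w \<in> skean \<theta> \<epsilon>"
    then show "w \<in> ball 0 \<sigma>"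
      using s(2)[of w] \<open>norm s < \<sigma>\<close> by simp
  qed
  ultimately show ?thesis
    using that[of \<sigma>] norm_ge_zero[of s] by linarith
qed

text \<open>The one case that neither \<open>X\<close> nor the \<zeta>-plane settles alone: a point
  outside the \<rho>-disc against a point of the slit. The closed \<sigma>-disc lies between
  them.\<close>

lemma separate_from_slit:
  assumes "z \<in> slit \<epsilon>" "p \<in> topspace X" "Inl p \<notin> glue ` D" "p \<notin> SK"
  shows "\<exists>U V. openin X' U \<and> openin X' V \<and> Inl p \<in> U \<and> Inr z \<in> V \<and> disjnt U V"
proof -
  obtain \<sigma> where s: "0 < \<sigma>" "\<sigma> < \<rho>" "skean \<theta> \<epsilon> \<subseteq> ball 0 \<sigma>"
    by (rule intermediate_radius)
  define C where "C = coord_preimage c (cball 0 \<sigma>)"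
  \<comment> \<open>The filled image of the \<sigma>-disc: off the slit, its points have
    \<open>norm (B z) < \<sigma>\<close> and are thus glued to points of \<open>C\<close>.\<close>
  define W where "W = {z. norm (z\<^sup>2 - K) < \<sigma>\<^sup>2}"
  have "cball 0 \<sigma> \<subseteq> snd c ` fst c"
    using disc s(2) cball_subset_ball_iff[of 0 \<sigma> "0::complex" \<rho>] by auto
  then have "closedin X C"
    unfolding C_def
    by (intro compactin_imp_closedin hausdorff compactin_coord_preimage charts chart compact_cball)
  moreover have SKC: "SK \<subseteq> C"
    using s(3) ball_subset_cball[of 0 \<sigma>] unfolding C_def coord_preimage_def by blast
  ultimately have U: "openin X' (Inl ` (topspace X - C))"
    by (intro openin_Inl_image) (auto intro: openin_diff)
  have "p \<notin> C"
    using assms s unfolding Inl_in_zc_iff by (auto simp: C_def coord_preimage_def)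
  have W: "open W"
    unfolding W_def by (intro open_Collect_less continuous_intros)
  have "\<sigma>\<^sup>2 \<le> \<rho>\<^sup>2" using s by (simp add: power_mono)
  then have WD: "W \<subseteq> D"
    unfolding W_def D_eq by auto
  have "Inr z \<in> glue ` W"
    using slit_power2_bound[OF assms(1) s(1,3)] glue_slit[OF assms(1)]
    by (intro image_eqI[of _ _ z]) (auto simp: W_def)
  moreover have "disjnt (Inl ` (topspace X - C)) (glue ` W)"
  proof -
    have "glue y \<noteq> Inl r" if "y \<in> W" "r \<notin> C" for y r
    proof (cases "y \<in> slit \<epsilon>")
      case False
      have "norm (B y) < \<sigma>"
        using that B_in_ball_iff[OF False s(1)] by (simp add: W_def)
      then have "q y \<in> C"
        using B_in[of y] False that WD by (auto simp: C_def coord_preimage_def)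
      then show ?thesis
        using False that by (auto simp: glue_off_slit)
    qed (simp add: glue_slit)
    then show ?thesis
      unfolding disjnt_iff by (metis DiffD2 imageE)
  qed
  ultimately show ?thesis
    using U openin_glue_image[OF W WD] \<open>p \<notin> C\<close> assms(2) by blast
qed

text \<open>Separating sets come from the plane for two points of the \<zeta> chart, from
  \<open>X\<close> for two points off the skean, and from the intermediate disc in the mixed
  case.\<close>

lemma Hausdorff_deformed: "Hausdorff_space X'"
  unfolding Hausdorff_space_def topspace_deformed
proof (intro allI impI, elim conjE)
  let ?P = "\<lambda>x y. \<exists>U V. openin X' U \<and> openin X' V \<and> x \<in> U \<and> y \<in> V \<and> disjnt U V"
  fix x y assume xy: "x \<in> pts" "y \<in> pts" "x \<noteq> y"
  have sym: "?P y x \<Longrightarrow> ?P x y" for x y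
    by (metis disjnt_sym)
  have in_zc: "?P x y" if in_D: "x \<in> glue ` D" "y \<in> glue ` D"
  proof -
    obtain u v where uv: "x = glue u" "y = glue v" "u \<in> D" "v \<in> D"
      using in_D by blast
    then have "u \<noteq> v" using xy(3) by blast
    then obtain U V where UV: "open U" "open V" "u \<in> U" "v \<in> V" "U \<inter> V = {}"
      using separation_t2[of u v] by blast
    have "glue ` (U \<inter> D) \<inter> glue ` (V \<inter> D) = {}"
      using inj_on_image_Int[OF inj_glue, of "U \<inter> D" "V \<inter> D"] UV(5) by auto
    moreover have "openin X' (glue ` (U \<inter> D))" "openin X' (glue ` (V \<inter> D))"
      using UV open_D by (auto intro!: openin_glue_image)
    ultimately show ?thesis
      using uv UV(3,4) unfolding disjnt_def by blast
  qed
  show "?P x y"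
    using xy(1)
  proof (cases x rule: pts_cases)
    case (1 p)
    show ?thesis
      using xy(2)
    proof (cases y rule: pts_cases)
      case y: (1 r)
      then obtain U V where "openin X U" "openin X V" "p \<in> U" "r \<in> V" "disjnt U V"
        using hausdorff 1 xy(3) unfolding Hausdorff_space_def by metis
      moreover from this have "openin X' (Inl ` (U - SK))" "openin X' (Inl ` (V - SK))"
        by (auto intro!: openin_Inl_image open_off_SK)
      moreover have "disjnt (Inl ` (U - SK) :: ('a + complex) set) (Inl ` (V - SK))"
        using \<open>disjnt U V\<close> by (auto simp: disjnt_def)
      ultimately show ?thesis
        using 1 y by (metis DiffI imageI)
    next
      case y: (2 z)
      show ?thesis
        using in_zc separate_from_slit[of z p] 1 y Inr_in_zc_iff[of z] by blast
    qed
  next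
    case (2 z)
    show ?thesis
      using xy(2)
    proof (cases y rule: pts_cases)
      case y: (1 p)
      show ?thesis
        using in_zc sym[OF separate_from_slit[of z p]] 2 y Inr_in_zc_iff[of z] by blast
    next
      case (2 z')
      then show ?thesis
        using in_zc \<open>x = Inr z\<close> \<open>z \<in> slit \<epsilon>\<close> by (simp add: Inr_in_zc_iff)
    qed
  qed
qed

text \<open>A separation in which one side misses the glued disc could be carried back to a
  separation of the connected surface \<open>X\<close>.\<close>

lemma connected_deformed_aux:
  assumes "openin X' E1" "openin X' E2" "pts \<subseteq> E1 \<union> E2" "E1 \<inter> E2 = {}" "E2 \<noteq> {}" "E2 \<inter> glue ` D = {}"
  shows False
proof -
  \<comment> \<open>The whole disc, skean included, goes to this side; off the skean it belonged to
    \<open>E1\<close> already, since \<open>E2\<close> misses it.\<close>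
  define F1 where "F1 = Inl -` E1 \<union> coord_preimage c (ball 0 \<rho>)"
  define F2 where "F2 = Inl -` E2"
  have "openin X F1" "openin X F2"
    unfolding F1_def F2_def using assms(1,2) openin_coord_preimage[OF chart open_ball]
    by (auto simp: openin_deformed)
  moreover have "topspace X \<subseteq> F1 \<union> F2"
  proof
    fix p assume p: "p \<in> topspace X"
    show "p \<in> F1 \<union> F2"
    proof (cases "p \<in> SK")
      case True
      then show ?thesis
        using skean_subset by (auto simp: F1_def coord_preimage_def)
    next
      case False
      then have "Inl p \<in> pts" using p by (simp add: deformed_points_def)
      then show ?thesis
        using assms(3) by (auto simp: F1_def F2_def)
    qed
  qed
  moreover have E2: "E2 \<subseteq> pts" using assms(2) by (simp add: openin_deformed)
  have "F1 \<inter> F2 = {}"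
  proof (rule ccontr)
    assume "F1 \<inter> F2 \<noteq> {}"
    then obtain p where p: "p \<in> F1" "Inl p \<in> E2" by (auto simp: F2_def)
    then have "p \<in> coord_preimage c (ball 0 \<rho>)" using assms(4) by (auto simp: F1_def)
    moreover have "p \<notin> SK" using p E2 by (auto simp: deformed_points_def)
    ultimately have "Inl p \<in> glue ` D"
      unfolding Inl_in_zc_iff by (auto simp: coord_preimage_def)
    then show False using p assms(6) by blast
  qed
  moreover have "F2 \<noteq> {}"
  proof -
    obtain x where x: "x \<in> E2" "x \<in> pts" "x \<notin> glue ` D"
      using assms(5,6) E2 by blast
    from x(2) show ?thesis
      by (cases x rule: pts_cases) (use x Inr_in_zc_iff in \<open>auto simp: F2_def\<close>)
  qed
  moreover have "0 \<in> snd c ` fst c"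
    using disc rho_pos by auto
  then have "F1 \<noteq> {}"
    using rho_pos by (auto simp: F1_def coord_preimage_def)
  ultimately show False
    using connected unfolding connected_space_def by blast
qed

text \<open>The filled disc is connected, so one side of any separation misses it.\<close>

lemma connected_deformed: "connected_space X'"
  unfolding connected_space_def topspace_deformed
proof (intro notI, elim exE conjE)
  fix E1 E2 assume E: "openin X' E1" "openin X' E2" "pts \<subseteq> E1 \<union> E2" "E1 \<inter> E2 = {}" "E1 \<noteq> {}" "E2 \<noteq> {}"
  let ?W = "\<lambda>E. {z \<in> D. glue z \<in> E}"
  have "open (?W E1)" "open (?W E2)"
    using E by (auto simp: openin_deformed)
  moreover have "D \<subseteq> ?W E1 \<union> ?W E2" "?W E1 \<inter> ?W E2 \<inter> D = {}"
    using E glue_in_pts by auto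
  ultimately have "?W E1 \<inter> D = {} \<or> ?W E2 \<inter> D = {}"
    using connected_D unfolding connected_def by blast
  then consider "E1 \<inter> glue ` D = {}" | "E2 \<inter> glue ` D = {}"
    by auto
  then show False
    using connected_deformed_aux[of E1 E2] connected_deformed_aux[of E2 E1] E by cases auto
qed

text \<open>Two compact images cover the surface: \<open>X\<close> without the open \<sigma>-disc,
  and the closed filled image of the \<sigma>-disc. The latter stays inside \<open>D\<close> because
  \<open>\<sigma> < \<rho>\<close>.\<close>

lemma compact_deformed: "compact_space X'"
proof -
  obtain \<sigma> where s: "0 < \<sigma>" "\<sigma> < \<rho>" "skean \<theta> \<epsilon> \<subseteq> ball 0 \<sigma>"
    by (rule intermediate_radius)
  define C where "C = topspace X - coord_preimage c (ball 0 \<sigma>)"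
  define W where "W = {z. norm (z\<^sup>2 - K) \<le> \<sigma>\<^sup>2}"
  have "\<sigma>\<^sup>2 < \<rho>\<^sup>2" using s by (simp add: power_strict_mono)
  then have WD: "W \<subseteq> D"
    by (auto simp: W_def D_eq)
  have "closed W"
    unfolding W_def by (intro closed_Collect_le continuous_intros)
  \<comment> \<open>A crude radius: combining
    \<open>(norm z)\<^sup>2 \<le> \<sigma>\<^sup>2 + norm K\<close> with
    \<open>2 * norm z \<le> (norm z)\<^sup>2 + 1\<close> avoids a square root.\<close>
  moreover have "W \<subseteq> cball 0 (\<sigma>\<^sup>2 + norm K + 1)"
  proof
    fix z assume "z \<in> W"
    then have "(norm z)\<^sup>2 \<le> \<sigma>\<^sup>2 + norm K"
      using norm_triangle_ineq2[of "z\<^sup>2" K] by (simp add: W_def norm_power)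
    moreover have "2 * norm z \<le> (norm z)\<^sup>2 + 1"
      using zero_le_power2[of "norm z - 1"] by (simp add: power2_eq_square algebra_simps)
    moreover have "0 \<le> \<sigma>\<^sup>2 + norm K" by simp
    ultimately show "z \<in> cball 0 (\<sigma>\<^sup>2 + norm K + 1)"
      unfolding mem_cball_0 by argo
  qed
  ultimately have "compact W"
    by (meson bounded_cball bounded_subset compact_eq_bounded_closed)
  then have "compactin (top_of_set D) W"
    using WD by (simp add: compactin_subtopology)
  moreover have "continuous_map (top_of_set D) X' glue"
    using open_D glue_in_pts by (auto simp: continuous_map_def topspace_deformed openin_deformed openin_open_eq)
  ultimately have 1: "compactin X' (glue ` W)"
    by (rule image_compactin)
  have "closedin X C"
    unfolding C_def using openin_coord_preimage[OF chart open_ball] by (simp add: closedin_diff)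
  then have "compactin X C"
    using compact closedin_compact_space by blast
  moreover have "C \<subseteq> topspace X - SK"
    using s by (auto simp: C_def coord_preimage_def)
  ultimately have "compactin (subtopology X (topspace X - SK)) C"
    by (simp add: compactin_subtopology)
  moreover have "continuous_map (subtopology X (topspace X - SK)) X' Inl"
    unfolding continuous_map_def topspace_deformed
  proof (intro conjI allI impI)
    fix U assume U: "openin X' U"
    then have "{x \<in> topspace (subtopology X (topspace X - SK)). Inl x \<in> U} = Inl -` U"
      by (auto simp: openin_deformed deformed_points_def)
    then show "openin (subtopology X (topspace X - SK)) {x \<in> topspace (subtopology X (topspace X - SK)). Inl x \<in> U}"
      using U open_off_SK[OF openin_topspace] by (auto simp: openin_deformed openin_open_subtopology deformed_points_def)
  qed (auto simp: deformed_points_def)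
  ultimately have 2: "compactin X' (Inl ` C)"
    by (rule image_compactin)
  have "pts \<subseteq> Inl ` C \<union> glue ` W"
  proof
    fix x assume "x \<in> pts"
    then show "x \<in> Inl ` C \<union> glue ` W"
    proof (cases x rule: pts_cases)
      case (1 p)
      show ?thesis
      proof (cases "p \<in> C")
        case False
        then have p: "p \<in> fst c" "norm (snd c p) < \<sigma>"
          using 1 by (auto simp: C_def coord_preimage_def)
        moreover have "snd c p \<notin> skean \<theta> \<epsilon>"
          using 1 p by (auto simp: coord_preimage_def)
        ultimately have "A (snd c p) \<in> W" "glue (A (snd c p)) = x"
          using A_in_iff[OF _ s(1), of "snd c p"] A_in(3)[of p] s 1 by (auto simp: W_def)
        then show ?thesis by blast
      qed (use 1 in simp)
    next
      case (2 z)
      then have "z \<in> W" using slit_power2_bound[OF _ s(1,3), of z] by (simp add: W_def)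
      then show ?thesis using glue_slit[OF 2(2)] unfolding 2(1) by (metis UnI2 imageI)
    qed
  qed
  then have "topspace X' = Inl ` C \<union> glue ` W"
    using compactin_subset_topspace[OF 1] compactin_subset_topspace[OF 2] topspace_deformed by auto
  then show ?thesis
    using compactin_Un[OF 2 1] by (simp add: compact_space_def)
qed

end

section \<open>Complex structure of the deformed surface\<close>

lemma deriv_cong_open:
  assumes "open U" "z \<in> U" "\<And>y. y \<in> U \<Longrightarrow> f y = g y"
  shows "deriv f z = deriv g z"
proof (rule deriv_cong_ev)
  show "eventually (\<lambda>y. f y = g y) (nhds z)"
    using eventually_nhds_in_open[OF assms(1,2)] by (rule eventually_mono) (rule assms(3))
qed simp

lemma open_chart_overlap:
  assumes "chart_on X c" "chart_on X d"
  shows "open (snd c ` (fst c \<inter> fst d))"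
  using assms unfolding chart_on_altdef by (meson Int_lower1 openin_Int)

context skean_surgery
begin

lemma holomorphic_B: "B holomorphic_on - slit \<epsilon>"
  using holomorphic_quad_shift_off_slit[OF eps theta] by simp

lemma fst_res: "fst (res d) = Inl ` (fst d - SK)"
  and snd_res [simp]: "snd (res d) (Inl p) = snd d p"
  by (auto simp: restricted_chart_def)

lemma snd_res_image: "snd (res d) ` (Inl ` P) = snd d ` P"
  by (auto simp: image_image)

lemma transition_deformed:
  assumes "d' \<in> \<A>'" "x \<in> fst d'"
  shows "transition d' e' (snd d' x) = snd e' x"
  using chart_on_deformed[OF assms(1)] assms(2) by (simp add: transition_coord chart_on_altdef)

lemma transition_orig: "\<lbrakk>d \<in> \<A>; p \<in> fst d\<rbrakk> \<Longrightarrow> transition d e (snd d p) = snd e p"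
  by (simp add: transition_coord inj_chart)

lemma res_in_deformed [simp]: "d \<in> \<A> \<Longrightarrow> res d \<in> \<A>'"
  and zc_in_deformed [simp]: "zc \<in> \<A>'"
  by (auto simp: deformed_atlas_def)

lemma deformed_atlas_cases:
  assumes "d' \<in> \<A>'"
  obtains d where "d \<in> \<A>" "d' = res d" | "d' = zc"
  using assms by (auto simp: deformed_atlas_def)

text \<open>Allows a family of coefficients to be defined by distinguishing the \<zeta> chart from
  all others; points of the slit belong to that chart only.\<close>

lemma res_neq_zc: "res d \<noteq> zc"
proof
  assume "res d = zc"
  moreover have "Inr 0 \<in> fst zc"
    using zero_in_slit[OF eps] by (simp add: fst_zc Inr_in_zc_iff)
  ultimately show False
    by (metis Inl_Inr_False fst_res imageE)
qed

lemma coords_zc: "snd zc ` fst zc = D"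
  by (auto simp: fst_zc zc_glue image_image)

lemma snd_zc_Inl: "snd zc (Inl p) = A (snd c p)"
  by (simp add: zeta_chart_def)

lemma overlap_res_res:
  "snd (res d) ` (fst (res d) \<inter> fst (res e)) = snd d ` (fst d \<inter> fst e - SK)"
proof -
  have "fst (res d) \<inter> fst (res e) = Inl ` (fst d \<inter> fst e - SK)"
    by (auto simp: fst_res)
  then show ?thesis
    by (simp add: snd_res_image)
qed

lemma overlap_res_zc:
  assumes "z \<in> snd (res d) ` (fst (res d) \<inter> fst zc)"
  obtains p where "p \<in> fst d" "p \<in> fst c" "norm (snd c p) < \<rho>" "p \<notin> SK" "z = snd d p"
proof -
  obtain x where x: "x \<in> fst (res d)" "x \<in> fst zc" "z = snd (res d) x"
    using assms by blast
  then obtain p where p: "x = Inl p" "p \<in> fst d"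
    unfolding fst_res by blast
  have "Inl p \<in> glue ` D" "z = snd d p"
    using x p by (simp_all add: fst_zc)
  then show ?thesis
    using p by (intro that[of p]) (simp_all add: Inl_in_zc_iff)
qed

lemma overlap_zc_res:
  assumes "z \<in> snd zc ` (fst zc \<inter> fst (res d))"
  shows "z \<in> D" "z \<notin> slit \<epsilon>" "q z \<in> fst d"
proof -
  obtain x where x: "x \<in> fst zc" "x \<in> fst (res d)" "z = snd zc x"
    using assms by blast
  then obtain p where "x = Inl p" "p \<in> fst d"
    unfolding fst_res by blast
  then have p: "Inl p \<in> glue ` D" "p \<in> fst d" "z = A (snd c p)"
    using x by (simp_all add: fst_zc snd_zc_Inl)
  then have p': "p \<in> fst c" "norm (snd c p) < \<rho>" "p \<notin> SK"
    by (auto simp: Inl_in_zc_iff)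
  show "z \<in> D" "z \<notin> slit \<epsilon>"
    using A_in[OF p'] p by auto
  then show "q z \<in> fst d"
    using A_in(3)[OF p'] p glue_off_slit[of z] by simp
qed

lemma transition_res_res:
  assumes "d \<in> \<A>" "e \<in> \<A>" "z \<in> snd (res d) ` (fst (res d) \<inter> fst (res e))"
  shows "transition (res d) (res e) z = transition d e z"
proof -
  obtain p where p: "p \<in> fst d" "p \<in> fst e" "p \<notin> SK" "z = snd d p"
    using assms(3) unfolding overlap_res_res by blast
  then show ?thesis
    using transition_deformed[of "res d" "Inl p" "res e"] transition_orig[of d p e] assms
    by (simp add: fst_res)
qed

text \<open>The new transitions are old ones into \<open>c\<close> followed by \<open>A\<close>. The
  bounds place the argument of \<open>A\<close> where \<open>A\<close> is holomorphic and where the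
  normal form will hold.\<close>

lemma transition_res_zc:
  assumes "d \<in> \<A>" "z \<in> snd (res d) ` (fst (res d) \<inter> fst zc)"
  shows "transition (res d) zc z = A (transition d c z)" "z \<in> snd d ` (fst d \<inter> fst c)"
    "norm (transition d c z) < \<rho>" "transition d c z \<notin> skean \<theta> \<epsilon>"
proof -
  obtain p where p: "p \<in> fst d" "p \<in> fst c" "norm (snd c p) < \<rho>" "p \<notin> SK" "z = snd d p"
    using overlap_res_zc[OF assms(2)] .
  then show "transition (res d) zc z = A (transition d c z)"
    using transition_deformed[of "res d" "Inl p" zc] transition_orig[of d p c] assms
    by (simp add: fst_res snd_zc_Inl)
  show "z \<in> snd d ` (fst d \<inter> fst c)" using p by blast
  show "norm (transition d c z) < \<rho>" "transition d c z \<notin> skean \<theta> \<epsilon>"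
    using transition_orig[of d p c] p assms by (auto simp: coord_preimage_def)
qed

lemma transition_zc_res:
  assumes "d \<in> \<A>" "z \<in> snd zc ` (fst zc \<inter> fst (res d))"
  shows "transition zc (res d) z = transition c d (B z)" "B z \<in> snd c ` (fst c \<inter> fst d)"
    "norm (B z) < \<rho>"
proof -
  note z = overlap_zc_res[OF assms(2)]
  note q = B_in[OF z(1,2)]
  have "glue z \<in> fst zc" "snd zc (glue z) = z"
    using z by (auto simp: fst_zc zc_glue)
  then have "transition zc (res d) z = snd (res d) (glue z)"
    using transition_deformed[of zc "glue z" "res d"] by simp
  also have "\<dots> = transition c d (B z)"
    using transition_orig[OF chart q(3), of d] q z by (simp add: glue_off_slit)
  finally show "transition zc (res d) z = transition c d (B z)" .
  show "B z \<in> snd c ` (fst c \<inter> fst d)"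
    using q z by (metis IntI image_eqI)
  show "norm (B z) < \<rho>" by (rule q)
qed

lemma transition_zc_zc:
  assumes "z \<in> D" shows "transition zc zc z = z"
  using transition_deformed[of zc "glue z" zc] assms by (simp add: zc_glue fst_zc)

lemma transition_deformed_holomorphic:
  assumes "d' \<in> \<A>'" "e' \<in> \<A>'"
  shows "transition d' e' holomorphic_on snd d' ` (fst d' \<inter> fst e')"
  using assms(1)
proof (cases d' rule: deformed_atlas_cases)
  case d: (1 d)
  show ?thesis
    using assms(2)
  proof (cases e' rule: deformed_atlas_cases)
    case e: (1 e)
    have "transition d e holomorphic_on snd (res d) ` (fst (res d) \<inter> fst (res e))"
      using transitions[OF d(1) e(1)] by (rule holomorphic_on_subset) (auto simp: overlap_res_res)
    then show ?thesis
      using holomorphic_transform transition_res_res[OF d(1) e(1)] d(2) e(2) by metis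
  next
    case e: 2
    let ?O = "snd (res d) ` (fst (res d) \<inter> fst zc)"
    have "transition d c holomorphic_on ?O"
      using transitions[OF d(1) chart] by (rule holomorphic_on_subset) (use transition_res_zc(2)[OF d(1)] in blast)
    moreover have "transition d c ` ?O \<subseteq> - skean \<theta> \<epsilon>"
      using transition_res_zc(4)[OF d(1)] by blast
    ultimately have "A \<circ> transition d c holomorphic_on ?O"
      by (rule holomorphic_on_compose_gen[OF _ holomorphic_skean_to_slit[OF eps theta]])
    then show ?thesis
      unfolding d(2) e
      by (rule holomorphic_transform) (use transition_res_zc(1)[OF d(1)] in simp)
  qed
next
  case d: 2
  show ?thesis
    using assms(2)
  proof (cases e' rule: deformed_atlas_cases)
    case e: (1 e)
    let ?O = "snd zc ` (fst zc \<inter> fst (res e))"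
    have "B holomorphic_on ?O"
      using holomorphic_B
      by (rule holomorphic_on_subset) (use overlap_zc_res(2) in blast)
    moreover have "B ` ?O \<subseteq> snd c ` (fst c \<inter> fst e)"
      using transition_zc_res(2)[OF e(1)] by blast
    ultimately have "transition c e \<circ> B holomorphic_on ?O"
      by (rule holomorphic_on_compose_gen[OF _ transitions[OF chart e(1)]])
    then show ?thesis
      unfolding d e(2)
      by (rule holomorphic_transform) (use transition_zc_res(1)[OF e(1)] in simp)
  next
    case e: 2
    have "transition zc zc holomorphic_on D"
      by (rule holomorphic_transform[OF holomorphic_on_ident]) (simp add: transition_zc_zc)
    then show ?thesis
      unfolding d e by (simp add: coords_zc)
  qed
qed

lemma topspace_deformed_atlas: "topspace X' = (\<Union>d'\<in>\<A>'. fst d')"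
proof
  have "fst d' \<subseteq> topspace X'" if "d' \<in> \<A>'" for d'
    using chart_on_deformed[OF that] openin_subset[of X' "fst d'"] by (simp add: chart_on_altdef)
  then show "(\<Union>d'\<in>\<A>'. fst d') \<subseteq> topspace X'"
    by blast
  show "topspace X' \<subseteq> (\<Union>d'\<in>\<A>'. fst d')"
  proof
    fix x assume "x \<in> topspace X'"
    then have "x \<in> pts" by (simp add: topspace_deformed)
    then show "x \<in> (\<Union>d'\<in>\<A>'. fst d')"
    proof (cases x rule: pts_cases)
      case (1 p)
      then obtain d where "d \<in> \<A>" "p \<in> fst d"
        using topspace_eq by auto
      then show ?thesis
        using 1 by (intro UN_I[of "res d"]) (auto simp: fst_res)
    next
      case (2 z)
      then show ?thesis
        by (intro UN_I[of zc]) (auto simp: fst_zc Inr_in_zc_iff)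
    qed
  qed
qed

theorem compact_riemann_surface_deformed: "compact_riemann_surface X' \<A>'"
  unfolding compact_riemann_surface_def riemann_surface_def
  using Hausdorff_deformed connected_deformed chart_on_deformed topspace_deformed_atlas
    transition_deformed_holomorphic compact_deformed by blast

text \<open>Implicit differentiation of \<open>(A w)\<^sup>2 = w\<^sup>2 + K\<close>, for coordinate
  changes in the direction towards \<zeta>.\<close>

lemma A_times_deriv:
  assumes "w \<notin> skean \<theta> \<epsilon>"
  shows "A w * deriv A w = w"
proof -
  have op: "open (- skean \<theta> \<epsilon>)"
    using closed_skean by blast
  then have "(A has_field_derivative deriv A w) (at w)"
    using holomorphic_skean_to_slit[OF eps theta] assms by (auto intro: holomorphic_derivI)
  then have 1: "((\<lambda>w. (A w)\<^sup>2) has_field_derivative 2 * A w * deriv A w) (at w)"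
    by (auto intro!: derivative_eq_intros)
  have "((\<lambda>w. (A w)\<^sup>2) has_field_derivative 2 * w) (at w)"
  proof (rule has_field_derivative_transform_within_open[OF _ op])
    show "((\<lambda>w. w\<^sup>2 + K) has_field_derivative 2 * w) (at w)"
      by (auto intro!: derivative_eq_intros)
  qed (use assms skean_to_slit_power2[OF eps theta] in auto)
  from DERIV_unique[OF 1 this] show ?thesis
    by simp
qed

lemma deriv_transition_cong:
  assumes "d' \<in> \<A>'" "e' \<in> \<A>'" "z \<in> snd d' ` (fst d' \<inter> fst e')"
    and "\<And>y. y \<in> snd d' ` (fst d' \<inter> fst e') \<Longrightarrow> transition d' e' y = g y"
  shows "deriv (transition d' e') z = deriv g z"
  by (rule deriv_cong_open[OF open_chart_overlap[OF chart_on_deformed[OF assms(1)] chart_on_deformed[OF assms(2)]]])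
    (fact assms(3,4))+

lemma transition_derivative:
  assumes "d \<in> \<A>" "e \<in> \<A>" "z \<in> snd d ` (fst d \<inter> fst e)"
  shows "(transition d e has_field_derivative deriv (transition d e) z) (at z)"
  using holomorphic_derivI[OF transitions[OF assms(1,2)] open_chart_overlap[OF charts charts]] assms by blast

lemma B_derivative:
  assumes "z \<notin> slit \<epsilon>"
  shows "(B has_field_derivative deriv B z) (at z)"
  using holomorphic_derivI[OF holomorphic_B] assms closed_slit
  by (auto simp: open_Compl)

lemma A_derivative:
  assumes "w \<notin> skean \<theta> \<epsilon>"
  shows "(A has_field_derivative deriv A w) (at w)"
  using holomorphic_derivI[OF holomorphic_skean_to_slit[OF eps theta]] assms closed_skean
  by (auto simp: open_Compl)

lemma B_times_deriv: "z \<notin> slit \<epsilon> \<Longrightarrow> B z * deriv B z = z"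
  using quad_shift_times_deriv[OF eps theta] by simp

end

section \<open>Extension of the differential\<close>

locale skean_surgery_differential = skean_surgery +
  fixes \<omega> :: "'a chart \<Rightarrow> complex \<Rightarrow> complex"
  assumes abelian: "abelian_differential \<A> \<omega>"
    and normal_form: "\<And>z. z \<in> ball 0 \<rho> \<Longrightarrow> \<omega> c z = z"
begin

lemma differential_holomorphic: "d \<in> \<A> \<Longrightarrow> \<omega> d holomorphic_on snd d ` fst d"
  and differential_transform: "\<lbrakk>d \<in> \<A>; e \<in> \<A>; z \<in> snd d ` (fst d \<inter> fst e)\<rbrakk> \<Longrightarrow>
        \<omega> d z = \<omega> e (transition d e z) * deriv (transition d e) z"
  using abelian unfolding abelian_differential_def by blast+

text \<open>Different charts may have the same restriction, whence the choice.\<close>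

definition extended_differential :: "('a + complex) chart \<Rightarrow> complex \<Rightarrow> complex" where
  "extended_differential d' = (if d' = zc then \<lambda>z. z else \<omega> (SOME d. d \<in> \<A> \<and> res d = d'))"

lemma extended_differential_zc: "extended_differential zc = (\<lambda>z. z)"
  by (simp add: extended_differential_def)

text \<open>Equal restrictions force equal coordinate functions and equal domains off the skean. The
  transition between the two charts is then the identity there, with derivative \<open>1\<close>, so
  the chart that was chosen does not matter.\<close>

lemma extended_differential_res:
  assumes "d \<in> \<A>" "z \<in> snd d ` (fst d - SK)"
  shows "extended_differential (res d) z = \<omega> d z"
proof -
  define e where "e = (SOME e. e \<in> \<A> \<and> res e = res d)"
  have e: "e \<in> \<A>" "res e = res d"
    using someI[of "\<lambda>e. e \<in> \<A> \<and> res e = res d" d] assms(1) by (auto simp: e_def)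
  have eq: "snd e = snd d"
  proof
    fix p show "snd e p = snd d p"
      using snd_res[of e p] snd_res[of d p] e(2) by simp
  qed
  have fst: "fst e - SK = fst d - SK"
    using fst_res[of e] fst_res[of d] e(2) by (simp add: inj_image_eq_iff)
  then have sub: "snd d ` (fst d - SK) \<subseteq> snd d ` (fst d \<inter> fst e)"
    by blast
  have idt: "transition d e y = y" if "y \<in> snd d ` (fst d \<inter> fst e)" for y
    using that transition_orig[OF assms(1), of _ e] unfolding eq by blast
  have "deriv (transition d e) z = deriv (\<lambda>y. y) z"
    by (rule deriv_cong_open[OF open_chart_overlap[OF charts[OF assms(1)] charts[OF e(1)]]])
      (use assms(2) sub idt in auto)
  then have "\<omega> d z = \<omega> e z"
    using differential_transform[OF assms(1) e(1), of z] idt[of z] assms(2) sub by (simp add: subsetD)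
  then show ?thesis
    using res_neq_zc by (simp add: extended_differential_def e_def)
qed

text \<open>Between restricted charts the old transformation rule applies. On mixed overlaps the
  chain rule leaves a factor \<open>A w * deriv A w = w\<close> or
  \<open>B z * deriv B z = z\<close>, which matches the normal form of \<omega> in
  \<open>c\<close>.\<close>

lemma abelian_extended_differential: "abelian_differential \<A>' extended_differential"
  unfolding abelian_differential_def
proof (intro conjI ballI)
  let ?w = extended_differential
  fix d' assume d': "d' \<in> \<A>'"
  show "?w d' holomorphic_on snd d' ` fst d'"
    using d'
  proof (cases d' rule: deformed_atlas_cases)
    case (1 d)
    have "\<omega> d holomorphic_on snd d ` (fst d - SK)"
      using differential_holomorphic[OF 1(1)] by (rule holomorphic_on_subset) auto
    then have "?w (res d) holomorphic_on snd d ` (fst d - SK)"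
      by (rule holomorphic_transform) (simp add: extended_differential_res[OF 1(1)])
    then show ?thesis
      unfolding 1(2) fst_res snd_res_image .
  qed (simp add: extended_differential_zc)
  fix e' z assume e': "e' \<in> \<A>'" and z: "z \<in> snd d' ` (fst d' \<inter> fst e')"
  show "?w d' z = ?w e' (transition d' e' z) * deriv (transition d' e') z"
    using d'
  proof (cases d' rule: deformed_atlas_cases)
    case d: (1 d)
    have z1: "?w d' z = \<omega> d z"
    proof -
      have "z \<in> snd (res d) ` fst (res d)" using z unfolding d(2) by blast
      then have "z \<in> snd d ` (fst d - SK)" unfolding fst_res snd_res_image .
      then show ?thesis using extended_differential_res[OF d(1)] d(2) by blast
    qed
    show ?thesis
      using e'
    proof (cases e' rule: deformed_atlas_cases)
      case e: (1 e)
      have z': "z \<in> snd d ` (fst d \<inter> fst e - SK)"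
        using z by (simp add: d(2) e(2) overlap_res_res)
      have t: "transition d' e' z = transition d e z"
        using transition_res_res[OF d(1) e(1)] z d(2) e(2) by blast
      have "transition d e z \<in> snd e ` (fst e - SK)"
      proof -
        obtain p where "z = snd d p" "p \<in> fst d" "p \<in> fst e" "p \<notin> SK" using z' by blast
        then show ?thesis using transition_orig[OF d(1), of p e] by simp
      qed
      then have "?w e' (transition d' e' z) = \<omega> e (transition d e z)"
        using extended_differential_res[OF e(1)] t e(2) by simp
      moreover have "deriv (transition d' e') z = deriv (transition d e) z"
        using deriv_transition_cong[OF d' e' z] transition_res_res[OF d(1) e(1)] d(2) e(2) by blast
      moreover have "z \<in> snd d ` (fst d \<inter> fst e)"
        using z' by blast
      ultimately show ?thesis
        using z1 differential_transform[OF d(1) e(1)] by simp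
    next
      case e: 2
      note zz = z[unfolded d(2) e]
      note t = transition_res_zc[OF d(1) zz]
      let ?t = "transition d c"
      have "deriv (transition d' e') z = deriv (\<lambda>y. A (?t y)) z"
        using deriv_transition_cong[OF d' e' z] transition_res_zc(1)[OF d(1)] d(2) e by simp
      also have "\<dots> = deriv A (?t z) * deriv ?t z"
        by (rule DERIV_imp_deriv, rule DERIV_chain2, rule A_derivative[OF t(4)],
            rule transition_derivative[OF d(1) chart t(2)])
      finally have "?w e' (transition d' e' z) * deriv (transition d' e') z
          = (A (?t z) * deriv A (?t z)) * deriv ?t z"
        using t(1) d(2) e by (simp add: extended_differential_zc)
      also have "\<dots> = \<omega> c (?t z) * deriv ?t z"
        using A_times_deriv[OF t(4)] normal_form[of "?t z"] t(3) by simp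
      also have "\<dots> = \<omega> d z"
        using differential_transform[OF d(1) chart t(2)] by simp
      finally show ?thesis using z1 by simp
    qed
  next
    case d: 2
    show ?thesis
      using e'
    proof (cases e' rule: deformed_atlas_cases)
      case e: (1 e)
      note zz = z[unfolded d e(2)]
      note t = transition_zc_res[OF e(1) zz]
      note ns = overlap_zc_res(2)[OF zz]
      let ?t = "transition c e"
      obtain p where p: "B z = snd c p" "p \<in> fst c" "p \<in> fst e"
        using t(2) by blast
      then have "?t (B z) \<in> snd e ` (fst e - SK)"
        using transition_orig[OF chart p(2), of e] B_off_slit[OF ns] by (auto simp: coord_preimage_def)
      then have w: "?w e' (transition d' e' z) = \<omega> e (?t (B z))"
        using extended_differential_res[OF e(1)] t(1) d e(2) by simp
      have "deriv (transition d' e') z = deriv (\<lambda>y. ?t (B y)) z"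
        using deriv_transition_cong[OF d' e' z] transition_zc_res(1)[OF e(1)] d e(2) by simp
      also have "\<dots> = deriv ?t (B z) * deriv B z"
        by (rule DERIV_imp_deriv, rule DERIV_chain2, rule transition_derivative[OF chart e(1) t(2)],
            rule B_derivative[OF ns])
      finally have "?w e' (transition d' e' z) * deriv (transition d' e') z
          = \<omega> e (?t (B z)) * deriv ?t (B z) * deriv B z"
        using w by simp
      also have "\<dots> = \<omega> c (B z) * deriv B z"
        using differential_transform[OF chart e(1) t(2)] by simp
      also have "\<dots> = z"
        using normal_form[of "B z"] t(3) B_times_deriv[OF ns] by simp
      finally show ?thesis
        by (simp add: d extended_differential_zc)
    next
      case e: 2
      have "deriv (transition d' e') z = deriv (\<lambda>y. y) z"
        using deriv_transition_cong[OF d' e' z, of "\<lambda>y. y"] transition_zc_zc d e by (simp add: coords_zc)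
      moreover have "z \<in> D" using z by (simp add: d e coords_zc)
      ultimately show ?thesis
        using d e by (simp add: extended_differential_zc transition_zc_zc)
    qed
  qed
qed

theorem deformed_differential_exists: "\<exists>\<omega>'. deformed_differential \<A> \<omega> c \<theta> \<epsilon> \<rho> \<omega>'"
  unfolding deformed_differential_def
  using abelian_extended_differential extended_differential_res by blast

end

section \<open>Periods\<close>

text \<open>Break points are controlled only while the path stays in one chart. Each time has a
  neighbourhood with finitely many bad times, and finitely many such neighbourhoods cover the unit
  interval.\<close>

lemma piecewise_C1_path_differentiable:
  assumes "riemann_surface X \<A>" and path: "piecewise_C1_path X \<A> \<gamma>"
  shows "finite {t \<in> {0..1}. \<not> (\<exists>d\<in>\<A>. \<gamma> t \<in> fst d \<and> (snd d \<circ> \<gamma>) differentiable at t within {0..1})}"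
proof -
  define N where "N = {t \<in> {0..1}. \<not> (\<exists>d\<in>\<A>. \<gamma> t \<in> fst d \<and> (snd d \<circ> \<gamma>) differentiable at t within {0..1})}"
  have cont: "continuous_map (subtopology euclideanreal {0..1}) X \<gamma>"
    using path by (simp add: piecewise_C1_path_def pathin_def)
  have "\<exists>U. open U \<and> t \<in> U \<and> finite (N \<inter> U)" if t: "t \<in> {0..1}" for t
  proof -
    have "\<gamma> t \<in> topspace X"
      using continuous_map_image_subset_topspace[OF cont] t by auto
    then obtain d where d: "d \<in> \<A>" "\<gamma> t \<in> fst d"
      using assms(1) by (auto simp: riemann_surface_def)
    then have "openin X (fst d)"
      using assms(1) by (auto simp: riemann_surface_def chart_on_def)
    then have "openin (top_of_set {0..1}) {s \<in> {0..1}. \<gamma> s \<in> fst d}"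
      using openin_continuous_map_preimage[OF cont, of "fst d"] by simp
    then obtain T where T: "open T" "{s \<in> {0..1}. \<gamma> s \<in> fst d} = {0..1} \<inter> T"
      by (auto simp: openin_open)
    then have "t \<in> T" using d t by blast
    \<comment> \<open>A closed ball, because the smoothness condition speaks of closed time
      intervals; \<open>?a\<close> and \<open>?b\<close> clip it to the unit interval.\<close>
    then obtain e where e: "0 < e" "cball t e \<subseteq> T"
      using T(1) open_contains_cball by blast
    let ?a = "max 0 (t - e)" and ?b = "min 1 (t + e)"
    have sub: "{?a..?b} \<subseteq> {0..1} \<inter> cball t e"
      by (auto simp: dist_real_def)
    then have "\<gamma> ` {?a..?b} \<subseteq> fst d"
      using T(2) e(2) by blast
    moreover have "0 \<le> ?a" "?a \<le> ?b" "?b \<le> 1"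
      using t e by auto
    ultimately have "(snd d \<circ> \<gamma>) piecewise_C1_differentiable_on {?a..?b}"
      using path d(1) unfolding piecewise_C1_path_def by blast
    then obtain S where S: "finite S" "(snd d \<circ> \<gamma>) C1_differentiable_on {?a..?b} - S"
      by (auto simp: piecewise_C1_differentiable_on_def)
    have "N \<inter> ball t e \<subseteq> S"
    proof
      fix s assume s: "s \<in> N \<inter> ball t e"
      show "s \<in> S"
      proof (rule ccontr)
        assume "s \<notin> S"
        moreover have s': "s \<in> {?a..?b}" using s by (auto simp: dist_real_def N_def)
        ultimately have "(snd d \<circ> \<gamma>) differentiable at s within {0..1}"
          using S(2) by (auto simp: C1_differentiable_on_eq intro: differentiable_at_withinI)
        moreover have "\<gamma> s \<in> fst d"
          using s' \<open>\<gamma> ` {?a..?b} \<subseteq> fst d\<close> by blast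
        ultimately show False using s d(1) unfolding N_def by blast
      qed
    qed
    then show ?thesis
      using S(1) e(1) finite_subset by (intro exI[of _ "ball t e"]) auto
  qed
  then have "\<forall>t\<in>{0..1}. \<exists>U. open U \<and> t \<in> U \<and> finite (N \<inter> U)"
    by blast
  from bchoice[OF this] obtain U where U: "\<And>t. t \<in> {0..1} \<Longrightarrow> open (U t) \<and> t \<in> U t \<and> finite (N \<inter> U t)"
    by blast
  obtain C where C: "C \<subseteq> {0..1}" "finite C" "{0..1} \<subseteq> (\<Union>t\<in>C. U t)"
  proof (rule compactE_image[of "{0..1::real}" "{0..1}" U])
    show "{0..1} \<subseteq> (\<Union>t\<in>{0..1}. U t)"
      using U by blast
  qed (use U in auto)
  have "N \<subseteq> (\<Union>t\<in>C. N \<inter> U t)"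
    using C(3) unfolding N_def by blast
  moreover have "finite (\<Union>t\<in>C. N \<inter> U t)"
    using C U by blast
  ultimately show ?thesis
    unfolding N_def[symmetric] by (rule finite_subset)
qed

context skean_surgery_differential
begin

text \<open>\<open>velocity_pairing\<close> selects a chart by \<open>SOME\<close>, and the
  selections on the two surfaces are unrelated. Differentiability in a single chart suffices for
  comparison, since holomorphic transitions carry it to every other.\<close>

lemma velocity_chart_independent:
  assumes path: "pathin X \<gamma>" and t: "t \<in> {0..1}"
    and d: "d \<in> \<A>" "\<gamma> t \<in> fst d" and e: "e \<in> \<A>" "\<gamma> t \<in> fst e"
    and diff: "(snd d \<circ> \<gamma>) differentiable at t within {0..1}"
  shows "\<omega> e (snd e (\<gamma> t)) * vector_derivative (snd e \<circ> \<gamma>) (at t within {0..1})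
       = \<omega> d (snd d (\<gamma> t)) * vector_derivative (snd d \<circ> \<gamma>) (at t within {0..1})"
proof -
  let ?t = "transition d e"
  let ?v = "vector_derivative (snd d \<circ> \<gamma>) (at t within {0..1})"
  let ?z = "snd d (\<gamma> t)"
  have v: "((snd d \<circ> \<gamma>) has_vector_derivative ?v) (at t within {0..1})"
    using diff vector_derivative_works by blast
  have z: "?z \<in> snd d ` (fst d \<inter> fst e)"
    using d e by blast
  have cont: "continuous_map (subtopology euclideanreal {0..1}) X \<gamma>"
    using path by (simp add: pathin_def)
  have "openin (top_of_set {0..1}) {s \<in> {0..1}. \<gamma> s \<in> fst d}"
    using openin_continuous_map_preimage[OF cont openin_chart[OF d(1)]] by simp
  then obtain T where T: "open T" "{s \<in> {0..1}. \<gamma> s \<in> fst d} = {0..1} \<inter> T"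
    by (auto simp: openin_open)
  then have "t \<in> T" using d t by blast
  then obtain r where r: "0 < r" "ball t r \<subseteq> T"
    using T(1) open_contains_ball by blast
  have "(?t has_field_derivative deriv ?t ?z) (at ((snd d \<circ> \<gamma>) t) within (snd d \<circ> \<gamma>) ` {0..1})"
    using transition_derivative[OF d(1) e(1) z] by (simp add: has_field_derivative_at_within)
  from field_vector_diff_chain_within[OF v this]
  have "(?t \<circ> (snd d \<circ> \<gamma>) has_vector_derivative ?v * deriv ?t ?z) (at t within {0..1})" .
  \<comment> \<open>For times within \<open>r\<close> of \<open>t\<close> the path stays in
    \<open>fst d\<close>, where the coordinate of \<open>e\<close> is the transition applied to that
    of \<open>d\<close>.\<close>
  then have "((snd e \<circ> \<gamma>) has_vector_derivative ?v * deriv ?t ?z) (at t within {0..1})"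
  proof (rule has_vector_derivative_transform_within[OF _ r(1) t])
    fix s assume "s \<in> {0..1}" "dist s t < r"
    moreover from this have "s \<in> T" using r(2) by (auto simp: dist_commute)
    ultimately have "\<gamma> s \<in> fst d" using T(2) by blast
    then show "(?t \<circ> (snd d \<circ> \<gamma>)) s = (snd e \<circ> \<gamma>) s"
      using transition_orig[OF d(1)] by simp
  qed
  then have "vector_derivative (snd e \<circ> \<gamma>) (at t within {0..1}) = ?v * deriv ?t ?z"
    using t by (intro vector_derivative_within_closed_interval) auto
  moreover have "\<omega> d ?z = \<omega> e (snd e (\<gamma> t)) * deriv ?t ?z"
    using differential_transform[OF d(1) e(1) z] transition_orig[OF d, of e] by simp
  ultimately show ?thesis
    by simp
qed

end

locale skean_surgery_extension = skean_surgery_differential +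
  fixes \<omega>'
  assumes deformed: "deformed_differential \<A> \<omega> c \<theta> \<epsilon> \<rho> \<omega>'"
begin

lemma deformed_on_res: "\<lbrakk>d \<in> \<A>; p \<in> fst d; p \<notin> SK\<rbrakk> \<Longrightarrow> \<omega>' (res d) (snd d p) = \<omega> d (snd d p)"
  using deformed unfolding deformed_differential_def by blast

text \<open>An admissible \<omega>' is prescribed only in restricted charts; compatibility with
  \<open>res c\<close> forces its coefficient in the \<zeta> chart off the slit, hence almost
  everywhere there.\<close>

lemma deformed_on_zc:
  assumes "z \<in> D" "z \<notin> slit \<epsilon>"
  shows "\<omega>' zc z = z"
proof -
  let ?O = "snd zc ` (fst zc \<inter> fst (res c))"
  note q = B_in[OF assms]
  have t: "transition zc (res c) y = B y" if "y \<in> ?O" for y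
    using transition_zc_res(1,2)[OF chart that] transition_orig[OF chart, of _ c] by force
  have "glue z \<in> fst zc \<inter> fst (res c)"
    using assms(1) q(3,4) glue_off_slit[OF assms(2)] unfolding fst_zc fst_res by (metis DiffI IntI imageI)
  then have z: "z \<in> ?O"
    using zc_glue[OF assms(1)] by (metis imageI)
  have "deriv (transition zc (res c)) z = deriv B z"
    using t chart z by (intro deriv_transition_cong) auto
  moreover have "\<omega>' zc z = \<omega>' (res c) (transition zc (res c) z) * deriv (transition zc (res c)) z"
    using deformed z chart zc_in_deformed res_in_deformed[OF chart]
    unfolding deformed_differential_def abelian_differential_def by blast
  moreover have "\<omega>' (res c) (B z) = B z"
    using deformed_on_res[OF chart q(3,4)] q normal_form[of "B z"] by simp
  ultimately show ?thesis
    using t[OF z] B_times_deriv[OF assms(2)] by simp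
qed

text \<open>The integrands agree at all but finitely many times, and an integral ignores such a
  set.\<close>

lemma path_integral_deformed:
  assumes path: "piecewise_C1_path X \<A> \<gamma>"
    and avoid: "\<gamma> ` {0..1} \<inter> coord_preimage c (ball 0 \<rho>) = {}"
  shows "path_integral \<A>' \<omega>' (Inl \<circ> \<gamma>) = path_integral \<A> \<omega> \<gamma>"
proof -
  let ?N = "{t \<in> {0..1}. \<not> (\<exists>d\<in>\<A>. \<gamma> t \<in> fst d \<and> (snd d \<circ> \<gamma>) differentiable at t within {0..1})}"
  have pathin: "pathin X \<gamma>"
    using path by (simp add: piecewise_C1_path_def)
  have "negligible ?N"
    using piecewise_C1_path_differentiable[OF _ path] surface
    by (auto simp: compact_riemann_surface_def intro: negligible_finite)
  moreover have "velocity_pairing \<A> \<omega> \<gamma> t = velocity_pairing \<A>' \<omega>' (Inl \<circ> \<gamma>) t" if t_in: "t \<in> {0..1} - ?N" for t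
  proof -
    have t: "t \<in> {0..1}" using t_in by blast
    obtain d where d: "d \<in> \<A>" "\<gamma> t \<in> fst d" "(snd d \<circ> \<gamma>) differentiable at t within {0..1}"
      using t_in by blast
    have off: "\<gamma> t \<notin> coord_preimage c (ball 0 \<rho>)"
      using avoid t by blast
    then have nSK: "\<gamma> t \<notin> SK"
      using skean_subset by (auto simp: coord_preimage_def)
    \<comment> \<open>\<open>e\<close> and \<open>f'\<close> are the charts picked by the two
      velocity pairings, and \<open>d\<close> is one in which the path is differentiable at
      \<open>t\<close>. Both picks are compared through \<open>d\<close>.\<close>
    define e where "e = (SOME e. e \<in> \<A> \<and> \<gamma> t \<in> fst e)"
    have e: "e \<in> \<A>" "\<gamma> t \<in> fst e"
      using someI[of "\<lambda>e. e \<in> \<A> \<and> \<gamma> t \<in> fst e" d] d by (auto simp: e_def)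
    define f' where "f' = (SOME f'. f' \<in> \<A>' \<and> (Inl \<circ> \<gamma>) t \<in> fst f')"
    have "Inl (\<gamma> t) \<in> fst (res d)"
      using d nSK by (simp add: fst_res)
    then have f': "f' \<in> \<A>'" "Inl (\<gamma> t) \<in> fst f'"
      using someI[of "\<lambda>f'. f' \<in> \<A>' \<and> (Inl \<circ> \<gamma>) t \<in> fst f'" "res d"] d by (auto simp: f'_def)
    \<comment> \<open>The path avoids the disc, so only restricted charts, in which \<omega>' equals
      \<omega>, contain its points.\<close>
    have "f' \<noteq> zc"
      using f'(2) off by (auto simp: fst_zc Inl_in_zc_iff coord_preimage_def)
    then obtain f where f: "f \<in> \<A>" "f' = res f"
      using deformed_atlas_cases[OF f'(1)] by blast
    then have "\<gamma> t \<in> fst f"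
      using f'(2) by (auto simp: fst_res)
    have "snd f' \<circ> (Inl \<circ> \<gamma>) = snd f \<circ> \<gamma>"
      by (auto simp: f(2))
    then have "velocity_pairing \<A>' \<omega>' (Inl \<circ> \<gamma>) t
        = \<omega> f (snd f (\<gamma> t)) * vector_derivative (snd f \<circ> \<gamma>) (at t within {0..1})"
      unfolding velocity_pairing_def Let_def f'_def[symmetric]
      using deformed_on_res[OF f(1) \<open>\<gamma> t \<in> fst f\<close> nSK] by (simp add: f(2))
    also have "\<dots> = \<omega> d (snd d (\<gamma> t)) * vector_derivative (snd d \<circ> \<gamma>) (at t within {0..1})"
      by (rule velocity_chart_independent[OF pathin t d(1,2) f(1) \<open>\<gamma> t \<in> fst f\<close> d(3)])
    also have "\<dots> = \<omega> e (snd e (\<gamma> t)) * vector_derivative (snd e \<circ> \<gamma>) (at t within {0..1})"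
      by (rule velocity_chart_independent[OF pathin t d(1,2) e d(3), symmetric])
    also have "\<dots> = velocity_pairing \<A> \<omega> \<gamma> t"
      unfolding velocity_pairing_def Let_def e_def[symmetric] ..
    finally show ?thesis by (rule sym)
  qed
  ultimately show ?thesis
    unfolding path_integral_def by (rule integral_spike)
qed

theorem period_deformed:
  assumes "cycle X \<A> C" "\<forall>(n, \<gamma>)\<in>set C. \<gamma> ` {0..1} \<inter> coord_preimage c (ball 0 \<rho>) = {}"
  shows "period \<A>' \<omega>' (transported_chain C) = period \<A> \<omega> C"
proof -
  have "path_integral \<A>' \<omega>' (Inl \<circ> \<gamma>) = path_integral \<A> \<omega> \<gamma>" if "(n, \<gamma>) \<in> set C" for n \<gamma>
    using assms that by (intro path_integral_deformed) (fastforce simp: cycle_def)+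
  then show ?thesis
    unfolding period_def transported_chain_def map_map
    by (intro arg_cong[where f = sum_list] map_cong) auto
qed

end


section \<open>The integral norm\<close>

text \<open>The value \<open>v\<close> is an argument, so that carrying a piece to another chart is
  one implication covering measurability, integrability and value.\<close>

definition integrable_piece ::
    "'a chart set \<Rightarrow> ('a chart \<Rightarrow> complex \<Rightarrow> complex) \<Rightarrow> 'a chart \<Rightarrow> 'a set \<Rightarrow> complex \<Rightarrow> bool" where
  "integrable_piece \<A> \<eta> d E v \<longleftrightarrow> d \<in> \<A> \<and> E \<subseteq> fst d \<and> snd d ` E \<in> sets lebesgue \<and>
     set_integrable lebesgue (snd d ` E) (\<eta> d) \<and> set_lebesgue_integral lebesgue (snd d ` E) (\<eta> d) = v"

lemma has_surface_integral_altdef: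
  "has_surface_integral X \<A> \<eta> I \<longleftrightarrow>
     (\<exists>(n::nat) c E v. (\<forall>i<n. integrable_piece \<A> \<eta> (c i) (E i) (v i)) \<and>
        disjoint_family_on E {..<n} \<and> (\<Union>i<n. E i) = topspace X \<and> I = (\<Sum>i<n. v i))"
proof
  assume "has_surface_integral X \<A> \<eta> I"
  then obtain n c E where *: "\<forall>i<(n::nat). c i \<in> \<A> \<and> E i \<subseteq> fst (c i) \<and> snd (c i) ` E i \<in> sets lebesgue \<and>
                set_integrable lebesgue (snd (c i) ` E i) (\<eta> (c i))"
     "disjoint_family_on E {..<n}" "(\<Union>i<n. E i) = topspace X"
     "I = (\<Sum>i<n. set_lebesgue_integral lebesgue (snd (c i) ` E i) (\<eta> (c i)))"
    unfolding has_surface_integral_def by blast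
  show "\<exists>(n::nat) c E v. (\<forall>i<n. integrable_piece \<A> \<eta> (c i) (E i) (v i)) \<and>
        disjoint_family_on E {..<n} \<and> (\<Union>i<n. E i) = topspace X \<and> I = (\<Sum>i<n. v i)"
    by (rule exI[of _ n], rule exI[of _ c], rule exI[of _ E],
        rule exI[of _ "\<lambda>i. set_lebesgue_integral lebesgue (snd (c i) ` E i) (\<eta> (c i))"])
      (use * in \<open>simp add: integrable_piece_def\<close>)
next
  assume "\<exists>(n::nat) c E v. (\<forall>i<n. integrable_piece \<A> \<eta> (c i) (E i) (v i)) \<and>
        disjoint_family_on E {..<n} \<and> (\<Union>i<n. E i) = topspace X \<and> I = (\<Sum>i<n. v i)"
  then obtain n c E v where *: "\<forall>i<(n::nat). integrable_piece \<A> \<eta> (c i) (E i) (v i)"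
        "disjoint_family_on E {..<n}" "(\<Union>i<n. E i) = topspace X" "I = (\<Sum>i<n. v i)"
    by blast
  have "I = (\<Sum>i<n. set_lebesgue_integral lebesgue (snd (c i) ` E i) (\<eta> (c i)))"
    unfolding *(4) using *(1) by (intro sum.cong) (auto simp: integrable_piece_def)
  moreover have "\<forall>i<n. c i \<in> \<A> \<and> E i \<subseteq> fst (c i) \<and> snd (c i) ` E i \<in> sets lebesgue \<and>
                set_integrable lebesgue (snd (c i) ` E i) (\<eta> (c i))"
    using *(1) unfolding integrable_piece_def by blast
  ultimately show "has_surface_integral X \<A> \<eta> I"
    unfolding has_surface_integral_def using *(2,3) by blast
qed

text \<open>A decomposition is carried over piece by piece, up to one additional null piece.\<close>

lemma has_surface_integral_transport:
  assumes int: "has_surface_integral X \<A> \<eta> I"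
    and pieces: "\<And>d E v. integrable_piece \<A> \<eta> d E v \<Longrightarrow> E \<subseteq> topspace X \<Longrightarrow> \<exists>d'. integrable_piece \<A>' \<eta>' d' (\<Phi> E) v"
    and disj: "\<And>E F. E \<inter> F = {} \<Longrightarrow> \<Phi> E \<inter> \<Phi> F = {}"
    and union: "\<And>E n. (\<Union>i<(n::nat). E i) = topspace X \<Longrightarrow> (\<Union>i<n. \<Phi> (E i)) \<union> N = topspace X'"
    and null: "integrable_piece \<A>' \<eta>' d0 N 0" "\<And>E. E \<subseteq> topspace X \<Longrightarrow> \<Phi> E \<inter> N = {}"
  shows "has_surface_integral X' \<A>' \<eta>' I"
proof -
  obtain n c E v where *: "\<And>i. i < (n::nat) \<Longrightarrow> integrable_piece \<A> \<eta> (c i) (E i) (v i)"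
        "disjoint_family_on E {..<n}" "(\<Union>i<n. E i) = topspace X" "I = (\<Sum>i<n. v i)"
    using int unfolding has_surface_integral_altdef by blast
  have sub: "E i \<subseteq> topspace X" if "i < n" for i
    using *(3) that by blast
  have "\<forall>i\<in>{..<n}. \<exists>d'. integrable_piece \<A>' \<eta>' d' (\<Phi> (E i)) (v i)"
    using pieces *(1) sub by blast
  then obtain c' where c': "\<And>i. i < n \<Longrightarrow> integrable_piece \<A>' \<eta>' (c' i) (\<Phi> (E i)) (v i)"
    by (metis lessThan_iff)
  \<comment> \<open>Index \<open>n\<close> is the extra slot for the null piece, which adds
    \<open>0\<close> to the sum.\<close>
  let ?c = "\<lambda>i. if i < n then c' i else d0"
  let ?E = "\<lambda>i. if i < n then \<Phi> (E i) else N"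
  let ?v = "\<lambda>i. if i < n then v i else 0"
  have "integrable_piece \<A>' \<eta>' (?c i) (?E i) (?v i)" if "i < Suc n" for i
    using c' null(1) that by auto
  moreover have "disjoint_family_on ?E {..<Suc n}"
    using *(2) disj null(2) sub unfolding disjoint_family_on_def by (auto simp: Int_commute)
  moreover have "(\<Union>i<Suc n. ?E i) = topspace X'"
    unfolding union[OF *(3), symmetric] by (auto simp: lessThan_Suc)
  moreover have "I = (\<Sum>i<Suc n. ?v i)"
    using *(4) by simp
  ultimately show ?thesis
    unfolding has_surface_integral_altdef
    by (intro exI[of _ "Suc n"] exI[of _ ?c] exI[of _ ?E] exI[of _ ?v] conjI allI impI)
qed

lemma set_integral_negligible:
  fixes f :: "'a::euclidean_space \<Rightarrow> 'b::euclidean_space"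
  assumes "negligible N"
  shows "N \<in> sets lebesgue" "set_integrable lebesgue N f" "set_lebesgue_integral lebesgue N f = 0"
proof -
  show "N \<in> sets lebesgue"
    using assms negligible_imp_sets by blast
  show i: "set_integrable lebesgue N f"
    using assms by (rule absolutely_integrable_negligible)
  show "set_lebesgue_integral lebesgue N f = 0"
    using set_lebesgue_integral_eq_integral(2)[OF i] integral_negligible[OF assms] by simp
qed

lemma set_integral_Diff_negligible:
  fixes f :: "'a::euclidean_space \<Rightarrow> 'b::euclidean_space"
  assumes "negligible N" "S \<in> sets lebesgue" "set_integrable lebesgue S f"
  shows "S - N \<in> sets lebesgue" "set_integrable lebesgue (S - N) f"
    "set_lebesgue_integral lebesgue (S - N) f = set_lebesgue_integral lebesgue S f"
proof -
  show 1: "S - N \<in> sets lebesgue"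
    using assms set_integral_negligible(1) by blast
  show 2: "set_integrable lebesgue (S - N) f"
    using assms(3) 1 by (rule set_integrable_subset) auto
  have "integral (S - N) f = integral S f"
    using assms(1) by (intro integral_spike_set) (auto elim: negligible_subset)
  then show "set_lebesgue_integral lebesgue (S - N) f = set_lebesgue_integral lebesgue S f"
    using set_lebesgue_integral_eq_integral(2)[OF 2] set_lebesgue_integral_eq_integral(2)[OF assms(3)] by simp
qed

lemma integrable_piece_cong:
  assumes "snd d ` E = snd e ` F" "\<And>z. z \<in> snd e ` F \<Longrightarrow> \<eta> d z = \<eta>' e z"
    "d \<in> \<A>" "E \<subseteq> fst d" "e \<in> \<A>'" "F \<subseteq> fst e"
  shows "integrable_piece \<A> \<eta> d E v \<longleftrightarrow> integrable_piece \<A>' \<eta>' e F v"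
  unfolding integrable_piece_def
  using assms set_integrable_cong[of lebesgue lebesgue "snd e ` F" "snd e ` F" "\<eta> d" "\<eta>' e"]
    set_lebesgue_integral_cong[of "snd e ` F" lebesgue "\<eta> d" "\<eta>' e"]
  by auto

lemma negligible_real_axis: "negligible {z. Im z = 0}"
  using negligible_hyperplane[of \<i> 0] by (simp add: inner_complex_def)

lemma negligible_imaginary_axis: "negligible {z. Re z = 0}"
  using negligible_hyperplane[of "1 :: complex" 0] by (simp add: inner_complex_def)

lemma negligible_slit: "negligible (slit \<epsilon>)"
  by (rule negligible_subset[OF negligible_real_axis]) (auto simp: slit_def)

lemma negligible_skean: "negligible (skean \<theta> \<epsilon>)"
  by (rule negligible_subset[OF negligible_Un[OF negligible_real_axis negligible_imaginary_axis]])
    (auto simp: skean_def)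

section \<open>Transport of decompositions between the two surfaces\<close>

context skean_surgery_extension
begin

text \<open>In \<open>c\<close> the skean lies on the coordinate axes; in any other chart its image
  is null because differentiable maps of the plane preserve null sets.\<close>

lemma negligible_SK_image:
  assumes "d \<in> \<A>" "P \<subseteq> fst d"
  shows "negligible (snd d ` (P \<inter> SK))"
proof -
  have "transition c d differentiable_on snd c ` (fst c \<inter> fst d)"
    using transitions[OF chart assms(1)] by (rule holomorphic_on_imp_differentiable_on)
  then have "transition c d differentiable_on snd c ` (P \<inter> SK)"
    by (rule differentiable_on_subset) (use assms(2) in \<open>auto simp: coord_preimage_def\<close>)
  moreover have "negligible (snd c ` (P \<inter> SK))"
    by (rule negligible_subset[OF negligible_skean]) (auto simp: coord_preimage_def)
  ultimately have "negligible (transition c d ` snd c ` (P \<inter> SK))"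
    by (intro negligible_differentiable_image_negligible) auto
  moreover have "transition c d ` snd c ` (P \<inter> SK) = snd d ` (P \<inter> SK)"
    unfolding image_image
    by (intro image_cong refl transition_orig chart) (auto simp: coord_preimage_def)
  ultimately show ?thesis by simp
qed

lemma integrable_piece_res_iff:
  assumes "d \<in> \<A>" "P \<subseteq> fst d - SK"
  shows "integrable_piece \<A>' (wedge_cnj \<omega>') (res d) (Inl ` P) v \<longleftrightarrow> integrable_piece \<A> (wedge_cnj \<omega>) d P v"
proof (rule integrable_piece_cong)
  show "snd (res d) ` Inl ` P = snd d ` P" by (rule snd_res_image)
  show "wedge_cnj \<omega>' (res d) z = wedge_cnj \<omega> d z" if z: "z \<in> snd d ` P" for z
  proof -
    obtain p where "p \<in> P" "z = snd d p" using z by blast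
    then have "\<omega>' (res d) z = \<omega> d z" using deformed_on_res[OF assms(1), of p] assms(2) by blast
    then show ?thesis by (simp add: wedge_cnj_def)
  qed
qed (use assms in \<open>auto simp: fst_res\<close>)

text \<open>No change of variables occurs in this direction: a piece stripped of the skean keeps its
  coordinate in the restricted chart, and the slit is the added null piece.\<close>

lemma has_surface_integral_forward:
  assumes "has_surface_integral X \<A> (wedge_cnj \<omega>) I"
  shows "has_surface_integral X' \<A>' (wedge_cnj \<omega>') I"
proof (rule has_surface_integral_transport[OF assms, where \<Phi> = "\<lambda>E. Inl ` (E - SK)" and N = "Inr ` slit \<epsilon>" and ?d0.0 = zc])
  fix d E v assume p: "integrable_piece \<A> (wedge_cnj \<omega>) d E v"
  then have d: "d \<in> \<A>" "E \<subseteq> fst d" by (auto simp: integrable_piece_def)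
  \<comment> \<open>Injectivity of the coordinate turns removing the skean into removing a null set
    from the image.\<close>
  have "snd d ` (E - SK) = snd d ` E - snd d ` (E \<inter> SK)"
    using inj_chart[OF d(1)] d(2) inj_on_image_set_diff[of "snd d" "fst d" E "E \<inter> SK"] by (auto simp: Diff_Int)
  then have "integrable_piece \<A> (wedge_cnj \<omega>) d (E - SK) v"
    using p set_integral_Diff_negligible[OF negligible_SK_image[OF d], of "snd d ` E" "wedge_cnj \<omega> d"]
    by (auto simp: integrable_piece_def)
  then have "integrable_piece \<A>' (wedge_cnj \<omega>') (res d) (Inl ` (E - SK)) v"
    using integrable_piece_res_iff[OF d(1), of "E - SK"] d(2) by blast
  then show "\<exists>d'. integrable_piece \<A>' (wedge_cnj \<omega>') d' (Inl ` (E - SK)) v" ..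
next
  have "snd zc ` Inr ` slit \<epsilon> = slit \<epsilon>"
    by (simp add: image_image zeta_chart_def)
  then show "integrable_piece \<A>' (wedge_cnj \<omega>') zc (Inr ` slit \<epsilon>) 0"
    using set_integral_negligible[OF negligible_slit] Inr_in_zc_iff
    by (auto simp: integrable_piece_def fst_zc)
next
  fix E :: "nat \<Rightarrow> 'a set" and n assume "(\<Union>i<n. E i) = topspace X"
  then show "(\<Union>i<n. Inl ` (E i - SK)) \<union> Inr ` slit \<epsilon> = topspace X'"
    unfolding topspace_deformed deformed_points_def by blast
qed auto

text \<open>A piece in the \<zeta> chart may meet the slit and has no counterpart in
  \<open>X\<close> with the same coordinate. Its slit points form a null set, and \<open>B\<close>
  carries the rest injectively into \<open>c\<close>.\<close>

lemma integrable_piece_zc: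
  assumes "integrable_piece \<A>' (wedge_cnj \<omega>') zc E v"
  shows "integrable_piece \<A> (wedge_cnj \<omega>) c (Inl -` E) v"
proof -
  define W where "W = snd zc ` E"
  have E: "E \<subseteq> glue ` D"
    using assms by (simp add: integrable_piece_def fst_zc)
  have WD: "W \<subseteq> D"
    using E zc_glue by (auto simp: W_def)
  have W: "W \<in> sets lebesgue" "set_integrable lebesgue W (wedge_cnj \<omega>' zc)"
      "set_lebesgue_integral lebesgue W (wedge_cnj \<omega>' zc) = v"
    using assms by (auto simp: integrable_piece_def W_def)
  let ?S = "W - slit \<epsilon>"
  note S = set_integral_Diff_negligible[OF negligible_slit[of \<epsilon>] W(1,2)]
  have im: "snd c ` (Inl -` E) = B ` ?S"
  proof (intro equalityI subsetI)
    fix w assume "w \<in> snd c ` (Inl -` E)"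
    then obtain p where p: "Inl p \<in> E" "w = snd c p" by auto
    then have p': "p \<in> fst c" "norm (snd c p) < \<rho>" "p \<notin> SK"
      using E Inl_in_zc_iff by blast+
    then have "A (snd c p) \<in> ?S" "B (A (snd c p)) = w"
      using p A_in[OF p'] B_A[of "snd c p"] snd_zc_Inl[of p]
      by (auto simp: W_def coord_preimage_def intro: image_eqI[where x = "Inl p"])
    then show "w \<in> B ` ?S" by blast
  next
    fix w assume "w \<in> B ` ?S"
    then obtain z where z: "z \<in> W" "z \<notin> slit \<epsilon>" "w = B z" by blast
    then obtain y where y: "y \<in> D" "glue y \<in> E" "z = snd zc (glue y)"
      using E by (auto simp: W_def)
    then have "y = z" by (simp add: zc_glue)
    then have "Inl (q z) \<in> E" "snd c (q z) = w"
      using y z B_in[of z] by (auto simp: glue_off_slit)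
    then show "w \<in> snd c ` (Inl -` E)" by blast
  qed
  \<comment> \<open>The normal form makes \<open>B z\<close> the coefficient in \<open>c\<close>,
    and \<open>B z * deriv B z = z\<close> is the one in the \<zeta> chart, so the Jacobian accounts
    for the whole difference.\<close>
  have eq: "(norm (deriv B z))\<^sup>2 *\<^sub>R wedge_cnj \<omega> c (B z) = wedge_cnj \<omega>' zc z" if "z \<in> ?S" for z
  proof -
    have z: "z \<in> D" "z \<notin> slit \<epsilon>" using that WD by auto
    have "\<omega> c (B z) = B z" using normal_form[of "B z"] B_in[OF z] by simp
    moreover have "\<omega>' zc z = B z * deriv B z"
      using deformed_on_zc[OF z] B_times_deriv[OF z(2)] by simp
    ultimately show ?thesis
      unfolding wedge_cnj_def scaleR_conv_of_real complex_norm_square by simp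
  qed
  have S_eq: "set_integrable lebesgue ?S (\<lambda>z. (norm (deriv B z))\<^sup>2 *\<^sub>R wedge_cnj \<omega> c (B z))"
    using S(2) by (rule iffD1[OF set_integrable_cong, rotated 3]) (auto simp: eq)
  have inj: "inj_on B ?S"
    using bij_betw_quad_shift(2)[OF eps theta] by (auto simp: bij_betw_def intro: inj_on_subset)
  have "open (- slit \<epsilon>)" using closed_slit by blast
  note cv = holomorphic_change_of_variables[OF holomorphic_B this S(1) _ inj S_eq]
  have sub: "?S \<subseteq> - slit \<epsilon>" by blast
  have "(LINT z:?S|lebesgue. (norm (deriv B z))\<^sup>2 *\<^sub>R wedge_cnj \<omega> c (B z)) = v"
    using set_lebesgue_integral_cong[OF S(1), of "\<lambda>z. (norm (deriv B z))\<^sup>2 *\<^sub>R wedge_cnj \<omega> c (B z)" "wedge_cnj \<omega>' zc"] eq S(3) W(3)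
    by auto
  moreover have "Inl -` E \<subseteq> fst c"
    using E Inl_in_zc_iff by blast
  ultimately show ?thesis
    unfolding integrable_piece_def im using cv[OF sub] chart by simp
qed

text \<open>Pieces in restricted charts return with the same coordinate, those in the \<zeta> chart
  by the change of variables. The skean is restored as a null piece in \<open>c\<close>.\<close>

lemma has_surface_integral_backward:
  assumes "has_surface_integral X' \<A>' (wedge_cnj \<omega>') I"
  shows "has_surface_integral X \<A> (wedge_cnj \<omega>) I"
proof (rule has_surface_integral_transport[OF assms, where \<Phi> = "\<lambda>E. Inl -` E" and N = SK and ?d0.0 = c])
  fix d' E v assume p: "integrable_piece \<A>' (wedge_cnj \<omega>') d' E v"
  then have d': "d' \<in> \<A>'" "E \<subseteq> fst d'" by (auto simp: integrable_piece_def)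
  show "\<exists>d. integrable_piece \<A> (wedge_cnj \<omega>) d (Inl -` E) v"
    using d'(1)
  proof (cases d' rule: deformed_atlas_cases)
    case (1 d)
    then have E: "E \<subseteq> Inl ` (fst d - SK)"
      using d'(2) by (simp add: fst_res)
    then have "Inl ` (Inl -` E) = E" "Inl -` E \<subseteq> fst d - SK"
      by auto
    then have "integrable_piece \<A> (wedge_cnj \<omega>) d (Inl -` E) v"
      using integrable_piece_res_iff[OF 1(1), of "Inl -` E"] p 1(2) by metis
    then show ?thesis ..
  next
    case 2
    then show ?thesis using integrable_piece_zc p by blast
  qed
next
  have "negligible (snd c ` SK)"
    by (rule negligible_subset[OF negligible_skean]) (auto simp: coord_preimage_def)
  then show "integrable_piece \<A> (wedge_cnj \<omega>) c SK 0"
    using set_integral_negligible[of "snd c ` SK"] chart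
    by (auto simp: integrable_piece_def coord_preimage_def)
next
  fix E :: "nat \<Rightarrow> ('a + complex) set" and n assume E: "(\<Union>i<n. E i) = topspace X'"
  have "(\<Union>i<n. Inl -` E i) = Inl -` pts"
    using E unfolding topspace_deformed[symmetric] by blast
  also have "\<dots> = topspace X - SK"
    by (auto simp: deformed_points_def)
  finally show "(\<Union>i<n. Inl -` E i) \<union> SK = topspace X"
    using fst_c_subset by (auto simp: coord_preimage_def)
next
  fix E assume "E \<subseteq> topspace X'"
  then show "Inl -` E \<inter> SK = {}"
    unfolding topspace_deformed deformed_points_def by blast
qed auto

theorem integral_norm_deformed: "integral_norm X' \<A>' \<omega>' = integral_norm X \<A> \<omega>"
proof -
  have "has_surface_integral X' \<A>' (wedge_cnj \<omega>') = has_surface_integral X \<A> (wedge_cnj \<omega>)"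
    using has_surface_integral_forward has_surface_integral_backward by blast
  then show ?thesis
    unfolding integral_norm_def surface_integral_def by simp
qed

end

theorem mainTheorem10:
  fixes \<theta> :: real
  assumes "0 \<le> \<theta>" and "\<theta> \<le> pi / 2"
  shows
    "(\<forall>\<epsilon>>0. riemann_mapping (S_map \<epsilon>) (outer_domain \<epsilon>) (- slit \<epsilon>) \<and>
             riemann_mapping (K_map \<theta> \<epsilon>) (outer_domain \<epsilon>) (- skean \<theta> \<epsilon>)) \<and>
     (\<exists>F. holomorphic_family_from_identity F \<and>
        (\<forall>\<delta>>0. \<exists>r>0. \<forall>\<epsilon>>0. \<epsilon>\<^sup>2 < r \<longrightarrow>
           (\<forall>w. norm w > \<delta> \<longrightarrow>
              w \<notin> skean \<theta> \<epsilon> \<and> F (complex_of_real (\<epsilon>\<^sup>2)) w = skean_to_slit \<theta> \<epsilon> w)) \<and>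
        (\<forall>w. w \<noteq> 0 \<longrightarrow>
           first_variation F w = complex_of_real (1 + cos (2 * \<theta>)) / w \<and>
           second_variation F w =
             complex_of_real (- 1 - 4 * cos (2 * \<theta>) + cos (4 * \<theta>) - 4 * (cos (2 * \<theta>))\<^sup>2)
               / (2 * w ^ 3))) \<and>
     (\<forall>\<epsilon>>0. \<exists>g. g holomorphic_on UNIV \<and>
        (\<forall>\<zeta> \<in> - slit \<epsilon>. g \<zeta> = pushforward (skean_to_slit \<theta> \<epsilon>) (- skean \<theta> \<epsilon>) (\<lambda>w. w) \<zeta>) \<and>
        g 0 = 0 \<and> zorder g 0 = 1) \<and>
     (\<forall>(X :: 'a topology) \<A> \<omega> c \<rho> \<epsilon>.
        compact_riemann_surface X \<A> \<and> abelian_differential \<A> \<omega> \<and>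
        c \<in> \<A> \<and> ball 0 \<rho> \<subseteq> snd c ` fst c \<and> (\<forall>z \<in> ball 0 \<rho>. \<omega> c z = z) \<and>
        0 < \<epsilon> \<and> skean \<theta> \<epsilon> \<subseteq> ball 0 \<rho> \<longrightarrow>
        compact_riemann_surface (deformed_surface X c \<theta> \<epsilon> \<rho>) (deformed_atlas \<A> c \<theta> \<epsilon> \<rho>) \<and>
        (\<exists>\<omega>'. deformed_differential \<A> \<omega> c \<theta> \<epsilon> \<rho> \<omega>') \<and>
        (\<forall>\<omega>'. deformed_differential \<A> \<omega> c \<theta> \<epsilon> \<rho> \<omega>' \<longrightarrow>
           (\<forall>C. cycle X \<A> C \<and>
                (\<forall>(n, \<gamma>)\<in>set C. \<gamma> ` {0..1} \<inter> coord_preimage c (ball 0 \<rho>) = {}) \<longrightarrow>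
                period (deformed_atlas \<A> c \<theta> \<epsilon> \<rho>) \<omega>' (transported_chain C) = period \<A> \<omega> C) \<and>
           integral_norm (deformed_surface X c \<theta> \<epsilon> \<rho>) (deformed_atlas \<A> c \<theta> \<epsilon> \<rho>) \<omega>'
             = integral_norm X \<A> \<omega>))"
proof (intro conjI)
  show "\<forall>\<epsilon>>0. riemann_mapping (S_map \<epsilon>) (outer_domain \<epsilon>) (- slit \<epsilon>) \<and>
             riemann_mapping (K_map \<theta> \<epsilon>) (outer_domain \<epsilon>) (- skean \<theta> \<epsilon>)"
    using riemann_mapping_S_map riemann_mapping_K_map assms by blast
  have "\<exists>r>0. \<forall>\<epsilon>>0. \<epsilon>\<^sup>2 < r \<longrightarrow>
           (\<forall>w. norm w > \<delta> \<longrightarrow>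
              w \<notin> skean \<theta> \<epsilon> \<and> quad_family \<theta> (complex_of_real (\<epsilon>\<^sup>2)) w = skean_to_slit \<theta> \<epsilon> w)"
    if "\<delta> > 0" for \<delta>
    using quad_family_eq_skean_to_slit[OF assms that] that by (intro exI[of _ "\<delta>\<^sup>2 / 4"]) auto
  then show "\<exists>F. holomorphic_family_from_identity F \<and>
        (\<forall>\<delta>>0. \<exists>r>0. \<forall>\<epsilon>>0. \<epsilon>\<^sup>2 < r \<longrightarrow>
           (\<forall>w. norm w > \<delta> \<longrightarrow>
              w \<notin> skean \<theta> \<epsilon> \<and> F (complex_of_real (\<epsilon>\<^sup>2)) w = skean_to_slit \<theta> \<epsilon> w)) \<and>
        (\<forall>w. w \<noteq> 0 \<longrightarrow>
           first_variation F w = complex_of_real (1 + cos (2 * \<theta>)) / w \<and>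
           second_variation F w =
             complex_of_real (- 1 - 4 * cos (2 * \<theta>) + cos (4 * \<theta>) - 4 * (cos (2 * \<theta>))\<^sup>2)
               / (2 * w ^ 3))"
    using holomorphic_family_quad_family[of \<theta>] variations_quad_family
    by (intro exI[of _ "quad_family \<theta>"] conjI allI impI) auto
  show "\<forall>\<epsilon>>0. \<exists>g. g holomorphic_on UNIV \<and>
        (\<forall>\<zeta> \<in> - slit \<epsilon>. g \<zeta> = pushforward (skean_to_slit \<theta> \<epsilon>) (- skean \<theta> \<epsilon>) (\<lambda>w. w) \<zeta>) \<and>
        g 0 = 0 \<and> zorder g 0 = 1"
  proof (intro allI impI)
    fix \<epsilon> :: real assume "0 < \<epsilon>"
    \<comment> \<open>The pushforward is \<open>\<zeta> d\<zeta>\<close>, so the identity function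
      is the extension across the slit.\<close>
    then show "\<exists>g. g holomorphic_on UNIV \<and>
        (\<forall>\<zeta> \<in> - slit \<epsilon>. g \<zeta> = pushforward (skean_to_slit \<theta> \<epsilon>) (- skean \<theta> \<epsilon>) (\<lambda>w. w) \<zeta>) \<and>
        g 0 = 0 \<and> zorder g 0 = 1"
      using pushforward_skean_to_slit[OF _ assms] zorder_id_0 by (intro exI[of _ "\<lambda>z. z"]) auto
  qed
  show "\<forall>(X :: 'a topology) \<A> \<omega> c \<rho> \<epsilon>.
        compact_riemann_surface X \<A> \<and> abelian_differential \<A> \<omega> \<and>
        c \<in> \<A> \<and> ball 0 \<rho> \<subseteq> snd c ` fst c \<and> (\<forall>z \<in> ball 0 \<rho>. \<omega> c z = z) \<and>
        0 < \<epsilon> \<and> skean \<theta> \<epsilon> \<subseteq> ball 0 \<rho> \<longrightarrow>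
        compact_riemann_surface (deformed_surface X c \<theta> \<epsilon> \<rho>) (deformed_atlas \<A> c \<theta> \<epsilon> \<rho>) \<and>
        (\<exists>\<omega>'. deformed_differential \<A> \<omega> c \<theta> \<epsilon> \<rho> \<omega>') \<and>
        (\<forall>\<omega>'. deformed_differential \<A> \<omega> c \<theta> \<epsilon> \<rho> \<omega>' \<longrightarrow>
           (\<forall>C. cycle X \<A> C \<and>
                (\<forall>(n, \<gamma>)\<in>set C. \<gamma> ` {0..1} \<inter> coord_preimage c (ball 0 \<rho>) = {}) \<longrightarrow>
                period (deformed_atlas \<A> c \<theta> \<epsilon> \<rho>) \<omega>' (transported_chain C) = period \<A> \<omega> C) \<and>
           integral_norm (deformed_surface X c \<theta> \<epsilon> \<rho>) (deformed_atlas \<A> c \<theta> \<epsilon> \<rho>) \<omega>'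
             = integral_norm X \<A> \<omega>)"
  proof (intro allI impI; elim conjE)
    fix X :: "'a topology" and \<A> \<omega> c \<rho> \<epsilon>
    assume hyps: "compact_riemann_surface X \<A>" "abelian_differential \<A> \<omega>" "c \<in> \<A>"
      "ball 0 \<rho> \<subseteq> snd c ` fst c" "\<forall>z \<in> ball 0 \<rho>. \<omega> c z = z" "0 < \<epsilon>" "skean \<theta> \<epsilon> \<subseteq> ball 0 \<rho>"
    interpret skean_surgery_differential X \<A> c \<theta> \<epsilon> \<rho> \<omega>
      by unfold_locales (use assms hyps in auto)
    show "compact_riemann_surface (deformed_surface X c \<theta> \<epsilon> \<rho>) (deformed_atlas \<A> c \<theta> \<epsilon> \<rho>) \<and>
        (\<exists>\<omega>'. deformed_differential \<A> \<omega> c \<theta> \<epsilon> \<rho> \<omega>') \<and>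
        (\<forall>\<omega>'. deformed_differential \<A> \<omega> c \<theta> \<epsilon> \<rho> \<omega>' \<longrightarrow>
           (\<forall>C. cycle X \<A> C \<and>
                (\<forall>(n, \<gamma>)\<in>set C. \<gamma> ` {0..1} \<inter> coord_preimage c (ball 0 \<rho>) = {}) \<longrightarrow>
                period (deformed_atlas \<A> c \<theta> \<epsilon> \<rho>) \<omega>' (transported_chain C) = period \<A> \<omega> C) \<and>
           integral_norm (deformed_surface X c \<theta> \<epsilon> \<rho>) (deformed_atlas \<A> c \<theta> \<epsilon> \<rho>) \<omega>'
             = integral_norm X \<A> \<omega>)"
    proof (intro conjI allI impI; (elim conjE)?)
      fix \<omega>' assume "deformed_differential \<A> \<omega> c \<theta> \<epsilon> \<rho> \<omega>'"
      then interpret skean_surgery_extension X \<A> c \<theta> \<epsilon> \<rho> \<omega> \<omega>'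
        by unfold_locales
      show "integral_norm (deformed_surface X c \<theta> \<epsilon> \<rho>) (deformed_atlas \<A> c \<theta> \<epsilon> \<rho>) \<omega>'
             = integral_norm X \<A> \<omega>"
        by (rule integral_norm_deformed)
      show "period (deformed_atlas \<A> c \<theta> \<epsilon> \<rho>) \<omega>' (transported_chain C) = period \<A> \<omega> C"
        if "cycle X \<A> C" "\<forall>(n, \<gamma>)\<in>set C. \<gamma> ` {0..1} \<inter> coord_preimage c (ball 0 \<rho>) = {}" for C
        using that by (rule period_deformed)
    qed (rule compact_riemann_surface_deformed deformed_differential_exists)+
  qed
qed

end
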